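(* For any constant $\delta<2$, there is no polynomial-time $\delta$-approximation algorithm for the red-blue \textsc{Pebbling} problem in the \textsc{oneshot} model (i.e. an algorithm that, given a DAG and $R$, outputs a pebbling with at most $R$ red pebbles of cost at most $\delta$ times the minimum possible cost), unless the unique games conjecture is false.
   Context: Red-blue pebble game on a DAG in the \textsc{oneshot} model: initially no node has a pebble. A pebbling is a finite sequence of steps of the following kinds: (1) replace a blue pebble on a node by a red pebble (cost 1); (2) replace a red pebble on a node by a blue pebble (cost 1); (3) compute: if all in-neighbours (inputs) of a node $v$ carry a red pebble, place a red pebble on $v$ (for a source node this is always allowed), cost 0, and this step may be applied to each node at most once during the whole pebbling; (4) delete a (red or blue) pebble from a node (cost 0). At every moment at most $R$ red pebbles may be on the DAG. The pebbling is complete when every sink carries a pebble (of either colour). The cost of a pebbling is the total number of steps of types (1) and (2); the \textsc{Pebbling} problem asks to minimize this cost for given DAG and $R$.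
   Formalization: The formal theorem also assumes P ≠ NP: the unique games conjecture is read as an NP-hardness claim, which holds trivially if P = NP, and then optimal oneshot pebblings can be computed in polynomial time, so the claim would fail. *)

theory Defs
  imports Complex_Main
begin

section \<open>Polynomial-time computation\<close>

text \<open>
  Deterministic Turing machines with finitely many two-way infinite tapes, over binary strings.
  States and tape symbols are initial segments of the natural numbers: \<open>0\<close> is the start state,
  \<open>1\<close> the halting state, and the symbols \<open>0\<close>, \<open>1\<close>, \<open>2\<close> are the blank and the two bits.
  The transition function maps a state and the scanned symbols (one per tape) to a new state and,
  for each tape, the symbol to write and a head movement in \<open>{-1, 0, 1}\<close>.  Only its values on the
  finite domain described in \<open>wf_tm\<close> are relevant, so a machine is a finite object.
\<close>

record tm =
  tapes :: nat
  states :: nat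
  symbols :: nat
  delta :: "nat \<Rightarrow> nat list \<Rightarrow> nat \<times> (nat \<times> int) list"

definition wf_tm :: "tm \<Rightarrow> bool" where
  "wf_tm M \<longleftrightarrow> 1 \<le> tapes M \<and> 2 \<le> states M \<and> 3 \<le> symbols M \<and>
     (\<forall>q < states M. \<forall>as. length as = tapes M \<and> set as \<subseteq> {..<symbols M} \<longrightarrow>
        (case delta M q as of (q', acts) \<Rightarrow>
           q' < states M \<and> length acts = tapes M \<and>
           set acts \<subseteq> {..<symbols M} \<times> {-1, 0, 1}))"

text \<open>A tape is given by its head position and its contents.\<close>

type_synonym tape = "int \<times> (int \<Rightarrow> nat)"

fun tm_step :: "tm \<Rightarrow> nat \<times> tape list \<Rightarrow> nat \<times> tape list" where
  "tm_step M (q, ts) =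
     (if q = 1 then (q, ts)
      else case delta M q (map (\<lambda>(h, t). t h) ts) of (q', acts) \<Rightarrow>
        (q', map2 (\<lambda>(h, t) (a, d). (h + d, t(h := a))) ts acts))"

definition contents_of :: "bool list \<Rightarrow> int \<Rightarrow> nat" where
  "contents_of x i =
     (if 0 \<le> i \<and> i < int (length x) then (if x ! nat i then 2 else 1) else 0)"

definition init_config :: "tm \<Rightarrow> bool list \<Rightarrow> nat \<times> tape list" where
  "init_config M x = (0, (0, contents_of x) # replicate (tapes M - 1) (0, \<lambda>_. 0))"

text \<open>Input and output are both on the first tape; all other tapes are work tapes.\<close>

definition tm_outputs :: "tm \<Rightarrow> bool list \<Rightarrow> nat \<Rightarrow> bool list \<Rightarrow> bool" where
  "tm_outputs M x t y \<longleftrightarrow>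
     (\<exists>h ts. (tm_step M ^^ t) (init_config M x) = (1, (h, contents_of y) # ts))"

definition poly_time :: "(bool list \<Rightarrow> bool list) \<Rightarrow> bool" where
  "poly_time f \<longleftrightarrow>
     (\<exists>M c d. wf_tm M \<and> (\<forall>x. \<exists>t \<le> c * length x ^ d + c. tm_outputs M x t (f x)))"


section \<open>P, NP and NP-hardness of promise problems\<close>

definition tag :: "bool list \<Rightarrow> bool list" where
  "tag x = concat (map (\<lambda>b. [False, b]) x)"

definition pair :: "bool list \<Rightarrow> bool list \<Rightarrow> bool list" where
  "pair x w = tag x @ [True, True] @ w"

definition class_P :: "bool list set set" where
  "class_P = {L. poly_time (\<lambda>x. [x \<in> L])}"

definition class_NP :: "bool list set set" where
  "class_NP = {L. \<exists>V \<in> class_P. \<exists>c d.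
     \<forall>x. x \<in> L \<longleftrightarrow> (\<exists>w. length w \<le> c * length x ^ d + c \<and> pair x w \<in> V)}"

definition NP_hard_promise :: "bool list set \<Rightarrow> bool list set \<Rightarrow> bool" where
  "NP_hard_promise Yes No \<longleftrightarrow>
     (\<forall>L \<in> class_NP. \<exists>f. poly_time f \<and>
        (\<forall>x. (x \<in> L \<longrightarrow> f x \<in> Yes) \<and> (x \<notin> L \<longrightarrow> f x \<in> No)))"


section \<open>Encoding of instances and solutions\<close>

text \<open>
  All objects are presented as lists of lists of natural numbers, with the numbers in binary, least
  significant bit first.  A pair of bits starting with \<open>False\<close> carries a digit;
  \<open>[True, False]\<close> ends a number and \<open>[True, True]\<close> ends an inner list.
\<close>

fun bin :: "nat \<Rightarrow> bool list" where
  "bin n = (if n = 0 then [] else odd n # bin (n div 2))"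

declare bin.simps [simp del]

definition enc_nat :: "nat \<Rightarrow> bool list" where
  "enc_nat n = tag (bin n) @ [True, False]"

definition enc_list :: "nat list \<Rightarrow> bool list" where
  "enc_list xs = concat (map enc_nat xs) @ [True, True]"

definition enc :: "nat list list \<Rightarrow> bool list" where
  "enc xss = concat (map enc_list xss)"

lemma bin_inj: "bin m = bin n \<Longrightarrow> m = n"
proof (induction m arbitrary: n rule: less_induct)
  case (less m)
  show ?case
  proof (cases "m = 0 \<or> n = 0")
    case True
    then show ?thesis using less.prems by (auto simp: bin.simps split: if_splits)
  next
    case False
    then have *: "odd m = odd n" "bin (m div 2) = bin (n div 2)"
      using less.prems by (auto simp: bin.simps[of m] bin.simps[of n])
    have "m div 2 = n div 2" using less.IH[of "m div 2"] False *(2) by simp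
    moreover have "m mod 2 = n mod 2" using *(1) by presburger
    ultimately show ?thesis by (metis div_mult_mod_eq)
  qed
qed

lemma tag_append_inj:
  "tag x @ True # u = tag y @ True # v \<Longrightarrow> x = y \<and> u = v"
proof (induction x arbitrary: y)
  case Nil
  then show ?case by (cases y) (auto simp: tag_def)
next
  case (Cons a x)
  then show ?case by (cases y) (auto simp: tag_def)
qed

lemma enc_nat_append_inj: "enc_nat m @ u = enc_nat n @ v \<Longrightarrow> m = n \<and> u = v"
  using tag_append_inj[of "bin m" "False # u" "bin n" "False # v"] bin_inj
  by (auto simp: enc_nat_def)

lemma enc_nat_ne_end: "enc_nat m @ u \<noteq> True # True # v"
  by (cases "bin m") (auto simp: enc_nat_def tag_def)

lemma enc_list_append_inj: "enc_list xs @ u = enc_list ys @ v \<Longrightarrow> xs = ys \<and> u = v"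
proof (induction xs arbitrary: ys)
  case Nil
  then show ?case
    using enc_nat_ne_end by (cases ys) (auto simp: enc_list_def dest: sym)
next
  case (Cons a xs)
  show ?case
  proof (cases ys)
    case Nil
    then show ?thesis using Cons.prems enc_nat_ne_end by (auto simp: enc_list_def)
  next
    case (Cons b ys')
    then have "enc_nat a @ (enc_list xs @ u) = enc_nat b @ (enc_list ys' @ v)"
      using Cons.prems by (simp add: enc_list_def)
    then show ?thesis using enc_nat_append_inj Cons.IH Cons by blast
  qed
qed

lemma enc_inj: "enc xss = enc yss \<Longrightarrow> xss = yss"
proof (induction xss arbitrary: yss)
  case Nil
  then show ?case by (cases yss) (auto simp: enc_def enc_list_def)
next
  case (Cons xs xss)
  show ?case
  proof (cases yss)
    case Nil
    then show ?thesis using Cons.prems by (auto simp: enc_def enc_list_def)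
  next
    case (Cons ys yss')
    then have "enc_list xs @ enc xss = enc_list ys @ enc yss'"
      using Cons.prems by (simp add: enc_def)
    then show ?thesis using enc_list_append_inj Cons.IH Cons by blast
  qed
qed


section \<open>The unique games conjecture\<close>

text \<open>
  A unique game on \<open>k\<close> labels is a bipartite multigraph, given by its nonempty list of edges
  \<open>(v, w, \<pi>)\<close> between a left vertex \<open>v\<close> and a right vertex \<open>w\<close>, where the list \<open>\<pi>\<close> is a
  permutation of the labels \<open>0, \<dots>, k - 1\<close>.  The two sides have separate name spaces.
  Every listed edge has the same weight; repeated edges express rational weights.
\<close>

type_synonym unique_game = "(nat \<times> nat \<times> nat list) list"

definition is_unique_game :: "nat \<Rightarrow> unique_game \<Rightarrow> bool" where
  "is_unique_game k I \<longleftrightarrow>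
     I \<noteq> [] \<and> (\<forall>(v, w, \<pi>) \<in> set I. distinct \<pi> \<and> set \<pi> = {..<k})"

definition satisfied_fraction ::
    "unique_game \<Rightarrow> (nat \<Rightarrow> nat) \<Rightarrow> (nat \<Rightarrow> nat) \<Rightarrow> real" where
  "satisfied_fraction I a b =
     real (length (filter (\<lambda>(v, w, \<pi>). \<pi> ! a v = b w) I)) / real (length I)"

definition ug_value :: "nat \<Rightarrow> unique_game \<Rightarrow> real" where
  "ug_value k I =
     Max {satisfied_fraction I a b | a b. range a \<subseteq> {..<k} \<and> range b \<subseteq> {..<k}}"

definition enc_ug :: "unique_game \<Rightarrow> bool list" where
  "enc_ug I = enc (map (\<lambda>(v, w, \<pi>). v # w # \<pi>) I)"

definition UGC :: bool where
  "UGC \<longleftrightarrow> (\<forall>\<zeta> > 0. \<forall>\<gamma> > 0. \<exists>k > 0.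
     NP_hard_promise
       {enc_ug I | I. is_unique_game k I \<and> ug_value k I \<ge> 1 - \<zeta>}
       {enc_ug I | I. is_unique_game k I \<and> ug_value k I \<le> \<gamma>})"


section \<open>The red-blue pebble game, oneshot model\<close>

datatype pebble = Red | Blue

datatype 'v step = Load 'v | Save 'v | Compute 'v | Delete 'v

text \<open>
  A configuration consists of the pebble (if any) on each node and the set of nodes to which the
  compute step has already been applied.
\<close>

type_synonym 'v config = "('v \<Rightarrow> pebble option) \<times> 'v set"

inductive pebble_step ::
    "'v set \<Rightarrow> ('v \<times> 'v) set \<Rightarrow> 'v config \<Rightarrow> 'v step \<Rightarrow> 'v config \<Rightarrow> bool"
  for V E where
  load: "c v = Some Blue \<Longrightarrow> pebble_step V E (c, D) (Load v) (c(v \<mapsto> Red), D)"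
| save: "c v = Some Red \<Longrightarrow> pebble_step V E (c, D) (Save v) (c(v \<mapsto> Blue), D)"
| compute: "v \<in> V \<Longrightarrow> v \<notin> D \<Longrightarrow> (\<And>u. (u, v) \<in> E \<Longrightarrow> c u = Some Red) \<Longrightarrow>
    pebble_step V E (c, D) (Compute v) (c(v \<mapsto> Red), insert v D)"
| delete: "c v \<noteq> None \<Longrightarrow> pebble_step V E (c, D) (Delete v) (c(v := None), D)"

text \<open>The bound \<open>R\<close> on red pebbles is imposed on every configuration that is reached.\<close>

inductive pebble_steps ::
    "'v set \<Rightarrow> ('v \<times> 'v) set \<Rightarrow> nat \<Rightarrow> 'v config \<Rightarrow> 'v step list \<Rightarrow> 'v config \<Rightarrow> bool"
  for V E R where
  Nil: "pebble_steps V E R C [] C"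
| Cons: "pebble_step V E C s C' \<Longrightarrow> card {v. fst C' v = Some Red} \<le> R \<Longrightarrow>
    pebble_steps V E R C' ss C'' \<Longrightarrow> pebble_steps V E R C (s # ss) C''"

definition sinks :: "'v set \<Rightarrow> ('v \<times> 'v) set \<Rightarrow> 'v set" where
  "sinks V E = {v \<in> V. \<forall>w. (v, w) \<notin> E}"

definition is_pebbling ::
    "'v set \<Rightarrow> ('v \<times> 'v) set \<Rightarrow> nat \<Rightarrow> 'v step list \<Rightarrow> bool" where
  "is_pebbling V E R ss \<longleftrightarrow>
     (\<exists>c D. pebble_steps V E R (\<lambda>_. None, {}) ss (c, D) \<and> (\<forall>v \<in> sinks V E. c v \<noteq> None))"

fun step_cost :: "'v step \<Rightarrow> nat" where
  "step_cost (Load v) = 1"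
| "step_cost (Save v) = 1"
| "step_cost (Compute v) = 0"
| "step_cost (Delete v) = 0"

definition cost :: "'v step list \<Rightarrow> nat" where
  "cost ss = sum_list (map step_cost ss)"

definition opt_cost :: "'v set \<Rightarrow> ('v \<times> 'v) set \<Rightarrow> nat \<Rightarrow> nat" where
  "opt_cost V E R = (LEAST m. \<exists>ss. is_pebbling V E R ss \<and> cost ss = m)"


section \<open>Approximation algorithms for pebbling\<close>

text \<open>
  As an input, a digraph on the nodes \<open>0, \<dots>, n - 1\<close> is given by its list \<open>G\<close> of in-neighbour
  lists; its length is \<open>n\<close>, so the size of the input is at least the number of nodes.
\<close>

definition nodes :: "nat list list \<Rightarrow> nat set" where
  "nodes G = {..<length G}"

definition edges :: "nat list list \<Rightarrow> (nat \<times> nat) set" where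
  "edges G = {(u, v). v < length G \<and> u \<in> set (G ! v)}"

definition is_dag :: "nat list list \<Rightarrow> bool" where
  "is_dag G \<longleftrightarrow> (\<forall>us \<in> set G. distinct us) \<and> edges G \<subseteq> nodes G \<times> nodes G \<and> acyclic (edges G)"

definition enc_instance :: "nat list list \<Rightarrow> nat \<Rightarrow> bool list" where
  "enc_instance G R = enc ([R] # G)"

fun enc_step :: "nat step \<Rightarrow> nat list" where
  "enc_step (Load v) = [0, v]"
| "enc_step (Save v) = [1, v]"
| "enc_step (Compute v) = [2, v]"
| "enc_step (Delete v) = [3, v]"

definition enc_pebbling :: "nat step list \<Rightarrow> bool list" where
  "enc_pebbling ss = enc (map enc_step ss)"

text \<open>
  Nothing is required of the output when \<open>R\<close> is too small for any pebbling to exist.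
\<close>

definition approximates_pebbling :: "real \<Rightarrow> (bool list \<Rightarrow> bool list) \<Rightarrow> bool" where
  "approximates_pebbling \<delta> f \<longleftrightarrow>
     (\<forall>G R. is_dag G \<and> (\<exists>ss. is_pebbling (nodes G) (edges G) R ss) \<longrightarrow>
        (\<exists>ss. f (enc_instance G R) = enc_pebbling ss \<and>
              is_pebbling (nodes G) (edges G) R ss \<and>
              real (cost ss) \<le> \<delta> * real (opt_cost (nodes G) (edges G) R)))"

end

theory Submission
  imports Defs
begin

text \<open>A pebbling within any factor of the optimum is free whenever the optimum is 0.  Hence an
  approximation algorithm decides whether a pebbling of cost 0 exists, and it suffices to reduce an
  NP-hard problem to that question.  The unique games conjecture supplies one: telling games of
  value at least 1/2 from games of value at most 1/3.

  Call two claims ``the edge \<open>(v, w, \<pi>)\<close> is satisfied by giving \<open>v\<close> the label \<open>a\<close>'' conflicting if they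
  give different labels to the same vertex.  A game with \<open>m\<close> edges has value at least 1/2 iff there are
  \<open>m / 2\<close> pairwise compatible claims.  In the gadget, the claims and a large number of pads are
  \<open>N = 2 * M\<close> items.  Every pair of items and every single item has a source that feeds it; the
  sink is fed by all items and by the sources of the conflicting pairs and of the single pads.  In a
  free pebbling a node keeps its pebble until all its out-neighbours are computed.  So when the next
  item is computed after a set \<open>P\<close> of \<open>M\<close> items, the number of red pebbles is
  \<open>2 * M\<^sup>2 + 4 * M + 1\<close> plus the number of conflicts in \<open>P\<close> minus the number of claims in \<open>P\<close>.
  The quadratic number of sources makes this moment the peak, so the least budget of a free
  pebbling gives the size of a largest compatible set of claims.\<close>

section \<open>Programs for multi-tape machines\<close>

text \<open>The count at the peak has its form because a conflicting pair keeps its link until the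
  sink is computed and a pad keeps its guard, while a claim releases its guard at once. Conflicts
  are not forbidden: dropping one endpoint of each turns a surplus of claims over conflicts into a
  compatible set. After \<open>j\<close> items the count carries the term
  \<open>- 2 * (M - j)^2\<close>. Claims are only one eighth of the items, so those that were not
  chosen can be postponed until this term pays for all their conflicts. The other obstacle is that
  polynomial time refers to concrete machines. Programs of a small language, whose residual programs
  serve as states, replace machines built by hand, and a program may run a given machine, which
  yields composition. The gadget is laid out for such programs: every nonempty list of in-neighbours
  is printed while a counter runs through the candidates, and the budget is reached by increments.
  The number \<open>k\<close> of labels is a constant, as in the unique games conjecture, so that
  labels of left vertices can be part of the program.\<close>

text \<open>\<open>Mach M off lg q\<close> runs \<open>M\<close> from state \<open>q\<close> on the tapes 0 and \<open>off + 1, off + 2, \<dots>\<close>, and records the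
  moves of its head on tape 0 on tape \<open>lg\<close>, the move \<open>d\<close> as the symbol \<open>d + 2\<close>.\<close>

datatype com = Skip
  | Act nat "(nat \<Rightarrow> nat) \<Rightarrow> nat" int
  | Seq com com
  | Cond "(nat \<Rightarrow> nat) \<Rightarrow> bool" com com
  | Loop "(nat \<Rightarrow> nat) \<Rightarrow> bool" com
  | Mach tm nat nat nat

definition stay :: "(nat \<Rightarrow> nat) \<Rightarrow> nat \<Rightarrow> nat \<times> int" where
  "stay a i = (a i, 0)"

definition tape_index :: "nat \<Rightarrow> nat \<Rightarrow> nat" where
  "tape_index off i = (if i = 0 then 0 else off + i)"

text \<open>A control step rewrites all scanned symbols and moves no head. \<open>Mach\<close> also
  stops on a symbol foreign to \<open>M\<close>: the compiled machine has a larger alphabet, on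
  which the transition function of \<open>M\<close> is unspecified.\<close>

fun nxt :: "com \<Rightarrow> (nat \<Rightarrow> nat) \<Rightarrow> com \<times> (nat \<Rightarrow> nat \<times> int)" where
  "nxt Skip a = (Skip, stay a)"
| "nxt (Act t f d) a = (Skip, (stay a)(t := (f a, d)))"
| "nxt (Seq c c') a =
    (if c = Skip then (c', stay a) else (Seq (fst (nxt c a)) c', snd (nxt c a)))"
| "nxt (Cond p c c') a = (if p a then c else c', stay a)"
| "nxt (Loop p c) a = (if p a then Seq c (Loop p c) else Skip, stay a)"
| "nxt (Mach M off lg q) a =
    (if q = 1 \<or> (\<exists>i<tapes M. symbols M \<le> a (tape_index off i)) then (Skip, stay a)
     else let r = delta M q (map (\<lambda>i. a (tape_index off i)) [0..<tapes M]) in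
       (Mach M off lg (fst r),
        \<lambda>j. if j = 0 then snd r ! 0
            else if off < j \<and> j < off + tapes M then snd r ! (j - off)
            else if j = lg then (nat (snd (snd r ! 0) + 2), 1)
            else (a j, 0)))"

definition app :: "tape \<Rightarrow> nat \<times> int \<Rightarrow> tape" where
  "app t w = (fst t + snd w, (snd t)(fst t := fst w))"

definition syms :: "(nat \<Rightarrow> tape) \<Rightarrow> nat \<Rightarrow> nat" where
  "syms \<sigma> i = snd (\<sigma> i) (fst (\<sigma> i))"

definition cstep :: "com \<times> (nat \<Rightarrow> tape) \<Rightarrow> com \<times> (nat \<Rightarrow> tape)" where
  "cstep z = (fst (nxt (fst z) (syms (snd z))),
              \<lambda>i. app (snd z i) (snd (nxt (fst z) (syms (snd z))) i))"

text \<open>For \<open>Mach\<close>, the bound \<open>4 \<le> S\<close> makes room for the logged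
  moves 1, 2, 3, and the log lies beyond the tapes of the machine.\<close>

fun wf_com :: "nat \<Rightarrow> nat \<Rightarrow> com \<Rightarrow> bool" where
  "wf_com T S Skip \<longleftrightarrow> True"
| "wf_com T S (Act t f d) \<longleftrightarrow>
    t < T \<and> d \<in> {-1, 0, 1} \<and> (\<forall>a. (\<forall>i. a i < S) \<longrightarrow> f a < S)"
| "wf_com T S (Seq c c') \<longleftrightarrow> wf_com T S c \<and> wf_com T S c'"
| "wf_com T S (Cond p c c') \<longleftrightarrow> wf_com T S c \<and> wf_com T S c'"
| "wf_com T S (Loop p c) \<longleftrightarrow> wf_com T S c"
| "wf_com T S (Mach M off lg q) \<longleftrightarrow>
    wf_tm M \<and> q < states M \<and> symbols M \<le> S \<and> 4 \<le> S \<and> off + tapes M \<le> lg \<and> lg < T"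

text \<open>All programs that can arise in a run of the given one: they are the states of the compiled
  machine.\<close>

fun residuals :: "com \<Rightarrow> com set" where
  "residuals Skip = {Skip}"
| "residuals (Act t f d) = {Act t f d, Skip}"
| "residuals (Seq c c') = (\<lambda>c. Seq c c') ` residuals c \<union> residuals c'"
| "residuals (Cond p c c') = {Cond p c c'} \<union> residuals c \<union> residuals c'"
| "residuals (Loop p c) = {Loop p c, Skip} \<union> (\<lambda>c'. Seq c' (Loop p c)) ` residuals c"
| "residuals (Mach M off lg q) = {Skip, Mach M off lg q} \<union> Mach M off lg ` {..<states M}"

lemma finite_residuals: "finite (residuals c)"
  by (induction c) auto

lemma self_in_residuals: "c \<in> residuals c"
  by (induction c) auto

lemma Skip_in_residuals: "Skip \<in> residuals c"
  by (induction c) auto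

section \<open>Compilation of programs into machines\<close>

definition legal :: "nat \<Rightarrow> nat \<Rightarrow> (nat \<Rightarrow> nat) \<Rightarrow> bool" where
  "legal T S a \<longleftrightarrow> (\<forall>i. a i < S) \<and> (\<forall>i\<ge>T. a i = 0)"

lemma wf_tm_delta:
  assumes "wf_tm M" "q < states M" "length as = tapes M" "\<And>i. i < tapes M \<Longrightarrow> as ! i < symbols M"
  shows "fst (delta M q as) < states M" "length (snd (delta M q as)) = tapes M"
    "i < tapes M \<Longrightarrow> fst (snd (delta M q as) ! i) < symbols M"
    "i < tapes M \<Longrightarrow> snd (snd (delta M q as) ! i) \<in> {-1, 0, 1}"
proof -
  have s: "set as \<subseteq> {..<symbols M}" using assms(3,4) by (auto simp: in_set_conv_nth)
  then have *: "fst (delta M q as) < states M \<and> length (snd (delta M q as)) = tapes M \<and>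
      set (snd (delta M q as)) \<subseteq> {..<symbols M} \<times> {-1,0,1}"
    using assms(1-3) unfolding wf_tm_def by (auto simp: split_beta)
  then show "fst (delta M q as) < states M" "length (snd (delta M q as)) = tapes M" by auto
  assume "i < tapes M"
  then have "snd (delta M q as) ! i \<in> {..<symbols M} \<times> {-1,0,1}" using * nth_mem by fastforce
  then show "fst (snd (delta M q as) ! i) < symbols M" "snd (snd (delta M q as) ! i) \<in> {-1, 0, 1}"
    by auto
qed

text \<open>Closure of the finite set of residuals under a step is what makes it usable as the state
  set of the compiled machine.\<close>

lemma nxt_residuals:
  assumes "wf_com T S c0" "c \<in> residuals c0"
  shows "fst (nxt c a) \<in> residuals c0 \<and> wf_com T S c"
  using assms
proof (induction c0 arbitrary: c)
  case (Mach M off lg q)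
  then have c: "c = Skip \<or> (\<exists>q' < states M. c = Mach M off lg q')" by auto
  then show ?case
  proof
    assume "c = Skip"
    then show ?thesis by simp
  next
    assume "\<exists>q'<states M. c = Mach M off lg q'"
    then obtain q' where q': "q' < states M" and c: "c = Mach M off lg q'" by blast
    show ?thesis
    proof (cases "q' = 1 \<or> (\<exists>i<tapes M. symbols M \<le> a (tape_index off i))")
      case True
      then show ?thesis using Mach.prems(1) q' by (auto simp: c)
    next
      case False
      then have "fst (delta M q' (map (\<lambda>i. a (tape_index off i)) [0..<tapes M])) < states M"
        using Mach.prems(1) q' by (intro wf_tm_delta(1)) auto
      then show ?thesis using Mach.prems(1) q'
        unfolding c nxt.simps if_not_P[OF False] Let_def by auto
    qed
  qed
next
  case (Seq c1 c2)
  have w: "wf_com T S c1" "wf_com T S c2" using Seq.prems by auto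
  consider "c \<in> residuals c2" | d where "c = Seq d c2" "d \<in> residuals c1" using Seq.prems by auto
  then show ?case
  proof cases
    case 1
    then show ?thesis using Seq.IH(2)[OF w(2) 1] by simp
  next
    case 2
    then show ?thesis using Seq.IH(1)[OF w(1) 2(2)] w(2) self_in_residuals[of c2] by simp
  qed
next
  case (Cond p c1 c2)
  have w: "wf_com T S c1" "wf_com T S c2" using Cond.prems by auto
  consider "c = Cond p c1 c2" | "c \<in> residuals c1" | "c \<in> residuals c2" using Cond.prems by auto
  then show ?case
  proof cases
    case 1
    then show ?thesis using w self_in_residuals[of c2] self_in_residuals[of c1] by simp
  next
    case 2
    then show ?thesis using Cond.IH(1)[OF w(1) 2] by simp
  next
    case 3
    then show ?thesis using Cond.IH(2)[OF w(2) 3] by simp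
  qed
next
  case (Loop p c1)
  have w: "wf_com T S c1" using Loop.prems by auto
  consider "c = Loop p c1" | "c = Skip" | d where "c = Seq d (Loop p c1)" "d \<in> residuals c1"
    using Loop.prems by auto
  then show ?case
  proof cases
    case 3
    then show ?thesis using Loop.IH[OF w 3(2)] w by simp
  qed (use w self_in_residuals[of c1] in simp_all)
next
  case Skip
  then show ?case by simp
next
  case (Act t f d)
  then show ?case by force
qed

text \<open>The last conjunct says that tapes from \<open>T\<close> on stay blank and at rest, so
  that a machine with \<open>T\<close> tapes loses nothing of the infinite store.\<close>

lemma nxt_act:
  assumes "wf_com T S c" "legal T S a"
  shows "fst (snd (nxt c a) i) < S \<and> snd (snd (nxt c a) i) \<in> {-1,0,1} \<and>
         (T \<le> i \<longrightarrow> snd (nxt c a) i = (0, 0))"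
  using assms
proof (induction c)
  case (Mach M off lg q)
  define as where "as = map (\<lambda>i. a (tape_index off i)) [0..<tapes M]"
  show ?case
  proof (cases "q = 1 \<or> (\<exists>i<tapes M. symbols M \<le> a (tape_index off i))")
    case True
    then show ?thesis using Mach.prems by (auto simp: stay_def legal_def)
  next
    case False
    have w: "wf_tm M" "q < states M" "length as = tapes M" "\<And>i. i < tapes M \<Longrightarrow> as ! i < symbols M"
      using Mach.prems False by (auto simp: as_def not_le)
    note d = wf_tm_delta[OF w]
    have t: "0 < tapes M" using w(1) by (auto simp: wf_tm_def)
    have m: "snd (nxt (Mach M off lg q) a) i = (if i = 0 then snd (delta M q as) ! 0
            else if off < i \<and> i < off + tapes M then snd (delta M q as) ! (i - off)
            else if i = lg then (nat (snd (snd (delta M q as) ! 0) + 2), 1)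
            else (a i, 0))"
      unfolding nxt.simps if_not_P[OF False] Let_def as_def by (simp only: snd_conv)
    have p: "symbols M \<le> S" "4 \<le> S" "off + tapes M \<le> lg" "lg < T" using Mach.prems by auto
    consider "i = 0" | "off < i" "i < off + tapes M" | "i \<noteq> 0" "\<not> (off < i \<and> i < off + tapes M)" by blast
    then show ?thesis
    proof cases
      case 1
      then show ?thesis unfolding m using d(3,4)[of 0] t p by auto
    next
      case 2
      then have "i - off < tapes M" by auto
      then show ?thesis unfolding m using d(3,4)[of "i - off"] 2 p by auto
    next
      case 3
      then show ?thesis unfolding m using d(4)[of 0] t p Mach.prems(2)
        by (auto simp: legal_def)
    qed
  qed
next
  case Skip
  then show ?case by (simp add: stay_def legal_def)
next
  case (Act t f d)
  then show ?case by (auto simp: stay_def legal_def)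
next
  case (Seq c c')
  then show ?case by (simp add: stay_def legal_def)
next
  case (Cond p c c')
  then show ?case by (simp add: stay_def legal_def)
next
  case (Loop p c)
  then show ?case by (simp add: stay_def legal_def)
qed

definition init :: "bool list \<Rightarrow> nat \<Rightarrow> tape" where
  "init x i = (0, if i = 0 then contents_of x else (\<lambda>_. 0))"

text \<open>The machine model fixes 0 as the start state and 1 as the halting state, so a numbering
  of programs has to send the initial program and \<open>Skip\<close> to these two numbers.\<close>

lemma ex_numbering:
  assumes "finite X" "u \<in> X" "v \<in> X" "u \<noteq> v"
  obtains e :: "'a \<Rightarrow> nat" where "inj_on e X" "e ` X \<subseteq> {..<card X}" "e u = 0" "e v = 1" "2 \<le> card X"
proof -
  obtain h n where h: "bij_betw h (X - {u,v}) {0..<n}" and n: "n = card (X - {u,v})"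
    using assms(1) ex_bij_betw_finite_nat[of "X - {u,v}"] by auto
  have "X = insert u (insert v (X - {u,v}))" using assms by blast
  then have "card X = card (insert u (insert v (X - {u,v})))" by simp
  also have "\<dots> = n + 2"
    unfolding n using assms by (subst card_insert_disjoint; simp)+
  finally have c: "card X = n + 2" .
  define e where "e z = (if z = u then 0 else if z = v then 1 else h z + 2)" for z
  have h': "h a < n" if "a \<in> X" "a \<noteq> u" "a \<noteq> v" for a
    using bij_betwE[OF h] that by auto
  have "inj_on e X"
  proof (rule inj_onI)
    fix a b assume ab: "a \<in> X" "b \<in> X" "e a = e b"
    show "a = b"
    proof (cases "a \<in> X - {u,v} \<and> b \<in> X - {u,v}")
      case True
      then show ?thesis using bij_betw_imp_inj_on[OF h] ab(3) by (simp add: e_def inj_on_eq_iff)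
    next
      case False
      then show ?thesis using ab by (auto simp: e_def split: if_splits)
    qed
  qed
  moreover have "e ` X \<subseteq> {..<card X}"
    using h' unfolding c by (auto simp: e_def)
  moreover have "e u = 0" "e v = 1" "2 \<le> card X" using assms(4) c by (auto simp: e_def)
  ultimately show ?thesis using that[of e] by blast
qed

text \<open>A program step is exactly one machine step, so time bounds carry over unchanged. The
  program has to differ from \<open>Skip\<close> because the start state differs from the halting
  state.\<close>

lemma compile:
  assumes wf: "wf_com T S c0" and ne: "c0 \<noteq> Skip" and T: "0 < T" and S: "3 \<le> S"
  obtains M where "wf_tm M"
    "\<And>x n \<sigma>. (cstep ^^ n) (c0, init x) = (Skip, \<sigma>) \<Longrightarrow>
       (tm_step M ^^ n) (init_config M x) = (1, map \<sigma> [0..<T])"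
proof -
  define X where "X = residuals c0"
  obtain e where e: "inj_on e X" "e ` X \<subseteq> {..<card X}" "e c0 = 0" "e Skip = 1" "2 \<le> card X"
    using ex_numbering[of X c0 Skip] finite_residuals self_in_residuals Skip_in_residuals ne unfolding X_def by blast
  define vec where "vec as = (\<lambda>i. if i < T then as ! i else 0 :: nat)" for as
  \<comment> \<open>The fallback \<open>Skip\<close> keeps \<open>dec\<close> inside
    \<open>X\<close> also on numbers that code no program.\<close>
  define dec where "dec q = (if q \<in> e ` X then inv_into X e q else Skip)" for q
  define M where "M = \<lparr>tapes = T, states = card X, symbols = S,
     delta = \<lambda>q as. (e (fst (nxt (dec q) (vec as))), map (snd (nxt (dec q) (vec as))) [0..<T])\<rparr>"
  have dec: "dec q \<in> X" for q
    unfolding dec_def using Skip_in_residuals inv_into_into[of q e X] by (auto simp: X_def)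
  have dece: "c \<in> X \<Longrightarrow> dec (e c) = c" for c
    unfolding dec_def using e(1) by simp
  have wfM: "wf_tm M"
    unfolding wf_tm_def
  proof (intro conjI allI impI)
    fix q as assume q: "q < states M" and as: "length as = tapes M \<and> set as \<subseteq> {..<symbols M}"
    have leg: "legal T S (vec as)"
      using as S nth_mem[of _ as] unfolding legal_def vec_def M_def by fastforce
    have 1: "fst (nxt (dec q) (vec as)) \<in> X" "wf_com T S (dec q)"
      using nxt_residuals[OF wf] dec unfolding X_def by auto
    have 2: "fst (snd (nxt (dec q) (vec as)) i) < S \<and> snd (snd (nxt (dec q) (vec as)) i) \<in> {-1,0,1}" for i
      using nxt_act[OF 1(2) leg] by auto
    have 3: "e (fst (nxt (dec q) (vec as))) < card X" using 1 e(2) by blast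
    have 4: "snd (nxt (dec q) (vec as)) i \<in> {..<S} \<times> {-1,0,1}" for i using 2[of i]
      by (metis SigmaI lessThan_iff prod.collapse)
    show "case delta M q as of (q', acts) \<Rightarrow> q' < states M \<and> length acts = tapes M \<and>
           set acts \<subseteq> {..<symbols M} \<times> {-1, 0, 1}"
    proof -
      have "set (map (snd (nxt (dec q) (vec as))) [0..<T]) \<subseteq> {..<S} \<times> {-1, 0, 1}"
        using 4 by (metis (no_types, lifting) image_subsetI list.set_map)
      then show ?thesis using 3 by (simp add: M_def)
    qed
  qed (use T S e(5) in \<open>auto simp: M_def\<close>)
  have step: "tm_step M (e c, map \<sigma> [0..<T]) = (e (fst (cstep (c, \<sigma>))), map (snd (cstep (c, \<sigma>))) [0..<T])"
    if c: "c \<in> X" and b: "\<And>i. T \<le> i \<Longrightarrow> syms \<sigma> i = 0" for c \<sigma>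
  proof (cases "c = Skip")
    case True
    then show ?thesis using e(4) by (auto simp: cstep_def stay_def app_def syms_def prod_eq_iff)
  next
    case False
    then have ne1: "e c \<noteq> 1" using e(1,4) c Skip_in_residuals unfolding X_def inj_on_def by metis
    have v: "vec (map (\<lambda>(h, t). t h) (map \<sigma> [0..<T])) = syms \<sigma>"
      using b by (auto simp: vec_def syms_def split_beta)
    show ?thesis using ne1 dece[OF c]
      by (simp add: M_def v[simplified] cstep_def split_beta app_def list_eq_iff_nth_eq)
  qed
  \<comment> \<open>Blank tapes from \<open>T\<close> on are needed for \<open>vec\<close> to
    recover all scanned symbols from the first \<open>T\<close> of them.\<close>
  define Inv where "Inv z \<longleftrightarrow> fst z \<in> X \<and> (\<forall>i\<ge>T. snd (snd z i) = (\<lambda>_. 0)) \<and> (\<forall>i p. snd (snd z i) p < S)"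
    for z :: "com \<times> (nat \<Rightarrow> tape)"
  have inv: "Inv (cstep z)" if "Inv z" for z
  proof -
    have leg: "legal T S (syms (snd z))" using that S unfolding Inv_def legal_def syms_def by auto
    have w: "wf_com T S (fst z)" "fst (nxt (fst z) (syms (snd z))) \<in> X"
      using nxt_residuals[OF wf] that unfolding Inv_def X_def by auto
    note a = nxt_act[OF w(1) leg]
    show ?thesis using w(2) a that unfolding Inv_def cstep_def app_def by auto
  qed
  have main: "(tm_step M ^^ n) (init_config M x) =
      (e (fst ((cstep ^^ n) (c0, init x))), map (snd ((cstep ^^ n) (c0, init x))) [0..<T])
      \<and> Inv ((cstep ^^ n) (c0, init x))" for n x
  proof (induction n)
    case 0
    have 1: "init_config M x = (e c0, map (init x) [0..<T])"
      using T e(3) by (auto simp: init_config_def M_def init_def list_eq_iff_nth_eq nth_Cons split: nat.split)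
    have 2: "Inv (c0, init x)" using T S self_in_residuals
      by (auto simp: Inv_def X_def init_def contents_of_def)
    show ?case using 1 2 by simp
  next
    case (Suc n)
    define z where "z = (cstep ^^ n) (c0, init x)"
    have z: "Inv z" "(tm_step M ^^ n) (init_config M x) = (e (fst z), map (snd z) [0..<T])"
      using Suc by (auto simp: z_def)
    have "tm_step M (e (fst z), map (snd z) [0..<T]) = (e (fst (cstep z)), map (snd (cstep z)) [0..<T])"
      using step[of "fst z" "snd z"] z(1) by (auto simp: Inv_def syms_def)
    then show ?case using inv[OF z(1)] z(2) by (simp flip: z_def)
  qed
  show ?thesis
  proof (rule that[OF wfM])
    fix x n \<sigma> assume "(cstep ^^ n) (c0, init x) = (Skip, \<sigma>)"
    then show "(tm_step M ^^ n) (init_config M x) = (1, map \<sigma> [0..<T])"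
      using main[of n x] e(4) by simp
  qed
qed

section \<open>Running times of programs\<close>

definition run :: "com \<Rightarrow> (nat \<Rightarrow> tape) \<Rightarrow> nat \<Rightarrow> (nat \<Rightarrow> tape) \<Rightarrow> bool" where
  "run c \<sigma> n \<sigma>' \<longleftrightarrow> (\<exists>k\<le>n. (cstep ^^ k) (c, \<sigma>) = (Skip, \<sigma>'))"

lemma app_stay: "app (\<sigma> i) (stay (syms \<sigma>) i) = \<sigma> i"
  by (simp add: app_def stay_def syms_def)

lemma cstep_Skip: "cstep (Skip, \<sigma>) = (Skip, \<sigma>)"
  by (simp add: cstep_def app_stay)

lemma cstep_Skip_iter: "(cstep ^^ k) (Skip, \<sigma>) = (Skip, \<sigma>)"
  by (induction k) (simp_all add: cstep_Skip)

lemma cstep_Act: "cstep (Act t f d, \<sigma>) = (Skip, \<sigma>(t := app (\<sigma> t) (f (syms \<sigma>), d)))"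
  by (auto simp: cstep_def app_stay fun_eq_iff)

lemma cstep_Cond: "cstep (Cond p c c', \<sigma>) = (if p (syms \<sigma>) then c else c', \<sigma>)"
  by (simp add: cstep_def app_stay)

lemma cstep_Loop: "cstep (Loop p c, \<sigma>) = (if p (syms \<sigma>) then Seq c (Loop p c) else Skip, \<sigma>)"
  by (auto simp: cstep_def app_stay)

lemma cstep_Seq: "cstep (Seq c c', \<sigma>) =
   (if c = Skip then (c', \<sigma>) else (Seq (fst (cstep (c, \<sigma>))) c', snd (cstep (c, \<sigma>))))"
  by (auto simp: cstep_def app_stay)

lemma run_mono: "run c \<sigma> n \<sigma>' \<Longrightarrow> n \<le> m \<Longrightarrow> run c \<sigma> m \<sigma>'"
  unfolding run_def by (meson order_trans)

lemma run_Skip: "run Skip \<sigma> n \<sigma>"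
  unfolding run_def by (rule exI[of _ 0]) simp

lemma run_step: "cstep (c, \<sigma>) = (c', \<sigma>1) \<Longrightarrow> run c' \<sigma>1 n \<sigma>2 \<Longrightarrow> run c \<sigma> (Suc n) \<sigma>2"
  unfolding run_def by (metis Suc_le_mono funpow_simps_right(2) o_apply)

lemma run_Act: "run (Act t f d) \<sigma> 1 (\<sigma>(t := app (\<sigma> t) (f (syms \<sigma>), d)))"
  using run_step[OF cstep_Act run_Skip[of _ 0]] by simp

text \<open>Induction on the steps of \<open>c\<close>. If \<open>c\<close> has become
  \<open>Skip\<close> before the steps are used up, the remaining ones idle, so the store is already
  the final one.\<close>

lemma run_Seq:
  assumes "run c \<sigma> n \<sigma>1" "run c' \<sigma>1 m \<sigma>2"
  shows "run (Seq c c') \<sigma> (n + m + 1) \<sigma>2"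
proof -
  obtain k where k: "k \<le> n" "(cstep ^^ k) (c, \<sigma>) = (Skip, \<sigma>1)" using assms(1) run_def by auto
  from k(2) have "run (Seq c c') \<sigma> (k + m + 1) \<sigma>2"
  proof (induction k arbitrary: c \<sigma>)
    case 0
    then show ?case using run_step[OF _ assms(2)] by (simp add: cstep_Seq)
  next
    case (Suc k)
    show ?case
    proof (cases "c = Skip")
      case True
      then have "\<sigma> = \<sigma>1" using Suc.prems cstep_Skip_iter[of "Suc k" \<sigma>] by simp
      then have "run (Seq c c') \<sigma> (Suc m) \<sigma>2"
        using True run_step[OF _ assms(2)] by (simp add: cstep_Seq)
      then show ?thesis by (rule run_mono) simp
    next
      case False
      obtain d \<sigma>d where d: "cstep (c, \<sigma>) = (d, \<sigma>d)" by fastforce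
      have "(cstep ^^ k) (d, \<sigma>d) = (Skip, \<sigma>1)" using Suc.prems d by (simp add: funpow_swap1)
      then have "run (Seq d c') \<sigma>d (k + m + 1) \<sigma>2" by (rule Suc.IH)
      then have "run (Seq c c') \<sigma> (Suc (k + m + 1)) \<sigma>2"
        using False d run_step[of "Seq c c'" \<sigma> "Seq d c'" \<sigma>d] by (simp add: cstep_Seq)
      then show ?thesis by simp
    qed
  qed
  then show ?thesis using k(1) by (elim run_mono) simp
qed

lemma run_Cond_True: "p (syms \<sigma>) \<Longrightarrow> run c \<sigma> n \<sigma>' \<Longrightarrow> run (Cond p c c') \<sigma> (n + 1) \<sigma>'"
  using run_step[of "Cond p c c'" \<sigma> c \<sigma>] by (simp add: cstep_Cond)

lemma run_Cond_False: "\<not> p (syms \<sigma>) \<Longrightarrow> run c' \<sigma> n \<sigma>' \<Longrightarrow> run (Cond p c c') \<sigma> (n + 1) \<sigma>'"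
  using run_step[of "Cond p c c'" \<sigma> c' \<sigma>] by (simp add: cstep_Cond)

lemma run_Loop_False: "\<not> p (syms \<sigma>) \<Longrightarrow> run (Loop p c) \<sigma> 1 \<sigma>"
  using run_step[of "Loop p c" \<sigma> Skip \<sigma> 0] by (simp add: cstep_Loop run_Skip)

lemma run_Loop_True:
  assumes "p (syms \<sigma>)" "run c \<sigma> n \<sigma>1" "run (Loop p c) \<sigma>1 m \<sigma>2"
  shows "run (Loop p c) \<sigma> (n + m + 2) \<sigma>2"
  using run_step[OF _ run_Seq[OF assms(2,3)], of "Loop p c" \<sigma>] assms(1)
  by (simp add: cstep_Loop)

text \<open>In each round one step unfolds the loop and one discards the finished body, hence
  \<open>B + 2\<close>; the failing test at the end is the last step.\<close>

lemma run_Loop: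
  assumes "\<And>i. i < k \<Longrightarrow> p (syms (st i))" "\<And>i. i < k \<Longrightarrow> run c (st i) B (st (Suc i))"
    "\<not> p (syms (st k))"
  shows "run (Loop p c) (st 0) (k * (B + 2) + 1) (st k)"
  using assms
proof (induction k arbitrary: st)
  case 0
  then show ?case using run_Loop_False[of p "st 0" c] by simp
next
  case (Suc k)
  have "run (Loop p c) (st (Suc 0)) (k * (B + 2) + 1) (st (Suc k))"
    using Suc.IH[of "\<lambda>i. st (Suc i)"] Suc.prems by simp
  from run_Loop_True[OF Suc.prems(1)[of 0] Suc.prems(2)[of 0] this] show ?case by (simp add: ac_simps)
qed

section \<open>Polynomial-time functions\<close>

definition poly_bound :: "(nat \<Rightarrow> nat) \<Rightarrow> bool" where
  "poly_bound p \<longleftrightarrow> (\<exists>c d. \<forall>n. p n \<le> c * n ^ d + c)"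

lemma poly_bound_const: "poly_bound (\<lambda>n. a)"
  unfolding poly_bound_def by (rule exI[of _ a]) simp

lemma poly_bound_id: "poly_bound (\<lambda>n. n)"
  unfolding poly_bound_def by (rule exI[of _ 1], rule exI[of _ 1]) simp

text \<open>The added 1 is for \<open>n = 0\<close>, where \<open>0 ^ 0\<close> exceeds
  \<open>0 ^ e\<close> for positive \<open>e\<close>.\<close>

lemma power_le_add_one: "d \<le> e \<Longrightarrow> (n::nat) ^ d \<le> n ^ e + 1"
  using power_increasing[of d e n] by (cases "n = 0") (auto simp: power_0_left)

lemma poly_bound_add:
  assumes "poly_bound p" "poly_bound q"
  shows "poly_bound (\<lambda>n. p n + q n)"
proof -
  obtain c d c' d' where p: "\<And>n. p n \<le> c * n ^ d + c" and q: "\<And>n. q n \<le> c' * n ^ d' + c'"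
    using assms unfolding poly_bound_def by blast
  have "p n + q n \<le> (2 * c + 2 * c') * n ^ (d + d') + (2 * c + 2 * c')" for n
  proof -
    have "c * n ^ d \<le> c * (n ^ (d + d') + 1)" "c' * n ^ d' \<le> c' * (n ^ (d + d') + 1)"
      by (intro mult_le_mono2 power_le_add_one; simp)+
    then show ?thesis using p[of n] q[of n] by (simp add: algebra_simps)
  qed
  then show ?thesis unfolding poly_bound_def by blast
qed

lemma poly_bound_mult:
  assumes "poly_bound p" "poly_bound q"
  shows "poly_bound (\<lambda>n. p n * q n)"
proof -
  obtain c d c' d' where p: "\<And>n. p n \<le> c * n ^ d + c" and q: "\<And>n. q n \<le> c' * n ^ d' + c'"
    using assms unfolding poly_bound_def by blast
  have "p n * q n \<le> (4 * c * c') * n ^ (d + d') + 4 * c * c'" for n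
  proof -
    have "p n * q n \<le> (c * n ^ d + c) * (c' * n ^ d' + c')" using p q by (rule mult_le_mono)
    also have "\<dots> = c * c' * (n ^ (d + d') + n ^ d + n ^ d' + 1)"
      by (simp add: algebra_simps power_add)
    also have "\<dots> \<le> c * c' * (n ^ (d + d') + (n ^ (d + d') + 1) + (n ^ (d + d') + 1) + 1)"
      by (intro mult_le_mono2 add_mono power_le_add_one order_refl) auto
    also have "\<dots> \<le> (4 * c * c') * n ^ (d + d') + 4 * c * c'" by (simp add: algebra_simps)
    finally show ?thesis .
  qed
  then show ?thesis unfolding poly_bound_def by blast
qed

lemma poly_bound_power: "poly_bound p \<Longrightarrow> poly_bound (\<lambda>n. p n ^ k)"
  by (induction k) (simp_all add: poly_bound_const poly_bound_mult)

lemmas poly_bound_intros = poly_bound_const poly_bound_id poly_bound_add poly_bound_mult poly_bound_power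

text \<open>Restricting the inputs to \<open>A\<close> leaves a program free on strings that encode
  nothing. A composition then only has to check that each function maps into the domain of the
  next.\<close>

definition poly_time_on :: "bool list set \<Rightarrow> (bool list \<Rightarrow> bool list) \<Rightarrow> bool" where
  "poly_time_on A f \<longleftrightarrow>
     (\<exists>M p. wf_tm M \<and> poly_bound p \<and> (\<forall>x\<in>A. \<exists>t\<le>p (length x). tm_outputs M x t (f x)))"

lemma poly_time_on_UNIV: "poly_time_on UNIV f \<longleftrightarrow> poly_time f"
proof
  assume "poly_time_on UNIV f"
  then obtain M p c d where "wf_tm M" "\<And>x. \<exists>t\<le>p (length x). tm_outputs M x t (f x)"
    "\<And>n. p n \<le> c * n ^ d + c"
    unfolding poly_time_on_def poly_bound_def by blast
  then show "poly_time f" unfolding poly_time_def by (meson order_trans)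
next
  assume "poly_time f"
  then obtain M c d where *: "wf_tm M" "\<forall>x. \<exists>t \<le> c * length x ^ d + c. tm_outputs M x t (f x)"
    unfolding poly_time_def by blast
  have "poly_bound (\<lambda>n. c * n ^ d + c)" by (intro poly_bound_intros)
  then show "poly_time_on UNIV f" using * unfolding poly_time_on_def by blast
qed

lemma poly_time_onI:
  assumes wf: "wf_com T S c" and T: "0 < T" and S: "3 \<le> S" and p: "poly_bound p"
    and r: "\<And>x. x \<in> A \<Longrightarrow> \<exists>\<sigma>. run c (init x) (p (length x)) \<sigma> \<and> snd (\<sigma> 0) = contents_of (f x)"
  shows "poly_time_on A f"
proof -
  \<comment> \<open>The trailing \<open>Skip\<close> guarantees a program different from
    \<open>Skip\<close>, at the price of one step.\<close>
  have "wf_com T S (Seq c Skip)" "Seq c Skip \<noteq> Skip" using wf by auto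
  then obtain M where M: "wf_tm M"
    "\<And>x n \<sigma>. (cstep ^^ n) (Seq c Skip, init x) = (Skip, \<sigma>) \<Longrightarrow>
       (tm_step M ^^ n) (init_config M x) = (1, map \<sigma> [0..<T])"
    using compile[OF _ _ T S] by blast
  have "\<exists>t\<le>p (length x) + 1. tm_outputs M x t (f x)" if x: "x \<in> A" for x
  proof -
    obtain \<sigma> where \<sigma>: "run c (init x) (p (length x)) \<sigma>" "snd (\<sigma> 0) = contents_of (f x)"
      using r[OF x] by blast
    have "run (Seq c Skip) (init x) (p (length x) + 0 + 1) \<sigma>" by (rule run_Seq[OF \<sigma>(1) run_Skip])
    then obtain t where t: "t \<le> p (length x) + 1" "(cstep ^^ t) (Seq c Skip, init x) = (Skip, \<sigma>)"
      unfolding run_def by auto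
    have "map \<sigma> [0..<T] = (fst (\<sigma> 0), contents_of (f x)) # map \<sigma> [1..<T]"
      using T \<sigma>(2) by (simp add: upt_conv_Cons prod_eq_iff)
    then have "tm_outputs M x t (f x)" unfolding tm_outputs_def using M(2)[OF t(2)] by auto
    then show ?thesis using t(1) by blast
  qed
  moreover have "poly_bound (\<lambda>n. p n + 1)" by (intro poly_bound_intros p)
  ultimately show ?thesis using M(1) unfolding poly_time_on_def by blast
qed

section \<open>Machines inside programs, and composition\<close>

definition log_tape :: "int list \<Rightarrow> int \<Rightarrow> nat" where
  "log_tape ds p = (if 0 \<le> p \<and> p < int (length ds) then nat (ds ! nat p + 2) else 0)"

lemma log_tape_snoc: "(log_tape ds)(int (length ds) := nat (d + 2)) = log_tape (ds @ [d])"
  by (auto simp: log_tape_def fun_eq_iff nth_append)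

text \<open>The head of tape 0 may stand anywhere, even left of its origin; the sum of the logged
  moves tells where. A move \<open>d\<close> is stored as \<open>d + 2\<close>, which is never
  blank, so a blank cell marks the beginning of the log when it is read backwards.\<close>

definition simulates ::
  "tm \<Rightarrow> nat \<Rightarrow> nat \<Rightarrow> (nat \<Rightarrow> tape) \<Rightarrow> int list \<Rightarrow> tape list \<Rightarrow> (nat \<Rightarrow> tape) \<Rightarrow> bool" where
  "simulates M off lg \<sigma>0 ds ts \<sigma> \<longleftrightarrow>
     length ts = tapes M \<and> (\<forall>i<tapes M. \<forall>p. snd (ts ! i) p < symbols M) \<and>
     (\<forall>i<tapes M. \<sigma> (tape_index off i) = ts ! i) \<and>
     \<sigma> lg = (int (length ds), log_tape ds) \<and> set ds \<subseteq> {-1, 0, 1} \<and>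
     fst (ts ! 0) = sum_list ds \<and>
     (\<forall>j. 0 < j \<longrightarrow> j \<noteq> lg \<longrightarrow> \<not> (off < j \<and> j < off + tapes M) \<longrightarrow> \<sigma> j = \<sigma>0 j)"

lemma simulates_step:
  assumes M: "wf_tm M" and lg: "off + tapes M \<le> lg" and q: "q < states M" "q \<noteq> 1"
    and s: "simulates M off lg \<sigma>0 ds ts \<sigma>"
  obtains d q' ts' \<sigma>' where "tm_step M (q, ts) = (q', ts')" "q' < states M" "d \<in> {-1,0,1}"
    "cstep (Mach M off lg q, \<sigma>) = (Mach M off lg q', \<sigma>')"
    "simulates M off lg \<sigma>0 (ds @ [d]) ts' \<sigma>'"
    "\<And>p. p \<noteq> fst (ts ! 0) \<Longrightarrow> snd (ts' ! 0) p = snd (ts ! 0) p"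
proof -
  have t0: "0 < tapes M" using M by (auto simp: wf_tm_def)
  define as where "as = map (\<lambda>(h, t). t h) ts"
  have len: "length ts = tapes M" and tsi: "\<And>i. i < tapes M \<Longrightarrow> \<sigma> (tape_index off i) = ts ! i"
    using s unfolding simulates_def by auto
  have as: "map (\<lambda>i. syms \<sigma> (tape_index off i)) [0..<tapes M] = as"
    using len tsi by (auto simp: as_def list_eq_iff_nth_eq syms_def split_beta)
  have las: "length as = tapes M" "\<And>i. i < tapes M \<Longrightarrow> as ! i < symbols M"
    using s len by (auto simp: as_def simulates_def split_beta)
  have ok: "\<not> (q = 1 \<or> (\<exists>i<tapes M. symbols M \<le> syms \<sigma> (tape_index off i)))"
    using q(2) las as by (auto simp: list_eq_iff_nth_eq not_le)
  note dl = wf_tm_delta[OF M q(1) las]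
  define q' acts where "q' = fst (delta M q as)" and "acts = snd (delta M q as)"
  define ts' where "ts' = map2 (\<lambda>(h, t) (a, d). (h + d, t(h := a))) ts acts"
  have la: "length acts = tapes M" using dl(2) by (simp add: acts_def)
  have ts': "ts' ! i = app (ts ! i) (acts ! i)" if "i < tapes M" for i
    using that len la by (simp add: ts'_def app_def split_beta)
  define act where "act = (\<lambda>j. if j = 0 then acts ! 0
            else if off < j \<and> j < off + tapes M then acts ! (j - off)
            else if j = lg then (nat (snd (acts ! 0) + 2), 1)
            else (syms \<sigma> j, 0))"
  define \<sigma>' where "\<sigma>' = (\<lambda>j. app (\<sigma> j) (act j))"
  have n: "nxt (Mach M off lg q) (syms \<sigma>) = (Mach M off lg q', act)"
    unfolding nxt.simps if_not_P[OF ok] Let_def as act_def q'_def acts_def by simp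
  have c: "cstep (Mach M off lg q, \<sigma>) = (Mach M off lg q', \<sigma>')"
    by (simp add: cstep_def n \<sigma>'_def del: nxt.simps)
  have t: "tm_step M (q, ts) = (q', ts')"
    using q(2) by (simp add: as_def[symmetric] q'_def ts'_def acts_def split_beta)
  have acti: "act (tape_index off i) = acts ! i" if "i < tapes M" for i
    using that by (auto simp: act_def tape_index_def)
  have actlg: "act lg = (nat (snd (acts ! 0) + 2), 1)" using lg t0 by (auto simp: act_def)
  define d where "d = snd (acts ! 0)"
  have d: "d \<in> {-1,0,1}" using dl(4)[of 0] t0 by (simp add: d_def acts_def)
  have sy: "fst (acts ! i) < symbols M" if i: "i < tapes M" for i
    using dl(3)[of i] i by (simp add: acts_def)
  have "simulates M off lg \<sigma>0 (ds @ [d]) ts' \<sigma>'"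
    unfolding simulates_def
  proof (intro conjI allI impI)
    show "length ts' = tapes M" using len la by (simp add: ts'_def)
    show "snd (ts' ! i) p < symbols M" if "i < tapes M" for i p
      using s sy[OF that] that unfolding simulates_def by (simp add: ts' app_def)
    show "\<sigma>' (tape_index off i) = ts' ! i" if "i < tapes M" for i
      using tsi[OF that] that by (simp add: \<sigma>'_def acti ts')
    show "\<sigma>' lg = (int (length (ds @ [d])), log_tape (ds @ [d]))"
      using s log_tape_snoc[of ds d] unfolding simulates_def
      by (simp add: \<sigma>'_def actlg app_def d_def)
    show "set (ds @ [d]) \<subseteq> {- 1, 0, 1}" using s d unfolding simulates_def by auto
    show "fst (ts' ! 0) = sum_list (ds @ [d])"
      using s t0 unfolding simulates_def by (simp add: ts' app_def d_def)
    show "\<sigma>' j = \<sigma>0 j" if "0 < j" "j \<noteq> lg" "\<not> (off < j \<and> j < off + tapes M)" for j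
      using s that unfolding simulates_def by (auto simp: \<sigma>'_def act_def app_def syms_def)
  qed
  moreover have "snd (ts' ! 0) p = snd (ts ! 0) p" if "p \<noteq> fst (ts ! 0)" for p
    using that t0 by (simp add: ts' app_def)
  moreover have "q' < states M" using dl(1) by (simp add: q'_def)
  ultimately show ?thesis using that t c d by blast
qed

text \<open>\<open>length ds\<close> can be smaller than \<open>n\<close> because
  \<open>tm_step\<close> idles in the halting state. The last conjunct serves to bound the output
  length: the head moves at most one cell per step, so it has not written beyond cell
  \<open>length x + n\<close>.\<close>

lemma simulation:
  assumes M: "wf_tm M" and lg: "off + tapes M \<le> lg"
    and \<sigma>0: "\<sigma>0 0 = (0, contents_of x)" "\<And>i. off < i \<Longrightarrow> i < off + tapes M \<Longrightarrow> \<sigma>0 i = (0, \<lambda>_. 0)"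
      "\<sigma>0 lg = (0, \<lambda>_. 0)"
    and z: "(tm_step M ^^ n) (init_config M x) = (q, ts)"
  shows "\<exists>ds \<sigma>. length ds \<le> n \<and> q < states M \<and>
    (cstep ^^ length ds) (Mach M off lg 0, \<sigma>0) = (Mach M off lg q, \<sigma>) \<and>
    simulates M off lg \<sigma>0 ds ts \<sigma> \<and>
    (\<forall>p \<ge> int (length x + n). snd (ts ! 0) p = 0)"
  using z
proof (induction n arbitrary: q ts)
  case 0
  have M': "0 < tapes M" "3 \<le> symbols M" "2 \<le> states M" using M by (auto simp: wf_tm_def)
  have ts: "q = 0" "ts = (0, contents_of x) # replicate (tapes M - 1) (0, \<lambda>_. 0)"
    using 0 by (auto simp: init_config_def)
  have "simulates M off lg \<sigma>0 [] ts \<sigma>0"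
    using M' lg \<sigma>0 unfolding simulates_def ts
    by (auto simp: nth_Cons tape_index_def contents_of_def log_tape_def fun_eq_iff split: nat.split)
  then show ?case using M' ts by (intro exI[of _ "[]"] exI[of _ \<sigma>0]) (auto simp: contents_of_def)
next
  case (Suc n)
  obtain q1 ts1 where z1: "(tm_step M ^^ n) (init_config M x) = (q1, ts1)" by fastforce
  obtain ds \<sigma> where IH: "length ds \<le> n" "q1 < states M"
    "(cstep ^^ length ds) (Mach M off lg 0, \<sigma>0) = (Mach M off lg q1, \<sigma>)"
    "simulates M off lg \<sigma>0 ds ts1 \<sigma>"
    "\<And>p. p \<ge> int (length x + n) \<Longrightarrow> snd (ts1 ! 0) p = 0"
    using Suc.IH[OF z1] by blast
  have st: "tm_step M (q1, ts1) = (q, ts)" using Suc.prems z1 by simp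
  show ?case
  proof (cases "q1 = 1")
    case True
    then show ?thesis using IH st by (intro exI[of _ ds] exI[of _ \<sigma>]) auto
  next
    case False
    obtain d q' ts' \<sigma>' where st': "tm_step M (q1, ts1) = (q', ts')" and d': "q' < states M" "d \<in> {-1,0,1}"
      "cstep (Mach M off lg q1, \<sigma>) = (Mach M off lg q', \<sigma>')"
      "simulates M off lg \<sigma>0 (ds @ [d]) ts' \<sigma>'"
      "\<And>p. p \<noteq> fst (ts1 ! 0) \<Longrightarrow> snd (ts' ! 0) p = snd (ts1 ! 0) p"
      by (rule simulates_step[OF M lg IH(2) False IH(4)]) (rule that, assumption+)
    have "q' = q" "ts' = ts" using st st' by (simp_all del: tm_step.simps)
    note d = d'[unfolded this]
    have "sum_list ds \<le> int (length ds)" if "set ds \<subseteq> {-1, 0, 1}" for ds :: "int list"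
      using that by (induction ds) auto
    then have h: "fst (ts1 ! 0) \<le> int n" using IH(1,4) unfolding simulates_def by fastforce
    have "snd (ts ! 0) p = 0" if p: "p \<ge> int (length x + Suc n)" for p
    proof -
      have "p \<noteq> fst (ts1 ! 0)" "p \<ge> int (length x + n)" using h p by auto
      then show ?thesis using d(5) IH(5) by simp
    qed
    moreover have "(cstep ^^ length (ds @ [d])) (Mach M off lg 0, \<sigma>0) = (Mach M off lg q, \<sigma>')"
      using IH(3) d(3) by simp
    ultimately show ?thesis using IH(1) d(1,4) by (intro exI[of _ "ds @ [d]"] exI[of _ \<sigma>']) simp
  qed
qed

text \<open>Undoes the moves of the head of tape 0 recorded on tape \<open>lg\<close>, which brings that head back to
  cell 0: the contents of the tape alone do not tell where its origin is.\<close>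

definition rewind :: "nat \<Rightarrow> com" where
  "rewind lg = Seq (Act lg (\<lambda>a. a lg) (-1)) (Loop (\<lambda>a. a lg \<noteq> 0)
     (Seq (Cond (\<lambda>a. a lg = 1) (Act 0 (\<lambda>a. a 0) 1)
            (Cond (\<lambda>a. a lg = 3) (Act 0 (\<lambda>a. a 0) (-1)) Skip))
          (Act lg (\<lambda>a. a lg) (-1))))"

lemma app_same: "app (h, u) (u h, d) = (h + d, u)"
  by (simp add: app_def)

text \<open>Moves are undone last first: after \<open>i\<close> rounds the head of tape 0 stands at
  the sum of the first \<open>length ds - i\<close> moves, which is 0 at the end.\<close>

lemma run_rewind:
  assumes lg: "lg \<noteq> 0" and \<sigma>: "\<sigma> lg = (int (length ds), log_tape ds)" "\<sigma> 0 = (sum_list ds, u)"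
    and ds: "set ds \<subseteq> {-1, 0, 1}"
  shows "\<exists>v. run (rewind lg) \<sigma> (7 * length ds + 3) (\<sigma>(0 := (0, u), lg := v))"
proof -
  define k where "k = length ds"
  define st where "st i = \<sigma>(0 := (sum_list (take (k - i) ds), u), lg := (int (k - i) - 1, log_tape ds))" for i
  define body where "body = Seq (Cond (\<lambda>a. a lg = 1) (Act 0 (\<lambda>a. a 0) 1)
            (Cond (\<lambda>a. a lg = 3) (Act 0 (\<lambda>a. a 0) (-1)) Skip))
          (Act lg (\<lambda>a. a lg) (-1))"
  have b: "run body (st i) 5 (st (Suc i)) \<and> syms (st i) lg \<noteq> 0" if i: "i < k" for i
  proof -
    define j where "j = k - Suc i"
    have j: "k - i = Suc j" "j < length ds" using i by (auto simp: j_def k_def)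
    have d: "ds ! j \<in> {-1,0,1}" using ds j(2) nth_mem by blast
    have s1: "syms (st i) lg = nat (ds ! j + 2)" using j by (simp add: syms_def st_def log_tape_def)
    have s0: "syms (st i) 0 = u (sum_list (take (Suc j) ds))" using lg j by (simp add: syms_def st_def)
    have sum: "sum_list (take (Suc j) ds) = sum_list (take j ds) + ds ! j"
      using j(2) by (simp add: take_Suc_conv_app_nth)
    define \<sigma>1 where "\<sigma>1 = (st i)(0 := (sum_list (take j ds), u))"
    have r1: "run (Cond (\<lambda>a. a lg = 1) (Act 0 (\<lambda>a. a 0) 1)
            (Cond (\<lambda>a. a lg = 3) (Act 0 (\<lambda>a. a 0) (-1)) Skip)) (st i) 3 \<sigma>1"
    proof -
      consider "ds ! j = -1" | "ds ! j = 0" | "ds ! j = 1" using d by blast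
      then show ?thesis
      proof cases
        case 1
        have "run (Act 0 (\<lambda>a. a 0) 1) (st i) 1 \<sigma>1"
          using run_Act[of 0 "\<lambda>a. a 0" 1 "st i"] 1 sum lg j(1) s0
          by (simp add: \<sigma>1_def st_def app_same)
        then show ?thesis
          by (intro run_mono[OF run_Cond_True]) (use s1 1 in auto)
      next
        case 2
        have e: "\<sigma>1 = st i" using 2 sum lg j(1) by (auto simp: \<sigma>1_def st_def fun_eq_iff)
        show ?thesis unfolding e
          by (intro run_mono[OF run_Cond_False[OF _ run_Cond_False[OF _ run_Skip[of _ 0]]]]) (use s1 2 in auto)
      next
        case 3
        have "run (Act 0 (\<lambda>a. a 0) (-1)) (st i) 1 \<sigma>1"
          using run_Act[of 0 "\<lambda>a. a 0" "-1" "st i"] 3 sum lg j(1) s0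
          by (simp add: \<sigma>1_def st_def app_same)
        then show ?thesis
          by (intro run_mono[OF run_Cond_False[OF _ run_Cond_True]]) (use s1 3 in auto)
      qed
    qed
    have "run (Act lg (\<lambda>a. a lg) (-1)) \<sigma>1 1 (st (Suc i))"
      using run_Act[of lg "\<lambda>a. a lg" "-1" \<sigma>1] lg j
      by (simp add: \<sigma>1_def st_def app_same j_def syms_def fun_upd_twist)
    from run_Seq[OF r1 this] have "run body (st i) 5 (st (Suc i))" by (simp add: body_def)
    then show ?thesis using s1 d by auto
  qed
  have e: "syms (st k) lg = 0" by (simp add: syms_def st_def log_tape_def)
  have l: "run (Loop (\<lambda>a. a lg \<noteq> 0) body) (st 0) (k * 7 + 1) (st k)"
    using run_Loop[of k "\<lambda>a. a lg \<noteq> 0" st body 5] b e by simp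
  have "run (Act lg (\<lambda>a. a lg) (-1)) \<sigma> 1 (st 0)"
    using run_Act[of lg "\<lambda>a. a lg" "-1" \<sigma>] lg \<sigma>
    by (simp add: st_def k_def app_same syms_def fun_upd_idem)
  from run_Seq[OF this l] have "run (rewind lg) \<sigma> (7 * length ds + 3) (st k)"
    unfolding rewind_def body_def by (rule run_mono) (simp add: k_def)
  moreover have "st k = \<sigma>(0 := (0, u), lg := (- 1, log_tape ds))" by (simp add: st_def)
  ultimately show ?thesis by auto
qed

lemma length_le_of_blank:
  assumes "\<And>p. p \<ge> int n \<Longrightarrow> contents_of y p = 0"
  shows "length y \<le> n"
proof (rule ccontr)
  assume "\<not> length y \<le> n"
  then show False using assms[of "int n"] by (auto simp: contents_of_def split: if_splits)
qed

lemma run_Mach: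
  assumes M: "wf_tm M" and lg: "off + tapes M \<le> lg"
    and \<sigma>0: "\<sigma>0 0 = (0, contents_of x)" "\<And>i. off < i \<Longrightarrow> i < off + tapes M \<Longrightarrow> \<sigma>0 i = (0, \<lambda>_. 0)"
      "\<sigma>0 lg = (0, \<lambda>_. 0)"
    and out: "tm_outputs M x t y"
  shows "\<exists>ds \<sigma>. run (Mach M off lg 0) \<sigma>0 (t + 1) \<sigma> \<and> length ds \<le> t \<and> set ds \<subseteq> {-1, 0, 1} \<and>
    \<sigma> 0 = (sum_list ds, contents_of y) \<and> \<sigma> lg = (int (length ds), log_tape ds) \<and>
    (\<forall>j. 0 < j \<longrightarrow> j \<noteq> lg \<longrightarrow> \<not> (off < j \<and> j < off + tapes M) \<longrightarrow> \<sigma> j = \<sigma>0 j) \<and>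
    length y \<le> length x + t"
proof -
  obtain h ts where "(tm_step M ^^ t) (init_config M x) = (1, (h, contents_of y) # ts)"
    using out unfolding tm_outputs_def by blast
  from simulation[OF M lg \<sigma>0 this] obtain ds \<sigma> where s: "length ds \<le> t"
    "(cstep ^^ length ds) (Mach M off lg 0, \<sigma>0) = (Mach M off lg 1, \<sigma>)"
    "simulates M off lg \<sigma>0 ds ((h, contents_of y) # ts) \<sigma>"
    "\<And>p. p \<ge> int (length x + t) \<Longrightarrow> contents_of y p = 0"
    by auto
  have "cstep (Mach M off lg 1, \<sigma>) = (Skip, \<sigma>)" by (simp add: cstep_def app_stay)
  then have "(cstep ^^ (length ds + 1)) (Mach M off lg 0, \<sigma>0) = (Skip, \<sigma>)" using s(2) by simp
  then have "run (Mach M off lg 0) \<sigma>0 (t + 1) \<sigma>" unfolding run_def using s(1) by (meson add_le_mono1)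
  moreover have "0 < tapes M" using M by (simp add: wf_tm_def)
  then have "\<sigma> 0 = (h, contents_of y)" using s(3) unfolding simulates_def
    by (metis nth_Cons_0 tape_index_def)
  moreover have "length y \<le> length x + t" by (rule length_le_of_blank) (rule s(4))
  ultimately show ?thesis using s(1,3) unfolding simulates_def
    by (intro exI[of _ ds] exI[of _ \<sigma>]) (auto simp: tape_index_def)
qed

text \<open>The two machines share only tape 0. The second one has work tapes and a log of its own,
  still blank, so after the rewinding it finds its initial configuration on
  \<open>f x\<close>.\<close>

lemma poly_time_on_comp:
  assumes f: "poly_time_on A f" and g: "poly_time_on B g" and AB: "\<And>x. x \<in> A \<Longrightarrow> f x \<in> B"
  shows "poly_time_on A (\<lambda>x. g (f x))"
proof -
  obtain M1 p1 where M1: "wf_tm M1" "\<And>x. x \<in> A \<Longrightarrow> \<exists>t\<le>p1 (length x). tm_outputs M1 x t (f x)"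
    and p1: "poly_bound p1" using f unfolding poly_time_on_def by blast
  \<comment> \<open>A bound \<open>c * n ^ d + c\<close> is monotone in \<open>n\<close>, which an
    arbitrary bound need not be. This matters since it is evaluated at
    \<open>length x + p1 (length x)\<close>, which only bounds the length of \<open>f x\<close> from
    above.\<close>
  obtain M2 c d where M2: "wf_tm M2" "\<And>x. x \<in> B \<Longrightarrow> \<exists>t\<le>c * length x ^ d + c. tm_outputs M2 x t (g x)"
    using g unfolding poly_time_on_def poly_bound_def by (meson order_trans)
  define lg T S off where "lg = tapes M1 + tapes M2" and "T = tapes M1 + tapes M2 + 2"
    and "S = symbols M1 + symbols M2 + 4" and "off = tapes M1 - 1"
  have t: "1 \<le> tapes M1" "1 \<le> tapes M2" using M1(1) M2(1) by (auto simp: wf_tm_def)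
  define prog where "prog = Seq (Mach M1 0 lg 0) (Seq (rewind lg) (Mach M2 off (lg + 1) 0))"
  have wf: "wf_com T S prog"
    using M1(1) M2(1) t by (auto simp: prog_def rewind_def T_def S_def lg_def off_def wf_tm_def)
  define p where "p n = (p1 n + 1) + ((7 * p1 n + 3) + (c * (n + p1 n) ^ d + c + 1) + 1) + 1" for n
  have p: "poly_bound p" unfolding p_def by (intro poly_bound_intros p1)
  show ?thesis
  proof (rule poly_time_onI[OF wf _ _ p])
    fix x assume x: "x \<in> A"
    obtain t1 where t1: "t1 \<le> p1 (length x)" "tm_outputs M1 x t1 (f x)" using M1(2)[OF x] by blast
    obtain t2 where t2: "t2 \<le> c * length (f x) ^ d + c" "tm_outputs M2 (f x) t2 (g (f x))"
      using M2(2)[OF AB[OF x]] by blast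
    have z: "init x i = (0, \<lambda>_. 0)" if "0 < i" for i using that by (simp add: init_def)
    obtain ds \<sigma>1 where s1: "run (Mach M1 0 lg 0) (init x) (t1 + 1) \<sigma>1" "length ds \<le> t1"
      "set ds \<subseteq> {-1, 0, 1}" "\<sigma>1 0 = (sum_list ds, contents_of (f x))"
      "\<sigma>1 lg = (int (length ds), log_tape ds)"
      "\<And>j. 0 < j \<Longrightarrow> j \<noteq> lg \<Longrightarrow> tapes M1 \<le> j \<Longrightarrow> \<sigma>1 j = init x j"
      "length (f x) \<le> length x + t1"
      using run_Mach[OF M1(1) _ _ _ _ t1(2), of 0 lg "init x"] z t by (auto simp: lg_def init_def)
    obtain v where s2: "run (rewind lg) \<sigma>1 (7 * length ds + 3) (\<sigma>1(0 := (0, contents_of (f x)), lg := v))"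
      using run_rewind[OF _ s1(5,4,3)] t by (auto simp: lg_def)
    define \<sigma>2 where "\<sigma>2 = \<sigma>1(0 := (0, contents_of (f x)), lg := v)"
    have "\<sigma>2 0 = (0, contents_of (f x))" "\<And>i. off < i \<Longrightarrow> i < off + tapes M2 \<Longrightarrow> \<sigma>2 i = (0, \<lambda>_. 0)"
      "\<sigma>2 (lg + 1) = (0, \<lambda>_. 0)"
      using s1(6) z t by (auto simp: \<sigma>2_def lg_def off_def)
    moreover have lg': "off + tapes M2 \<le> lg + 1" by (simp add: off_def lg_def)
    ultimately obtain \<sigma>3 es where
      s3: "run (Mach M2 off (lg + 1) 0) \<sigma>2 (t2 + 1) \<sigma>3" "\<sigma>3 0 = (sum_list es, contents_of (g (f x)))"
      using run_Mach[OF M2(1) lg' _ _ _ t2(2), of \<sigma>2] by blast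
    have "run prog (init x) ((t1 + 1) + ((7 * length ds + 3) + (t2 + 1) + 1) + 1) \<sigma>3"
      unfolding prog_def by (intro run_Seq[OF s1(1)] run_Seq[OF s2] s3(1)[unfolded \<sigma>2_def])
    moreover have "t2 \<le> c * (length x + p1 (length x)) ^ d + c"
      using t2(1) s1(7) t1(1) by (meson add_le_mono1 add_left_mono le_trans mult_le_mono2 power_mono zero_le)
    ultimately have "run prog (init x) (p (length x)) \<sigma>3"
      by (elim run_mono) (use t1(1) s1(2) in \<open>simp add: p_def\<close>)
    then show "\<exists>\<sigma>. run prog (init x) (p (length x)) \<sigma> \<and> snd (\<sigma> 0) = contents_of (g (f x))"
      using s3(2) by auto
  qed (auto simp: T_def S_def)
qed

section \<open>Programs on tapes with finite contents\<close>

type_synonym zipper = "nat list \<times> nat list"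

text \<open>A tape that starts at cell 0 is kept as the reversed list of the symbols left of the head
  and the list of the symbols from the head onwards; trailing blanks are immaterial.\<close>

definition tape_of :: "zipper \<Rightarrow> tape" where
  "tape_of z = (int (length (fst z)),
     \<lambda>i. if 0 \<le> i \<and> nat i < length (fst z) + length (snd z) then (rev (fst z) @ snd z) ! nat i else 0)"

definition cur :: "zipper \<Rightarrow> nat" where
  "cur z = (case snd z of [] \<Rightarrow> 0 | a # _ \<Rightarrow> a)"

lemma cur_simps[simp]: "cur (l, []) = 0" "cur (l, a # r) = a"
  by (simp_all add: cur_def)

definition srun :: "com \<Rightarrow> (nat \<Rightarrow> zipper) \<Rightarrow> nat \<Rightarrow> (nat \<Rightarrow> zipper) \<Rightarrow> bool" where
  "srun c s n s' \<longleftrightarrow> run c (\<lambda>i. tape_of (s i)) n (\<lambda>i. tape_of (s' i))"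

abbreviation scan :: "(nat \<Rightarrow> zipper) \<Rightarrow> nat \<Rightarrow> nat" where
  "scan s \<equiv> \<lambda>i. cur (s i)"

lemma syms_tape_of: "syms (\<lambda>i. tape_of (s i)) = scan s"
proof
  fix i show "syms (\<lambda>i. tape_of (s i)) i = scan s i"
    by (cases "snd (s i)") (auto simp: syms_def tape_of_def cur_def nth_append)
qed

lemma srun_mono: "srun c s n s' \<Longrightarrow> n \<le> m \<Longrightarrow> srun c s m s'"
  unfolding srun_def by (rule run_mono)

lemma srun_eq: "srun c s n s1 \<Longrightarrow> n \<le> m \<Longrightarrow> s1 = s' \<Longrightarrow> srun c s m s'"
  using srun_mono by blast

lemma srun_conv: "srun c s n s' \<Longrightarrow> s = t \<Longrightarrow> n \<le> m \<Longrightarrow> s' = t' \<Longrightarrow> srun c t m t'"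
  using srun_mono by blast

lemma srun_Skip: "srun Skip s n s"
  unfolding srun_def by (rule run_Skip)

lemma srun_Seq: "srun c s n s1 \<Longrightarrow> srun c' s1 m s2 \<Longrightarrow> srun (Seq c c') s (n + m + 1) s2"
  unfolding srun_def by (rule run_Seq)

lemma srun_Cond_True: "p (scan s) \<Longrightarrow> srun c s n s' \<Longrightarrow> srun (Cond p c c') s (n + 1) s'"
  unfolding srun_def by (rule run_Cond_True) (simp_all add: syms_tape_of)

lemma srun_Cond_False: "\<not> p (scan s) \<Longrightarrow> srun c' s n s' \<Longrightarrow> srun (Cond p c c') s (n + 1) s'"
  unfolding srun_def by (rule run_Cond_False) (simp_all add: syms_tape_of)

lemma srun_Cond:
  "(p (scan s) \<Longrightarrow> srun c s n s') \<Longrightarrow> (\<not> p (scan s) \<Longrightarrow> srun c' s n s') \<Longrightarrow> srun (Cond p c c') s (n + 1) s'"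
  using srun_Cond_True srun_Cond_False by metis

lemma srun_Loop:
  assumes "\<And>i. i < k \<Longrightarrow> p (scan (st i))" "\<And>i. i < k \<Longrightarrow> srun c (st i) B (st (Suc i))"
    "\<not> p (scan (st k))"
  shows "srun (Loop p c) (st 0) (k * (B + 2) + 1) (st k)"
  unfolding srun_def
  by (rule run_Loop[of k p "\<lambda>i t. tape_of (st i t)"]) (use assms in \<open>simp_all add: syms_tape_of srun_def\<close>)

lemma srun_Act:
  assumes "app (tape_of (s t)) (f (scan s), d) = tape_of z"
  shows "srun (Act t f d) s 1 (s(t := z))"
proof -
  have "(\<lambda>i. tape_of (s i))(t := tape_of z) = (\<lambda>i. tape_of ((s(t := z)) i))" by auto
  then show ?thesis using run_Act[of t f d "\<lambda>i. tape_of (s i)"] assms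
    by (simp add: srun_def syms_tape_of)
qed

lemma app_tape_write:
  "app (tape_of (l, r)) (v, 0) = tape_of (l, v # tl r)"
  by (cases r) (auto simp: app_def tape_of_def fun_eq_iff nth_append nth_Cons' nat_less_iff)

lemma app_tape_right:
  "app (tape_of (l, r)) (v, 1) = tape_of (v # l, tl r)"
  by (cases r) (auto simp: app_def tape_of_def fun_eq_iff nth_append nth_Cons' nat_less_iff)

lemma app_tape_left:
  "app (tape_of (x # l, r)) (cur (x # l, r), -1) = tape_of (l, x # r)"
  by (cases r) (auto simp: app_def tape_of_def fun_eq_iff nth_append nth_Cons' nat_less_iff)

lemma tape_of_blank: "tape_of (l, [0]) = tape_of (l, [])"
  by (auto simp: tape_of_def fun_eq_iff nth_append)

definition rt :: "nat \<Rightarrow> com" where "rt t = Act t (\<lambda>a. a t) 1"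
definition lf :: "nat \<Rightarrow> com" where "lf t = Act t (\<lambda>a. a t) (-1)"
definition wr :: "nat \<Rightarrow> nat \<Rightarrow> com" where "wr t v = Act t (\<lambda>_. v) 0"
definition em :: "nat \<Rightarrow> ((nat \<Rightarrow> nat) \<Rightarrow> nat) \<Rightarrow> com" where "em t f = Act t f 1"

lemma srun_rt: "srun (rt t) s 1 (s(t := (cur (s t) # fst (s t), tl (snd (s t)))))"
  unfolding rt_def by (rule srun_Act) (metis app_tape_right prod.collapse)

lemma srun_em: "srun (em t f) s 1 (s(t := (f (scan s) # fst (s t), tl (snd (s t)))))"
  unfolding em_def by (rule srun_Act) (metis app_tape_right prod.collapse)

lemma srun_wr: "srun (wr t v) s 1 (s(t := (fst (s t), v # tl (snd (s t)))))"
  unfolding wr_def by (rule srun_Act) (metis app_tape_write prod.collapse)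

text \<open>A blank in the last cell is dropped from the list, so that an erased tape is literally
  equal to a fresh one.\<close>

lemma srun_erase: "s t = (l, [x]) \<Longrightarrow> srun (wr t 0) s 1 (s(t := (l, [])))"
  unfolding wr_def by (rule srun_Act) (simp add: app_tape_write tape_of_blank)

lemma srun_lf: "s t = (x # l, r) \<Longrightarrow> srun (lf t) s 1 (s(t := (l, x # r)))"
  unfolding lf_def by (rule srun_Act) (simp add: app_tape_left del: cur_simps)

lemma srun_rt': "s t = (l, x # r) \<Longrightarrow> s' = s(t := (x # l, r)) \<Longrightarrow> srun (rt t) s 1 s'"
  using srun_rt[of t s] by simp

lemma srun_lf': "s t = (x # l, r) \<Longrightarrow> s' = s(t := (l, x # r)) \<Longrightarrow> srun (lf t) s 1 s'"
  using srun_lf[of s t] by simp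

lemma srun_wr': "s t = (l, r) \<Longrightarrow> s' = s(t := (l, v # tl r)) \<Longrightarrow> srun (wr t v) s 1 s'"
  using srun_wr[of t v s] by simp

lemma srun_em': "s t = (l, r) \<Longrightarrow> s' = s(t := (f (scan s) # l, tl r)) \<Longrightarrow> srun (em t f) s 1 s'"
  using srun_em[of t f s] by simp

text \<open>The initial move to the left makes the search look strictly left of the head.\<close>

definition back_to :: "nat \<Rightarrow> (nat \<Rightarrow> bool) \<Rightarrow> com" where
  "back_to t p = Seq (lf t) (Loop (\<lambda>a. \<not> p (a t)) (lf t))"

definition skip_to :: "nat \<Rightarrow> (nat \<Rightarrow> bool) \<Rightarrow> com" where
  "skip_to t p = Loop (\<lambda>a. \<not> p (a t)) (rt t)"

lemma srun_back_to:
  assumes "s t = (xs @ y # l, r)" "\<And>x. x \<in> set xs \<Longrightarrow> \<not> p x" "p y"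
  shows "srun (back_to t p) s (3 * length xs + 3) (s(t := (l, y # rev xs @ r)))"
proof -
  define ys where "ys = xs @ [y]"
  define st where "st i = s(t := (drop (Suc i) ys @ l, rev (take (Suc i) ys) @ r))" for i
  have ys: "length ys = Suc (length xs)" "ys \<noteq> []" by (simp_all add: ys_def)
  have st: "st i t = (drop (Suc i) ys @ l, ys ! i # rev (take i ys) @ r)" if "i \<le> length xs" for i
    using that ys by (simp add: st_def take_Suc_conv_app_nth)
  have yi: "ys ! i = xs ! i" if "i < length xs" for i using that by (simp add: ys_def nth_append)
  have 1: "srun (lf t) s 1 (st 0)"
    by (rule srun_lf'[of _ _ "hd ys" "tl ys @ l" r])
       (use ys assms(1) in \<open>cases xs; auto simp: st_def ys_def fun_eq_iff\<close>)+
  have 2: "srun (Loop (\<lambda>a. \<not> p (a t)) (lf t)) (st 0) (length xs * (1 + 2) + 1) (st (length xs))"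
  proof (rule srun_Loop)
    fix i assume i: "i < length xs"
    show "\<not> p (scan (st i) t)" using st[of i] i yi assms(2) by simp
    have "drop (Suc i) ys = ys ! Suc i # drop (Suc (Suc i)) ys"
      using i ys by (simp add: Cons_nth_drop_Suc)
    then have "st i t = (ys ! Suc i # drop (Suc (Suc i)) ys @ l, rev (take (Suc i) ys) @ r)"
      by (simp add: st_def)
    then show "srun (lf t) (st i) 1 (st (Suc i))"
      by (rule srun_lf') (use i ys in \<open>simp add: st_def take_Suc_conv_app_nth[of "Suc i"] fun_eq_iff\<close>)
  next
    show "\<not> \<not> p (scan (st (length xs)) t)" using st[of "length xs"] assms(3) by (simp add: ys_def)
  qed
  show ?thesis unfolding back_to_def
    by (rule srun_eq[OF srun_Seq[OF 1 2]]) (simp_all add: st_def ys_def)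
qed

lemma srun_skip_to:
  assumes "s t = (l, xs @ r)" "\<And>x. x \<in> set xs \<Longrightarrow> \<not> p x" "p (cur (l, r))"
  shows "srun (skip_to t p) s (3 * length xs + 1) (s(t := (rev xs @ l, r)))"
proof -
  define st where "st i = s(t := (rev (take i xs) @ l, drop i xs @ r))" for i
  have "srun (Loop (\<lambda>a. \<not> p (a t)) (rt t)) (st 0) (length xs * (1 + 2) + 1) (st (length xs))"
  proof (rule srun_Loop)
    fix i assume i: "i < length xs"
    then have d: "drop i xs = xs ! i # drop (Suc i) xs" by (simp add: Cons_nth_drop_Suc)
    then show "\<not> p (scan (st i) t)" using i assms(2) by (simp add: st_def)
    have "st i t = (rev (take i xs) @ l, xs ! i # drop (Suc i) xs @ r)" by (simp add: st_def d)
    then show "srun (rt t) (st i) 1 (st (Suc i))"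
      by (rule srun_rt') (use i in \<open>simp add: st_def take_Suc_conv_app_nth fun_eq_iff\<close>)
  next
    show "\<not> \<not> p (scan (st (length xs)) t)" using assms(3) by (simp add: st_def cur_def)
  qed
  moreover have "st 0 = s" using assms(1) by (auto simp: st_def)
  ultimately have "srun (skip_to t p) s (length xs * (1 + 2) + 1) (st (length xs))"
    by (simp only: skip_to_def)
  then show ?thesis by (rule srun_eq) (simp_all add: st_def)
qed

text \<open>Work tapes carry the sentinel 6 in cell 0.\<close>

definition rew :: "nat \<Rightarrow> com" where
  "rew t = Seq (back_to t (\<lambda>x. x = 6)) (rt t)"

lemma srun_rew:
  assumes "s t = (rev xs @ [6], r)" "6 \<notin> set xs"
  shows "srun (rew t) s (3 * length xs + 5) (s(t := ([6], xs @ r)))"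
proof -
  have 1: "srun (back_to t (\<lambda>x. x = 6)) s (3 * length (rev xs) + 3) (s(t := ([], 6 # rev (rev xs) @ r)))"
    by (rule srun_back_to) (use assms in auto)
  show ?thesis unfolding rew_def
    by (rule srun_eq[OF srun_Seq[OF 1 srun_rt]]) auto
qed

section \<open>Loops over the contents of a tape\<close>

definition For :: "nat \<Rightarrow> com \<Rightarrow> com" where
  "For t c = Seq (Loop (\<lambda>a. a t \<noteq> 0) (Seq c (rt t))) (rew t)"

text \<open>The rule overrides tape \<open>t\<close> in the stores \<open>st i\<close>; the body has
  to leave its head where it was. Per symbol, moving on costs two steps, the loop two and the final
  rewinding three, hence \<open>B + 7\<close>.\<close>

lemma srun_For:
  assumes body: "\<And>i. i < length xs \<Longrightarrow>
      srun c ((st i)(t := (rev (take i xs) @ [6], drop i xs))) B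
             ((st (Suc i))(t := (rev (take i xs) @ [6], drop i xs)))"
    and xs: "0 \<notin> set xs" "6 \<notin> set xs"
    and s: "s = (st 0)(t := ([6], xs))" and s': "s' = (st (length xs))(t := ([6], xs))"
  shows "srun (For t c) s (length xs * (B + 7) + 7) s'"
proof -
  define st' where "st' i = (st i)(t := (rev (take i xs) @ [6], drop i xs))" for i
  have l: "srun (Loop (\<lambda>a. a t \<noteq> 0) (Seq c (rt t))) (st' 0) (length xs * ((B + 1 + 1) + 2) + 1) (st' (length xs))"
  proof (rule srun_Loop)
    fix i assume i: "i < length xs"
    then have d: "drop i xs = xs ! i # drop (Suc i) xs" by (simp add: Cons_nth_drop_Suc)
    have "xs ! i \<noteq> 0" using xs(1) nth_mem[OF i] by metis
    then show "scan (st' i) t \<noteq> 0" using d by (simp add: st'_def)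
    have "srun (rt t) ((st (Suc i))(t := (rev (take i xs) @ [6], drop i xs))) 1 (st' (Suc i))"
      by (rule srun_rt'[where l = "rev (take i xs) @ [6]" and x = "xs ! i" and r = "drop (Suc i) xs"])
         (use i in \<open>simp_all add: st'_def d take_Suc_conv_app_nth\<close>)
    from srun_Seq[OF body[OF i] this] show "srun (Seq c (rt t)) (st' i) (B + 1 + 1) (st' (Suc i))"
      by (simp add: st'_def)
  next
    show "\<not> scan (st' (length xs)) t \<noteq> 0" by (simp add: st'_def)
  qed
  have r: "srun (rew t) (st' (length xs)) (3 * length xs + 5) ((st' (length xs))(t := ([6], xs @ [])))"
    by (rule srun_rew) (use xs in \<open>simp_all add: st'_def\<close>)
  show ?thesis unfolding For_def
    by (rule srun_eq[OF srun_Seq, OF _ r])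
       (use l s s' in \<open>auto simp: st'_def algebra_simps\<close>)
qed

definition For_items :: "nat \<Rightarrow> com \<Rightarrow> com" where
  "For_items t c = Seq (Loop (\<lambda>a. a t \<noteq> 0) (Seq c (Seq (skip_to t (\<lambda>x. x = 5)) (rt t)))) (rew t)"

abbreviation items :: "nat list list \<Rightarrow> nat list" where
  "items yss \<equiv> concat (map (\<lambda>ys. ys @ [5]) yss)"

lemma items_snoc: "i < length yss \<Longrightarrow> items (take (Suc i) yss) = items (take i yss) @ yss ! i @ [5]"
  by (simp add: take_Suc_conv_app_nth)

lemma items_drop: "i < length yss \<Longrightarrow> items (drop i yss) = yss ! i @ 5 # items (drop (Suc i) yss)"
  using Cons_nth_drop_Suc[of i yss, symmetric] by (simp only: list.map concat.simps append.assoc append.simps)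

text \<open>The body may stop anywhere in the current item, up to its end marker 5. The existential
  split into \<open>u\<close> and \<open>v\<close> records where, and skipping to the marker brings
  the head back into step.\<close>

lemma srun_For_items:
  assumes body: "\<And>i. i < length yss \<Longrightarrow> \<exists>u v. yss ! i = u @ v \<and>
      srun c ((st i)(t := (rev (items (take i yss)) @ [6], items (drop i yss)))) B
             ((st (Suc i))(t := (rev u @ rev (items (take i yss)) @ [6], v @ 5 # items (drop (Suc i) yss))))"
    and yss: "\<And>ys. ys \<in> set yss \<Longrightarrow> 0 \<notin> set ys \<and> 5 \<notin> set ys \<and> 6 \<notin> set ys \<and> length ys \<le> L"
    and s: "s = (st 0)(t := ([6], items yss))" and s': "s' = (st (length yss))(t := ([6], items yss))"
  shows "srun (For_items t c) s (length yss * (B + 6 * L + 10) + 7) s'"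
proof -
  define st' where "st' i = (st i)(t := (rev (items (take i yss)) @ [6], items (drop i yss)))" for i
  have l: "srun (Loop (\<lambda>a. a t \<noteq> 0) (Seq c (Seq (skip_to t (\<lambda>x. x = 5)) (rt t)))) (st' 0)
      (length yss * ((B + ((3 * L + 1) + 1 + 1) + 1) + 2) + 1) (st' (length yss))"
  proof (rule srun_Loop)
    fix i assume i: "i < length yss"
    have yi: "0 \<notin> set (yss ! i) \<and> 5 \<notin> set (yss ! i) \<and> 6 \<notin> set (yss ! i) \<and> length (yss ! i) \<le> L"
      using yss nth_mem[OF i] by blast
    show "scan (st' i) t \<noteq> 0" using yi items_drop[OF i] by (cases "yss ! i") (auto simp: st'_def)
    obtain u v where uv: "yss ! i = u @ v" and
      b: "srun c (st' i) B ((st (Suc i))(t := (rev u @ rev (items (take i yss)) @ [6], v @ 5 # items (drop (Suc i) yss))))"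
      using body[OF i] by (auto simp: st'_def)
    let ?s1 = "(st (Suc i))(t := (rev u @ rev (items (take i yss)) @ [6], v @ 5 # items (drop (Suc i) yss)))"
    let ?s2 = "(st (Suc i))(t := (rev v @ rev u @ rev (items (take i yss)) @ [6], 5 # items (drop (Suc i) yss)))"
    have "srun (skip_to t (\<lambda>x. x = 5)) ?s1 (3 * length v + 1) (?s1(t := (rev v @ rev u @ rev (items (take i yss)) @ [6], 5 # items (drop (Suc i) yss))))"
      by (rule srun_skip_to) (use yi uv in auto)
    then have 1: "srun (skip_to t (\<lambda>x. x = 5)) ?s1 (3 * L + 1) ?s2"
      by (rule srun_eq) (use yi uv in auto)
    have 2: "srun (rt t) ?s2 1 (st' (Suc i))"
      by (rule srun_rt'[where l = "rev v @ rev u @ rev (items (take i yss)) @ [6]" and x = 5 and r = "items (drop (Suc i) yss)"])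
         (use i in \<open>simp_all add: st'_def items_snoc uv del: map_append concat_append take_Suc_conv_app_nth\<close>)
    show "srun (Seq c (Seq (skip_to t (\<lambda>x. x = 5)) (rt t))) (st' i) (B + ((3 * L + 1) + 1 + 1) + 1) (st' (Suc i))"
      by (rule srun_Seq[OF b srun_Seq[OF 1 2]])
  next
    show "\<not> scan (st' (length yss)) t \<noteq> 0" by (simp add: st'_def)
  qed
  have len: "length (items yss) \<le> length yss * (L + 1)"
    using yss
  proof (induction yss)
    case (Cons a yss)
    have "length a \<le> L" using Cons.prems[of a] by simp
    moreover have "length (items yss) \<le> length yss * (L + 1)" using Cons by simp
    ultimately show ?case by simp
  qed simp
  have "6 \<notin> set (items yss)" using yss by auto
  then have r: "srun (rew t) (st' (length yss)) (3 * length (items yss) + 5) ((st' (length yss))(t := ([6], items yss @ [])))"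
    by (intro srun_rew) (simp_all add: st'_def)
  have le: "length yss * ((B + ((3 * L + 1) + 1 + 1) + 1) + 2) + 1 + (3 * length (items yss) + 5) + 1
      \<le> length yss * (B + 6 * L + 10) + 7"
    using len by (simp add: algebra_simps)
  have "srun (For_items t c) (st' 0) (length yss * (B + 6 * L + 10) + 7) ((st' (length yss))(t := ([6], items yss @ [])))"
    unfolding For_items_def by (rule srun_mono[OF srun_Seq[OF l r] le])
  then show ?thesis by (simp add: s s' st'_def)
qed

definition sy :: "bool \<Rightarrow> nat" where
  "sy b = (if b then 2 else 1)"

lemma sy_simps[simp]: "sy True = 2" "sy False = 1" "sy b \<noteq> 0" "0 < sy b" "sy b = 2 \<longleftrightarrow> b" "sy b = 1 \<longleftrightarrow> \<not> b"
  "sy b < 7" "sy b < 3" "sy b \<noteq> 3" "sy b \<noteq> 4" "sy b \<noteq> 5" "sy b \<noteq> 6" "sy b = sy b' \<longleftrightarrow> b = b'"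
  by (auto simp: sy_def)

abbreviation sys :: "bool list \<Rightarrow> nat list" where "sys \<equiv> map sy"

lemma in_sys: "a \<in> set (sys x) \<Longrightarrow> a = 1 \<or> a = 2"
  by (auto simp: sy_def)

lemma tape_of_bits: "snd (tape_of (l, r)) = contents_of x" if "rev l @ r = sys x"
proof -
  have len: "length l + length r = length x" using arg_cong[OF that, of length] by simp
  show ?thesis using len by (auto simp: tape_of_def contents_of_def fun_eq_iff that sy_def)
qed

text \<open>After the input has been copied to tape 1, both heads return in step while tape 0 is
  erased. The sentinel on tape 1 tells when the head of tape 0 is back in cell 0, where the output
  is to begin.\<close>

definition prelude :: com where
  "prelude = Seq (em 1 (\<lambda>_. 6)) (Seq (Loop (\<lambda>a. a 0 \<noteq> 0) (Seq (em 1 (\<lambda>a. a 0)) (rt 0)))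
     (Seq (lf 1) (Seq (Loop (\<lambda>a. a 1 \<noteq> 6) (Seq (lf 0) (Seq (wr 0 0) (lf 1)))) (rt 1))))"

definition start_store :: "bool list \<Rightarrow> nat \<Rightarrow> zipper" where
  "start_store x t = (if t = 1 then ([6], sys x) else ([], []))"

lemma srun_prelude:
  "srun prelude (\<lambda>t. if t = 0 then ([], sys x) else ([], [])) (12 * length x + 20) (start_store x)"
proof -
  let ?b = "\<lambda>t::nat. ([], []) :: zipper"
  define xs where "xs = sys x"
  define ys where "ys = rev xs @ [6]"
  define st where "st i = ?b(0 := (rev (take i xs), drop i xs), 1 := (rev (take i xs) @ [6], []))" for i
  define sb where "sb i = ?b(0 := (drop i (rev xs), []), 1 := (drop (Suc i) ys, rev (take (Suc i) ys)))" for i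
  have 1: "srun (em 1 (\<lambda>_. 6)) (?b(0 := ([], xs))) 1 (st 0)"
    by (rule srun_eq[OF srun_em]) (auto simp: st_def)
  have 2: "srun (Loop (\<lambda>a. a 0 \<noteq> 0) (Seq (em 1 (\<lambda>a. a 0)) (rt 0))) (st 0) (length xs * ((1 + 1 + 1) + 2) + 1) (st (length xs))"
  proof (rule srun_Loop)
    fix i assume i: "i < length xs"
    then have d: "drop i xs = xs ! i # drop (Suc i) xs" by (simp add: Cons_nth_drop_Suc)
    show "scan (st i) 0 \<noteq> 0" using i by (simp add: st_def d) (simp add: xs_def)
    show "srun (Seq (em 1 (\<lambda>a. a 0)) (rt 0)) (st i) (1 + 1 + 1) (st (Suc i))"
      by (rule srun_eq[OF srun_Seq[OF srun_em srun_rt]])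
         (use i in \<open>auto simp: st_def d take_Suc_conv_app_nth fun_eq_iff\<close>)
  qed (simp add: st_def)
  have ysl: "length ys = Suc (length xs)" by (simp add: ys_def)
  have ysi: "ys ! i = rev xs ! i" if "i < length xs" for i using that by (simp add: ys_def nth_append)
  have 3: "srun (lf 1) (st (length xs)) 1 (sb 0)"
  proof (rule srun_lf'[where x = "hd ys" and l = "tl ys" and r = "[]"])
    have "ys \<noteq> []" using ysl by auto
    then show "st (length xs) 1 = (hd ys # tl ys, [])" by (simp add: st_def flip: ys_def)
    show "sb 0 = (st (length xs))(1 := (tl ys, [hd ys]))"
      using \<open>ys \<noteq> []\<close> by (cases ys) (auto simp: st_def sb_def fun_eq_iff)
  qed
  have 4: "srun (Loop (\<lambda>a. a 1 \<noteq> 6) (Seq (lf 0) (Seq (wr 0 0) (lf 1)))) (sb 0) (length xs * ((1 + (1 + 1 + 1) + 1) + 2) + 1) (sb (length xs))"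
  proof (rule srun_Loop)
    fix i assume i: "i < length xs"
    have c: "sb i 1 = (drop (Suc i) ys, ys ! i # rev (take i ys))"
      using i ysl by (simp add: sb_def take_Suc_conv_app_nth)
    have "rev xs ! i \<in> set xs" using i by (metis length_rev nth_mem set_rev)
    then show "scan (sb i) 1 \<noteq> 6" unfolding c using ysi[OF i] by (auto simp: xs_def)
    have d: "drop i (rev xs) = rev xs ! i # drop (Suc i) (rev xs)"
      using i by (simp add: Cons_nth_drop_Suc)
    have d': "drop (Suc i) ys = ys ! Suc i # drop (Suc (Suc i)) ys"
      using i ysl by (simp add: Cons_nth_drop_Suc)
    let ?s1 = "(sb i)(0 := (drop (Suc i) (rev xs), [rev xs ! i]))"
    let ?s2 = "(sb i)(0 := (drop (Suc i) (rev xs), []))"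
    have a: "srun (lf 0) (sb i) 1 ?s1" by (rule srun_lf') (auto simp: sb_def d)
    have "srun (wr 0 0) ?s1 1 (?s1(0 := (drop (Suc i) (rev xs), [])))" by (rule srun_erase) simp
    then have b: "srun (wr 0 0) ?s1 1 ?s2" by simp
    have e: "srun (lf 1) ?s2 1 (sb (Suc i))"
      by (rule srun_lf'[where x = "ys ! Suc i" and l = "drop (Suc (Suc i)) ys" and r = "rev (take (Suc i) ys)"])
         (use i ysl in \<open>auto simp: sb_def d' take_Suc_conv_app_nth[of "Suc i"] fun_eq_iff\<close>)
    show "srun (Seq (lf 0) (Seq (wr 0 0) (lf 1))) (sb i) (1 + (1 + 1 + 1) + 1) (sb (Suc i))"
      by (rule srun_Seq[OF a srun_Seq[OF b e]])
  next
    show "\<not> scan (sb (length xs)) 1 \<noteq> 6" by (simp add: sb_def ys_def)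
  qed
  have 5: "srun (rt 1) (sb (length xs)) 1 (start_store x)"
    by (rule srun_rt'[where x = 6 and l = "[]" and r = xs])
       (auto simp: sb_def ys_def start_store_def xs_def fun_eq_iff)
  have e: "?b(0 := ([], xs)) = (\<lambda>t. if t = 0 then ([], sys x) else ([], []))" by (auto simp: xs_def)
  show ?thesis unfolding prelude_def
    using srun_Seq[OF 1 srun_Seq[OF 2 srun_Seq[OF 3 srun_Seq[OF 4 5]]]] unfolding e
    by (rule srun_mono) (simp add: xs_def)
qed

lemma wf_prims [simp]:
  "wf_com T S (rt t) \<longleftrightarrow> t < T" "wf_com T S (lf t) \<longleftrightarrow> t < T"
  "wf_com T S (wr t v) \<longleftrightarrow> t < T \<and> ((\<exists>a. \<forall>i::nat. a i < S) \<longrightarrow> v < S)"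
  "wf_com T S (em t f) \<longleftrightarrow> t < T \<and> (\<forall>a. (\<forall>i. a i < S) \<longrightarrow> f a < S)"
  by (auto simp: rt_def lf_def wr_def em_def)

lemma wf_derived [simp]:
  "wf_com T S (back_to t p) \<longleftrightarrow> t < T" "wf_com T S (skip_to t p) \<longleftrightarrow> t < T"
  "wf_com T S (rew t) \<longleftrightarrow> t < T" "wf_com T S (For t c) \<longleftrightarrow> wf_com T S c \<and> t < T"
  "wf_com T S (For_items t c) \<longleftrightarrow> wf_com T S c \<and> t < T"
  by (auto simp: back_to_def skip_to_def rew_def For_def For_items_def)

text \<open>Seven symbols are provided for: the blank, the two bits, the separators 3, 4, 5 and the
  sentinel 6.\<close>

lemma poly_time_on_program:
  assumes wf: "wf_com T S c" and T: "2 \<le> T" and S: "7 \<le> S" and p: "poly_bound p"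
    and r: "\<And>x. x \<in> A \<Longrightarrow> \<exists>s'. srun c (start_store x) (p (length x)) s' \<and> s' 0 = (rev (sys (f x)), [])"
  shows "poly_time_on A f"
proof (rule poly_time_onI)
  show "wf_com T S (Seq prelude c)" using wf T S by (auto simp: prelude_def)
  show "0 < T" "3 \<le> S" using T S by auto
  show "poly_bound (\<lambda>n. 12 * n + 20 + p n + 1)" by (intro poly_bound_intros p)
  fix x assume "x \<in> A"
  then obtain s' where s': "srun c (start_store x) (p (length x)) s'" "s' 0 = (rev (sys (f x)), [])"
    using r by blast
  have i: "init x = (\<lambda>t. tape_of (if t = 0 then ([], sys x) else ([], [])))"
  proof
    fix t show "init x t = tape_of (if t = 0 then ([], sys x) else ([], []))"
      using tape_of_bits[of "[]" "sys x" x] by (auto simp: init_def prod_eq_iff tape_of_def)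
  qed
  have "run (Seq prelude c) (init x) (12 * length x + 20 + p (length x) + 1) (\<lambda>t. tape_of (s' t))"
    using srun_Seq[OF srun_prelude s'(1)] unfolding srun_def i .
  moreover have "snd (tape_of (s' 0)) = contents_of (f x)"
    unfolding s'(2) by (rule tape_of_bits) simp
  ultimately show "\<exists>\<sigma>. run (Seq prelude c) (init x) (12 * length x + 20 + p (length x) + 1) \<sigma> \<and>
      snd (\<sigma> 0) = contents_of (f x)" by blast
qed

lemma srun_Loop_False: "\<not> p (scan s) \<Longrightarrow> srun (Loop p c) s 1 s"
  unfolding srun_def by (rule run_Loop_False) (simp add: syms_tape_of)

lemma srun_Loop_True:
  "p (scan s) \<Longrightarrow> srun c s n s1 \<Longrightarrow> srun (Loop p c) s1 m s2 \<Longrightarrow> srun (Loop p c) s (n + m + 2) s2"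
  unfolding srun_def by (rule run_Loop_True) (simp_all add: syms_tape_of)

section \<open>Reading pairs and pebblings\<close>

text \<open>Recovers the instance from a pair of an instance and a witness. It turns the inclusion
  of P in NP into a composition of polynomial-time functions.\<close>

fun decode :: "bool list \<Rightarrow> bool list" where
  "decode (False # b # r) = b # decode r"
| "decode _ = []"

lemma decode_pair: "decode (pair x w) = x"
  by (induction x) (auto simp: pair_def tag_def)

definition decode_prog :: com where
  "decode_prog = Loop (\<lambda>a. a 1 = 1)
     (Seq (rt 1) (Cond (\<lambda>a. a 1 = 0) Skip (Seq (em 0 (\<lambda>a. a 1)) (rt 1))))"

lemma srun_decode:
  "\<exists>z. srun decode_prog (s(0 := (out, []), 1 := (l, sys x))) (8 * length x + 1)
        (s(0 := (rev (sys (decode x)) @ out, []), 1 := z))"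
proof (induction x arbitrary: out l rule: decode.induct)
  case (1 b r)
  let ?s = "s(0 := (out, []), 1 := (l, sys (False # b # r)))"
  let ?s1 = "s(0 := (out, []), 1 := (1 # l, sy b # sys r))"
  let ?s2 = "s(0 := (sy b # out, []), 1 := (sy b # 1 # l, sys r))"
  obtain z where z: "srun decode_prog ?s2 (8 * length r + 1) (s(0 := (rev (sys (decode r)) @ sy b # out, []), 1 := z))"
    using 1 by blast
  have a: "srun (rt 1) ?s 1 ?s1" by (rule srun_eq[OF srun_rt]) (auto simp: fun_eq_iff)
  have b: "srun (Seq (em 0 (\<lambda>a. a 1)) (rt 1)) ?s1 3 ?s2"
    by (rule srun_eq[OF srun_Seq[OF srun_em srun_rt]]) (auto simp: fun_eq_iff)
  have c: "srun (Cond (\<lambda>a. a 1 = 0) Skip (Seq (em 0 (\<lambda>a. a 1)) (rt 1))) ?s1 (3 + 1) ?s2"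
    by (rule srun_Cond_False[OF _ b]) simp
  have "srun decode_prog ?s ((1 + (3 + 1) + 1) + (8 * length r + 1) + 2) (s(0 := (rev (sys (decode r)) @ sy b # out, []), 1 := z))"
    unfolding decode_prog_def
    by (rule srun_Loop_True[OF _ srun_Seq[OF a c] z[unfolded decode_prog_def]]) simp
  then show ?case by (intro exI[of _ z]) (erule srun_conv, auto)
next
  case ("2_1")
  have "srun decode_prog (s(0 := (out, []), 1 := (l, []))) 1 (s(0 := (out, []), 1 := (l, [])))"
    unfolding decode_prog_def by (rule srun_Loop_False) simp
  then show ?case by (intro exI[of _ "(l, [])"]) (erule srun_conv, auto)
next
  case ("2_3" v)
  show ?case
  proof (cases v)
    case True
    have "srun decode_prog (s(0 := (out, []), 1 := (l, [2]))) 1 (s(0 := (out, []), 1 := (l, [2])))"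
      unfolding decode_prog_def by (rule srun_Loop_False) simp
    then show ?thesis by (intro exI[of _ "(l, [2])"]) (erule srun_conv, auto simp: True)
  next
    case False
  let ?s = "s(0 := (out, []), 1 := (l, sys [False]))"
  let ?s1 = "s(0 := (out, []), 1 := (1 # l, []))"
  have a: "srun (rt 1) ?s 1 ?s1" by (rule srun_eq[OF srun_rt]) (auto simp: fun_eq_iff)
  have c: "srun (Cond (\<lambda>a. a 1 = 0) Skip (Seq (em 0 (\<lambda>a. a 1)) (rt 1))) ?s1 (0 + 1) ?s1"
    by (rule srun_Cond_True[OF _ srun_Skip]) simp
  have d: "srun decode_prog ?s1 1 ?s1" unfolding decode_prog_def by (rule srun_Loop_False) simp
  have "srun decode_prog ?s ((1 + (0 + 1) + 1) + 1 + 2) ?s1"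
    unfolding decode_prog_def
    by (rule srun_Loop_True[OF _ srun_Seq[OF a c] d[unfolded decode_prog_def]]) simp
  then show ?thesis by (intro exI[of _ "(1 # l, [])"]) (erule srun_conv, auto simp: False)
  qed
next
  case ("2_2" x)
  have "srun decode_prog (s(0 := (out, []), 1 := (l, sys (True # x)))) 1 (s(0 := (out, []), 1 := (l, sys (True # x))))"
    unfolding decode_prog_def by (rule srun_Loop_False) simp
  then show ?case by (intro exI[of _ "(l, sys (True # x))"]) (erule srun_conv, auto)
qed

lemma poly_time_decode: "poly_time_on A decode"
proof (rule poly_time_on_program)
  show "wf_com 2 7 decode_prog" by (simp add: decode_prog_def)
  show "poly_bound (\<lambda>n. 8 * n + 1)" by (intro poly_bound_intros)
  fix x
  have e: "(\<lambda>t. ([], []))(0 := ([], []), 1 := ([6], sys x)) = start_store x"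
    by (auto simp: start_store_def fun_eq_iff)
  show "\<exists>s'. srun decode_prog (start_store x) (8 * length x + 1) s' \<and> s' 0 = (rev (sys (decode x)), [])"
    using srun_decode[of "\<lambda>t. ([], [])" "[]" "[6]" x] unfolding e by fastforce
qed simp_all

section \<open>Testing whether an encoded pebbling has cost zero\<close>

definition scan_list :: com where
  "scan_list = Loop (\<lambda>a. a 3 = 1) (Cond (\<lambda>a. a 1 = 1) (Seq (rt 1) (rt 1))
     (Seq (rt 1) (Seq (Cond (\<lambda>a. a 1 = 2) (wr 3 2) Skip) (rt 1))))"

text \<open>The bits of an encoded list come in pairs, and \<open>[True, True]\<close> occurs as an
  aligned pair only at its end. Tape 3 holds 1 while the list lasts and 2 from this pair on.\<close>

lemma srun_scan_list:
  assumes "(True, True) \<notin> set ps"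
  shows "srun scan_list (s(1 := (l, sys (concat (map (\<lambda>(p, q). [p, q]) ps) @ True # True # r)), 3 := ([], [1])))
     (10 * length ps + 12)
     (s(1 := (rev (sys (concat (map (\<lambda>(p, q). [p, q]) ps) @ [True, True])) @ l, sys r), 3 := ([], [2])))"
  using assms
proof (induction ps arbitrary: l)
  case Nil
  let ?s = "s(1 := (l, 2 # 2 # sys r), 3 := ([], [1]))"
  let ?s1 = "s(1 := (2 # l, 2 # sys r), 3 := ([], [1]))"
  let ?s2 = "s(1 := (2 # l, 2 # sys r), 3 := ([], [2]))"
  let ?s3 = "s(1 := (2 # 2 # l, sys r), 3 := ([], [2]))"
  have a: "srun (rt 1) ?s 1 ?s1" by (rule srun_eq[OF srun_rt]) (auto simp: fun_eq_iff)
  have w: "srun (wr 3 2) ?s1 1 ?s2" by (rule srun_eq[OF srun_wr]) (auto simp: fun_eq_iff)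
  have b: "srun (Cond (\<lambda>a. a 1 = 2) (wr 3 2) Skip) ?s1 (1 + 1) ?s2"
    by (rule srun_Cond_True[OF _ w]) simp
  have c: "srun (rt 1) ?s2 1 ?s3" by (rule srun_eq[OF srun_rt]) (auto simp: fun_eq_iff)
  have d: "srun (Cond (\<lambda>a. a 1 = 1) (Seq (rt 1) (rt 1))
     (Seq (rt 1) (Seq (Cond (\<lambda>a. a 1 = 2) (wr 3 2) Skip) (rt 1)))) ?s ((1 + ((1 + 1) + 1 + 1) + 1) + 1) ?s3"
    by (rule srun_Cond_False[OF _ srun_Seq[OF a srun_Seq[OF b c]]]) simp
  have e: "srun scan_list ?s3 1 ?s3" unfolding scan_list_def by (rule srun_Loop_False) simp
  have "srun scan_list ?s (((1 + ((1 + 1) + 1 + 1) + 1) + 1) + 1 + 2) ?s3"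
    unfolding scan_list_def by (rule srun_Loop_True[OF _ d e[unfolded scan_list_def]]) simp
  then show ?case by (rule srun_conv) auto
next
  case (Cons pq ps)
  obtain p q where pq: "pq = (p, q)" by fastforce
  let ?r = "concat (map (\<lambda>(p, q). [p, q]) ps) @ True # True # r"
  let ?s = "s(1 := (l, sy p # sy q # sys ?r), 3 := ([], [1]))"
  let ?s1 = "s(1 := (sy p # l, sy q # sys ?r), 3 := ([], [1]))"
  let ?s2 = "s(1 := (sy q # sy p # l, sys ?r), 3 := ([], [1]))"
  have a: "srun (rt 1) ?s 1 ?s1" by (rule srun_eq[OF srun_rt]) (auto simp: fun_eq_iff)
  have b: "srun (rt 1) ?s1 1 ?s2" by (rule srun_eq[OF srun_rt]) (auto simp: fun_eq_iff)
  have d: "srun (Cond (\<lambda>a. a 1 = 1) (Seq (rt 1) (rt 1))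
     (Seq (rt 1) (Seq (Cond (\<lambda>a. a 1 = 2) (wr 3 2) Skip) (rt 1)))) ?s 6 ?s2"
  proof (cases p)
    case False
    have "srun (Cond (\<lambda>a. a 1 = 1) (Seq (rt 1) (rt 1))
     (Seq (rt 1) (Seq (Cond (\<lambda>a. a 1 = 2) (wr 3 2) Skip) (rt 1)))) ?s ((1 + 1 + 1) + 1) ?s2"
      by (rule srun_Cond_True[OF _ srun_Seq[OF a b]]) (use False in simp)
    then show ?thesis by (rule srun_mono) simp
  next
    case True
    then have q: "\<not> q" using Cons.prems pq by auto
    have c: "srun (Cond (\<lambda>a. a 1 = 2) (wr 3 2) Skip) ?s1 (0 + 1) ?s1"
      by (rule srun_Cond_False[OF _ srun_Skip]) (use q in simp)
    have "srun (Cond (\<lambda>a. a 1 = 1) (Seq (rt 1) (rt 1))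
     (Seq (rt 1) (Seq (Cond (\<lambda>a. a 1 = 2) (wr 3 2) Skip) (rt 1)))) ?s ((1 + ((0 + 1) + 1 + 1) + 1) + 1) ?s2"
      by (rule srun_Cond_False[OF _ srun_Seq[OF a srun_Seq[OF c b]]]) (use True in simp)
    then show ?thesis by (rule srun_mono) simp
  qed
  have IH: "srun scan_list ?s2 (10 * length ps + 12)
     (s(1 := (rev (sys (concat (map (\<lambda>(p, q). [p, q]) ps) @ [True, True])) @ sy q # sy p # l, sys r), 3 := ([], [2])))"
    using Cons.IH[of "sy q # sy p # l"] Cons.prems by (simp del: fun_upd_apply)
  have "srun scan_list ?s (6 + (10 * length ps + 12) + 2)
     (s(1 := (rev (sys (concat (map (\<lambda>(p, q). [p, q]) ps) @ [True, True])) @ sy q # sy p # l, sys r), 3 := ([], [2])))"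
    unfolding scan_list_def by (rule srun_Loop_True[OF _ d IH[unfolded scan_list_def]]) simp
  then show ?case by (rule srun_conv) (auto simp: pq fun_eq_iff)
qed

definition nat_pairs :: "nat \<Rightarrow> (bool \<times> bool) list" where
  "nat_pairs n = map (Pair False) (bin n) @ [(True, False)]"

lemma enc_nat_pairs: "enc_nat n = concat (map (\<lambda>(p, q). [p, q]) (nat_pairs n))"
  by (simp add: enc_nat_def tag_def nat_pairs_def o_def)

lemma enc_list_pairs: "enc_list xs = concat (map (\<lambda>(p, q). [p, q]) (concat (map nat_pairs xs))) @ [True, True]"
  by (induction xs) (auto simp: enc_list_def enc_nat_pairs)

text \<open>A function on all strings, whose value on an encoded pebbling is determined because the
  encoding is injective.\<close>

definition zero_cost_bits :: "bool list \<Rightarrow> bool list" where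
  "zero_cost_bits y = [\<exists>ss. y = enc_pebbling ss \<and> cost ss = 0]"

lemma enc_step_inj: "enc_step s = enc_step s' \<Longrightarrow> s = s'"
  by (cases s; cases s') auto

lemma zero_cost_bits_enc: "zero_cost_bits (enc_pebbling ss) = [cost ss = 0]"
proof -
  have "ss = ss'" if "enc_pebbling ss = enc_pebbling ss'" for ss'
  proof -
    have "map enc_step ss = map enc_step ss'" using that enc_inj unfolding enc_pebbling_def by blast
    then show ?thesis by (rule list.inj_map_strong[rotated]) (rule enc_step_inj)
  qed
  then show ?thesis unfolding zero_cost_bits_def by auto
qed

text \<open>A move that costs something is \<open>[0, v]\<close> or \<open>[1, v]\<close>; among the codes of the four kinds of
  moves these are the ones whose first or third bit is \<open>True\<close>.\<close>

lemma bits_enc_step: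
  "\<exists>r. enc_list (enc_step s) = [True, False] @ r \<and> step_cost s \<noteq> 0 \<or>
       enc_list (enc_step s) = [False, True, True, False] @ r \<and> step_cost s \<noteq> 0 \<or>
       enc_list (enc_step s) = [False, False, False, True] @ r \<and> step_cost s = 0 \<or>
       enc_list (enc_step s) = [False, True, False, True] @ r \<and> step_cost s = 0"
  by (cases s) (auto simp: enc_list_def enc_nat_def tag_def bin.simps)

text \<open>The bits that reveal the cost are inspected first and the head returns, so that the
  skipping of the list starts at an aligned position.\<close>

definition check_step :: com where
  "check_step = Seq (Cond (\<lambda>a. a 1 = 2) (wr 2 1)
     (Seq (rt 1) (Seq (rt 1) (Seq (Cond (\<lambda>a. a 1 = 2) (wr 2 1) Skip) (Seq (lf 1) (lf 1))))))
     (Seq (wr 3 1) scan_list)"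

definition check_prog :: com where
  "check_prog = Seq (Loop (\<lambda>a. a 1 \<noteq> 0) check_step) (em 0 (\<lambda>a. if a 2 = 1 then 1 else 2))"

text \<open>Tape 2 is blank at the start, so a blank has to mean that no costly move has been
  seen.\<close>

definition flag :: "bool \<Rightarrow> nat list" where
  "flag b = (if b then [] else [1])"

lemma srun_check_step:
  assumes z: "z = ([], []) \<or> z = ([], [2])"
  shows "srun check_step (s(1 := (l, sys (enc_list (enc_step st) @ r)), 2 := ([], flag b), 3 := z))
     (10 * length (enc_list (enc_step st)) + 30)
     (s(1 := (rev (sys (enc_list (enc_step st))) @ l, sys r), 2 := ([], flag (b \<and> step_cost st = 0)), 3 := ([], [2])))"
proof -
  define c where "c = Cond (\<lambda>a. a 1 = 2) (wr 2 1)
     (Seq (rt 1) (Seq (rt 1) (Seq (Cond (\<lambda>a. a 1 = 2) (wr 2 1) Skip) (Seq (lf 1) (lf 1)))))"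
  let ?e = "enc_list (enc_step st)"
  let ?s = "s(1 := (l, sys (?e @ r)), 2 := ([], flag b), 3 := z)"
  let ?s1 = "s(1 := (l, sys (?e @ r)), 2 := ([], flag (b \<and> step_cost st = 0)), 3 := z)"
  obtain u where "?e = [True, False] @ u \<and> step_cost st \<noteq> 0 \<or>
       ?e = [False, True, True, False] @ u \<and> step_cost st \<noteq> 0 \<or>
       ?e = [False, False, False, True] @ u \<and> step_cost st = 0 \<or>
       ?e = [False, True, False, True] @ u \<and> step_cost st = 0" using bits_enc_step by blast
  then have "?e = [True, False] @ u \<and> step_cost st \<noteq> 0 \<or>
      (\<exists>p q. ?e = [False, p, q, \<not> q] @ u \<and> (q \<longleftrightarrow> step_cost st \<noteq> 0))"
  proof (elim disjE conjE)
    assume "?e = [False, True, True, False] @ u" "step_cost st \<noteq> 0"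
    then show ?thesis by (intro disjI2 exI[of _ True] exI[of _ True]) simp
  next
    assume "?e = [False, False, False, True] @ u" "step_cost st = 0"
    then show ?thesis by (intro disjI2 exI[of _ False] exI[of _ False]) simp
  next
    assume "?e = [False, True, False, True] @ u" "step_cost st = 0"
    then show ?thesis by (intro disjI2 exI[of _ True] exI[of _ False]) simp
  qed simp
  then consider (a) "?e = [True, False] @ u" "step_cost st \<noteq> 0"
    | (b) p q where "?e = [False, p, q, \<not> q] @ u" "q \<longleftrightarrow> step_cost st \<noteq> 0" by blast
  then have 1: "srun c ?s 12 ?s1"
  proof cases
    case a
    have w: "srun (wr 2 1) ?s 1 ?s1" by (rule srun_eq[OF srun_wr]) (use a in \<open>auto simp: fun_eq_iff flag_def\<close>)
    have "srun c ?s (1 + 1) ?s1" unfolding c_def by (rule srun_Cond_True[OF _ w]) (simp add: a)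
    then show ?thesis by (rule srun_mono) simp
  next
    case b
    let ?t = "sy (\<not> q) # sys (u @ r)"
    let ?m1 = "s(1 := (1 # l, sy p # sy q # ?t), 2 := ([], flag b), 3 := z)"
    let ?m2 = "s(1 := (sy p # 1 # l, sy q # ?t), 2 := ([], flag b), 3 := z)"
    let ?m3 = "s(1 := (sy p # 1 # l, sy q # ?t), 2 := ([], flag (b \<and> step_cost st = 0)), 3 := z)"
    let ?m4 = "s(1 := (1 # l, sy p # sy q # ?t), 2 := ([], flag (b \<and> step_cost st = 0)), 3 := z)"
    have m1: "srun (rt 1) ?s 1 ?m1" by (rule srun_eq[OF srun_rt]) (auto simp: fun_eq_iff b(1))
    have m2: "srun (rt 1) ?m1 1 ?m2" by (rule srun_eq[OF srun_rt]) (auto simp: fun_eq_iff)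
    have m3: "srun (Cond (\<lambda>a. a 1 = 2) (wr 2 1) Skip) ?m2 (1 + 1) ?m3"
    proof (rule srun_Cond)
      assume "scan ?m2 1 = 2"
      then have "step_cost st \<noteq> 0" using b(2) by simp
      then show "srun (wr 2 1) ?m2 1 ?m3"
        by (intro srun_eq[OF srun_wr]) (auto simp: fun_eq_iff flag_def)
    next
      assume "scan ?m2 1 \<noteq> 2"
      then have "step_cost st = 0" using b(2) by simp
      then show "srun Skip ?m2 1 ?m3" by (intro srun_eq[OF srun_Skip[of _ 1]]) auto
    qed
    have m4: "srun (lf 1) ?m3 1 ?m4" by (rule srun_lf') (auto simp: fun_eq_iff)
    have m5: "srun (lf 1) ?m4 1 ?s1" by (rule srun_lf') (auto simp: fun_eq_iff b(1))
    have "srun c ?s ((1 + (1 + ((1 + 1) + (1 + 1 + 1) + 1) + 1) + 1) + 1) ?s1" unfolding c_def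
      by (rule srun_Cond_False[OF _ srun_Seq[OF m1 srun_Seq[OF m2 srun_Seq[OF m3 srun_Seq[OF m4 m5]]]]]) (simp add: b(1))
    then show ?thesis by (rule srun_mono) simp
  qed
  define ps where "ps = concat (map nat_pairs (enc_step st))"
  have e: "?e = concat (map (\<lambda>(p, q). [p, q]) ps) @ [True, True]" by (simp add: enc_list_pairs ps_def)
  have len: "length ps \<le> length ?e"
  proof -
    have "length ps \<le> length (concat (map (\<lambda>(p, q). [p, q]) ps))" for ps :: "(bool \<times> bool) list"
      by (induction ps) auto
    then show ?thesis unfolding e by (simp add: le_SucI)
  qed
  have nt: "(True, True) \<notin> set ps" by (auto simp: ps_def nat_pairs_def)
  let ?q = "s(1 := (l, sys (?e @ r)), 2 := ([], flag (b \<and> step_cost st = 0)), 3 := ([], [1]))"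
  have 2: "srun (wr 3 1) ?s1 1 ?q" by (rule srun_eq[OF srun_wr]) (use z in \<open>auto simp: fun_eq_iff\<close>)
  have 3: "srun scan_list ?q (10 * length ps + 12)
      (s(1 := (rev (sys ?e) @ l, sys r), 2 := ([], flag (b \<and> step_cost st = 0)), 3 := ([], [2])))"
    using srun_scan_list[OF nt, of "s(2 := ([], flag (b \<and> step_cost st = 0)))" l r]
    by (rule srun_conv) (auto simp: e fun_eq_iff)
  show ?thesis unfolding check_step_def
    by (rule srun_mono[OF srun_Seq[OF 1[unfolded c_def] srun_Seq[OF 2 3]]]) (use len in simp)
qed

lemma poly_time_zero_cost_bits: "poly_time_on (range enc_pebbling) zero_cost_bits"
proof (rule poly_time_on_program)
  show "wf_com 4 7 check_prog" by (auto simp: check_prog_def check_step_def scan_list_def)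
  show "poly_bound (\<lambda>n. n * (10 * n + 32) + 3)" by (intro poly_bound_intros)
  fix x assume "x \<in> range enc_pebbling"
  then obtain ss where x: "x = enc_pebbling ss" by blast
  define es where "es = map (\<lambda>st. enc_list (enc_step st)) ss"
  have xe: "x = concat es" by (simp add: x enc_pebbling_def enc_def es_def o_def)
  \<comment> \<open>Tape 3 is blank before the first move only; later it holds the 2 left behind by
    \<open>scan_list\<close>.\<close>
  define sta where "sta i = (\<lambda>t::nat. ([], []) :: zipper)(1 := (rev (sys (concat (take i es))) @ [6], sys (concat (drop i es))),
      2 := ([], flag (cost (take i ss) = 0)), 3 := if i = 0 then ([], []) else ([], [2]))" for i
  have les: "length es = length ss" by (simp add: es_def)
  have ne: "es ! i \<noteq> []" if "i < length ss" for i using that by (auto simp: es_def enc_list_def)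
  have d: "concat (drop i es) = es ! i @ concat (drop (Suc i) es)" if "i < length ss" for i
    using that les by (metis Cons_nth_drop_Suc concat.simps(2))
  have tk: "concat (take (Suc i) es) = concat (take i es) @ es ! i" if "i < length ss" for i
    using that les by (simp add: take_Suc_conv_app_nth)
  have l: "srun (Loop (\<lambda>a. a 1 \<noteq> 0) check_step) (sta 0) (length ss * ((10 * length x + 30) + 2) + 1) (sta (length ss))"
  proof (rule srun_Loop)
    fix i assume i: "i < length ss"
    show "scan (sta i) 1 \<noteq> 0" using ne[OF i] d[OF i] by (cases "es ! i") (auto simp: sta_def)
    have lx: "length (es ! i) \<le> length x"
    proof -
      have "x = concat (take i es) @ concat (drop i es)" by (simp add: xe flip: concat_append)
      then show ?thesis using d[OF i] by simp
    qed
    have ei: "es ! i = enc_list (enc_step (ss ! i))" using i by (simp add: es_def)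
    have c: "cost (take (Suc i) ss) = 0 \<longleftrightarrow> cost (take i ss) = 0 \<and> step_cost (ss ! i) = 0"
      using i by (simp add: cost_def take_Suc_conv_app_nth)
    show "srun check_step (sta i) (10 * length x + 30) (sta (Suc i))"
      using srun_check_step[where s = "\<lambda>t. ([], [])" and l = "rev (sys (concat (take i es))) @ [6]"
          and st = "ss ! i" and r = "concat (drop (Suc i) es)" and b = "cost (take i ss) = 0"
          and z = "if i = 0 then ([], []) else ([], [2])"]
      unfolding ei[symmetric] d[OF i, symmetric]
      by (rule srun_conv) (use lx in \<open>auto simp: sta_def c tk[OF i]\<close>)
  next
    show "\<not> scan (sta (length ss)) 1 \<noteq> 0" by (simp add: sta_def les)
  qed
  have s0: "sta 0 = start_store x" by (auto simp: sta_def start_store_def xe fun_eq_iff flag_def cost_def)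
  have m: "srun (em 0 (\<lambda>a. if a 2 = 1 then 1 else 2)) (sta (length ss)) 1
      ((sta (length ss))(0 := (rev (sys (zero_cost_bits x)), [])))"
    by (rule srun_eq[OF srun_em]) (auto simp: x zero_cost_bits_enc sta_def flag_def)
  have "length ss \<le> length x"
  proof -
    have "length es \<le> length (concat es)" if "\<forall>e\<in>set es. e \<noteq> []" for es :: "bool list list"
      using that
    proof (induction es)
      case (Cons e es)
      then show ?case by (cases e) auto
    qed simp
    moreover have "\<forall>e\<in>set es. e \<noteq> []" by (auto simp: es_def enc_list_def)
    ultimately show ?thesis using xe les by metis
  qed
  then have "length ss * (10 * length x + 30 + 2) \<le> length x * (10 * length x + 32)" by (intro mult_le_mono) auto
  then have "srun check_prog (start_store x) (length x * (10 * length x + 32) + 3)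
      ((sta (length ss))(0 := (rev (sys (zero_cost_bits x)), [])))"
    unfolding check_prog_def s0[symmetric] by (intro srun_mono[OF srun_Seq[OF l m]]) simp
  then show "\<exists>s'. srun check_prog (start_store x) (length x * (10 * length x + 32) + 3) s' \<and>
      s' 0 = (rev (sys (zero_cost_bits x)), [])" by auto
qed simp_all

section \<open>Constants, counters and selective printing\<close>

primrec ems :: "nat \<Rightarrow> nat list \<Rightarrow> com" where
  "ems t [] = Skip"
| "ems t (x # xs) = Seq (em t (\<lambda>_. x)) (ems t xs)"

lemma srun_ems: "s t = (l, []) \<Longrightarrow> srun (ems t xs) s (2 * length xs) (s(t := (rev xs @ l, [])))"
proof (induction xs arbitrary: s l)
  case Nil
  then show ?case by (auto intro!: srun_conv[OF srun_Skip[of s 0]])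
next
  case (Cons x xs)
  let ?s = "s(t := (x # l, []))"
  have "srun (em t (\<lambda>_. x)) s 1 ?s" by (rule srun_em') (use Cons.prems in auto)
  moreover have "srun (ems t xs) ?s (2 * length xs) (?s(t := (rev xs @ x # l, [])))"
    by (rule Cons.IH) simp
  ultimately have "srun (ems t (x # xs)) s (1 + 2 * length xs + 1) (?s(t := (rev xs @ x # l, [])))"
    unfolding ems.simps by (rule srun_Seq)
  then show ?case by (rule srun_eq) auto
qed

lemma wf_ems [simp]: "t < T \<Longrightarrow> \<forall>x\<in>set xs. x < S \<Longrightarrow> wf_com T S (ems t xs)"
  by (induction xs) auto

definition clear :: "nat \<Rightarrow> com" where
  "clear t = Seq (skip_to t (\<lambda>x. x = 0)) (Seq (lf t)
     (Seq (Loop (\<lambda>a. a t \<noteq> 6) (Seq (wr t 0) (lf t))) (rt t)))"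

lemma wf_clear [simp]: "t < T \<Longrightarrow> 0 < S \<Longrightarrow> wf_com T S (clear t)"
  by (simp add: clear_def)

lemma srun_clear:
  assumes "s t = ([6], xs)" "0 \<notin> set xs" "6 \<notin> set xs"
  shows "srun (clear t) s (8 * length xs + 10) (s(t := ([6], [])))"
proof -
  define ys where "ys = rev xs @ [6]"
  define st where "st i = s(t := (drop (Suc i) ys, [ys ! i]))" for i
  have ysl: "length ys = Suc (length xs)" by (simp add: ys_def)
  have 1: "srun (skip_to t (\<lambda>x. x = 0)) s (3 * length xs + 1) (s(t := (rev xs @ [6], [])))"
  proof (rule srun_skip_to)
    show "\<not> x = 0" if "x \<in> set xs" for x using assms(2) that by metis
  qed (use assms in auto)
  have 2: "srun (lf t) (s(t := (rev xs @ [6], []))) 1 (st 0)"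
  proof (rule srun_lf'[where x = "hd ys" and l = "tl ys" and r = "[]"])
    have "ys \<noteq> []" using ysl by auto
    then show "(s(t := (rev xs @ [6], []))) t = (hd ys # tl ys, [])" by (simp flip: ys_def)
    show "st 0 = (s(t := (rev xs @ [6], [])))(t := (tl ys, [hd ys]))"
      using \<open>ys \<noteq> []\<close> by (cases ys) (auto simp: st_def fun_eq_iff)
  qed
  have 3: "srun (Loop (\<lambda>a. a t \<noteq> 6) (Seq (wr t 0) (lf t))) (st 0) (length xs * ((1 + 1 + 1) + 2) + 1) (st (length xs))"
  proof (rule srun_Loop)
    fix i assume i: "i < length xs"
    have "ys ! i = rev xs ! i" using i by (simp add: ys_def nth_append)
    moreover have "rev xs ! i \<in> set xs" using i by (metis length_rev nth_mem set_rev)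
    ultimately show "scan (st i) t \<noteq> 6" using assms(3) by (auto simp: st_def)
    have d: "drop (Suc i) ys = ys ! Suc i # drop (Suc (Suc i)) ys"
      using i ysl by (simp add: Cons_nth_drop_Suc)
    have a: "srun (wr t 0) (st i) 1 ((st i)(t := (drop (Suc i) ys, [])))"
      by (rule srun_erase) (simp add: st_def)
    have b: "srun (lf t) ((st i)(t := (drop (Suc i) ys, []))) 1 (st (Suc i))"
      by (rule srun_lf'[where x = "ys ! Suc i" and l = "drop (Suc (Suc i)) ys" and r = "[]"])
         (auto simp: st_def d fun_eq_iff)
    show "srun (Seq (wr t 0) (lf t)) (st i) (1 + 1 + 1) (st (Suc i))" by (rule srun_Seq[OF a b])
  next
    show "\<not> scan (st (length xs)) t \<noteq> 6" by (simp add: st_def ys_def nth_append)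
  qed
  have 4: "srun (rt t) (st (length xs)) 1 (s(t := ([6], [])))"
    by (rule srun_rt'[where x = 6 and l = "[]" and r = "[]"]) (auto simp: st_def ys_def fun_eq_iff nth_append)
  show ?thesis unfolding clear_def
    by (rule srun_mono[OF srun_Seq[OF 1 srun_Seq[OF 2 srun_Seq[OF 3 4]]]]) simp
qed

fun incb :: "bool list \<Rightarrow> bool list" where
  "incb [] = [True]"
| "incb (False # b) = True # b"
| "incb (True # b) = False # incb b"

lemma bin_Suc: "bin (Suc n) = incb (bin n)"
proof (induction n rule: less_induct)
  case (less n)
  show ?case
  proof (cases "n = 0")
    case True
    then show ?thesis by (simp add: bin.simps)
  next
    case False
    show ?thesis
    proof (cases "odd n")
      case True
      have "bin (Suc n) = False # bin (Suc (n div 2))" using True by (subst bin.simps) simp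
      also have "\<dots> = False # incb (bin (n div 2))" using less[of "n div 2"] False by simp
      also have "\<dots> = incb (bin n)" using True False by (simp add: bin.simps[of n])
      finally show ?thesis .
    next
      case False
      have "bin (Suc n) = True # bin (n div 2)" using False by (subst bin.simps) simp
      also have "\<dots> = incb (bin n)" using False \<open>n \<noteq> 0\<close> by (simp add: bin.simps[of n])
      finally show ?thesis .
    qed
  qed
qed

text \<open>A bound linear in the value is enough, because all counter values stay polynomial in the
  input length.\<close>

lemma length_bin: "length (bin n) \<le> n"
proof (induction n)
  case 0
  then show ?case by (simp add: bin.simps)
next
  case (Suc n)
  have "length (incb b) \<le> Suc (length b)" for b by (induction b rule: incb.induct) auto
  then show ?case using Suc unfolding bin_Suc by (metis Suc_le_mono order_trans)
qed

text \<open>\<open>j\<close> is the length of the carry. Since \<open>tl [] = []\<close>, the form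
  \<open>True # tl r\<close> also covers an increment that creates a new leading digit.\<close>

lemma incb_split: "\<exists>j r. b = replicate j True @ r \<and> incb b = replicate j False @ True # tl r \<and> (r = [] \<or> \<not> hd r)"
proof (induction b rule: incb.induct)
  case 1
  show ?case by (intro exI[of _ 0] exI[of _ "[]"]) simp
next
  case (2 b)
  show ?case by (intro exI[of _ 0] exI[of _ "False # b"]) simp
next
  case (3 b)
  then obtain j r where "b = replicate j True @ r" "incb b = replicate j False @ True # tl r" "r = [] \<or> \<not> hd r"
    by blast
  then show ?case by (intro exI[of _ "Suc j"] exI[of _ r]) simp
qed

definition inc :: com where
  "inc = Seq (Loop (\<lambda>a. a 7 = 2) (em 7 (\<lambda>_. 1))) (Seq (wr 7 2) (rew 7))"

lemma srun_inc:
  assumes "s 7 = ([6], sys b)"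
  shows "srun inc s (6 * length b + 9) (s(7 := ([6], sys (incb b))))"
proof -
  obtain j r where b: "b = replicate j True @ r" "incb b = replicate j False @ True # tl r" "r = [] \<or> \<not> hd r"
    using incb_split by blast
  define st where "st i = s(7 := (replicate i 1 @ [6], replicate (j - i) 2 @ sys r))" for i
  have 1: "srun (Loop (\<lambda>a. a 7 = 2) (em 7 (\<lambda>_. 1))) (st 0) (j * (1 + 2) + 1) (st j)"
  proof (rule srun_Loop)
    fix i assume i: "i < j"
    then obtain m where m: "j - i = Suc m" by (cases "j - i") auto
    then have m': "j - Suc i = m" by simp
    show "scan (st i) 7 = 2" by (simp add: st_def m)
    show "srun (em 7 (\<lambda>_. 1)) (st i) 1 (st (Suc i))"
      by (rule srun_em') (auto simp: st_def m m' fun_eq_iff)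
  next
    show "scan (st j) 7 \<noteq> 2" using b(3) by (cases r) (auto simp: st_def)
  qed
  have s0: "st 0 = s" using assms by (auto simp: st_def b(1) fun_eq_iff)
  let ?s = "s(7 := (replicate j 1 @ [6], 2 # sys (tl r)))"
  have 2: "srun (wr 7 2) (st j) 1 ?s" by (rule srun_wr') (auto simp: st_def fun_eq_iff map_tl)
  have 3: "srun (rew 7) ?s (3 * length (replicate j (1::nat)) + 5) (?s(7 := ([6], replicate j 1 @ 2 # sys (tl r))))"
    by (rule srun_rew) auto
  have lb: "length b = j + length r" by (simp add: b(1))
  show ?thesis unfolding inc_def
    by (rule srun_conv[OF srun_Seq[OF 1 srun_Seq[OF 2 3]] s0]) (auto simp: b(2) lb fun_eq_iff)
qed

definition out :: "bool list \<Rightarrow> zipper" where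
  "out w = (rev (sys w), [])"

text \<open>Isolates what a printing loop changes, so that loop rules follow only the printed word
  and the counter.\<close>

definition counting :: "(nat \<Rightarrow> zipper) \<Rightarrow> bool list \<Rightarrow> nat \<Rightarrow> nat \<Rightarrow> zipper" where
  "counting s w i = s(0 := out w, 7 := ([6], sys (bin i)))"

lemma counting_simps [simp]:
  "counting s w i 0 = out w" "counting s w i 7 = ([6], sys (bin i))"
  "t \<noteq> 0 \<Longrightarrow> t \<noteq> 7 \<Longrightarrow> counting s w i t = s t"
  "(counting s w i)(0 := out w') = counting s w' i"
  "(counting s w i)(7 := ([6], sys (bin j))) = counting s w j"
  by (auto simp: counting_def fun_eq_iff)

lemma counting_upd: "t \<noteq> 0 \<Longrightarrow> t \<noteq> 7 \<Longrightarrow> (counting s w i)(t := z) = counting (s(t := z)) w i"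
  by (auto simp: counting_def fun_eq_iff)

lemma srun_inc_counting:
  assumes "i < X"
  shows "srun inc (counting s w i) (6 * X + 9) (counting s w (Suc i))"
  by (rule srun_conv[OF srun_inc[of "counting s w i" "bin i"]])
     (use length_bin[of i] assms in \<open>auto simp flip: bin_Suc\<close>)

definition print :: com where
  "print = Seq (For 7 (Seq (em 0 (\<lambda>_. 1)) (em 0 (\<lambda>a. a 7)))) (ems 0 [2, 1])"

lemma srun_print:
  assumes "i \<le> X"
  shows "srun print (counting s w i) (10 * X + 12) (counting s (w @ enc_nat i) i)"
proof -
  let ?b = "bin i"
  define st where "st j = counting s (w @ concat (map (\<lambda>b. [False, b]) (take j ?b))) i" for j
  have 1: "srun (For 7 (Seq (em 0 (\<lambda>_. 1)) (em 0 (\<lambda>a. a 7)))) (counting s w i)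
      (length (sys ?b) * (3 + 7) + 7) (counting s (w @ tag ?b) i)"
  proof (rule srun_For[where st = st])
    fix j assume j: "j < length (sys ?b)"
    then have d: "drop j (sys ?b) = sy (?b ! j) # drop (Suc j) (sys ?b)"
      by (metis Cons_nth_drop_Suc length_map nth_map)
    let ?z = "(rev (take j (sys ?b)) @ [6], drop j (sys ?b))"
    let ?w = "w @ concat (map (\<lambda>b. [False, b]) (take j ?b))"
    have a: "srun (em 0 (\<lambda>_. 1)) ((st j)(7 := ?z)) 1 ((st j)(7 := ?z, 0 := out (?w @ [False])))"
      by (rule srun_em') (auto simp: st_def out_def)
    have b: "srun (em 0 (\<lambda>a. a 7)) ((st j)(7 := ?z, 0 := out (?w @ [False]))) 1 ((st (Suc j))(7 := ?z))"
      by (rule srun_em') (use j in \<open>auto simp: st_def out_def d counting_def fun_eq_iff take_Suc_conv_app_nth\<close>)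
    show "srun (Seq (em 0 (\<lambda>_. 1)) (em 0 (\<lambda>a. a 7))) ((st j)(7 := ?z)) 3 ((st (Suc j))(7 := ?z))"
      by (rule srun_mono[OF srun_Seq[OF a b]]) simp
  qed (auto simp: st_def tag_def)
  have 2: "srun (ems 0 [2, 1]) (counting s (w @ tag ?b) i) (2 * length [2::nat, 1]) ((counting s (w @ tag ?b) i)(0 := (rev [2, 1] @ rev (sys (w @ tag ?b)), [])))"
    by (rule srun_ems) (simp add: out_def)
  have l: "length (bin i) \<le> X" using length_bin[of i] assms by simp
  show ?thesis unfolding print_def
    by (rule srun_conv[OF srun_Seq[OF 1 2]])
       (use l in \<open>auto simp: enc_nat_def out_def counting_def fun_eq_iff\<close>)
qed

definition visit :: "((nat \<Rightarrow> nat) \<Rightarrow> bool) \<Rightarrow> com" where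
  "visit p = Seq (Cond p print Skip) inc"

definition sel :: "(nat \<Rightarrow> bool) \<Rightarrow> nat \<Rightarrow> nat \<Rightarrow> bool list" where
  "sel \<phi> i j = concat (map enc_nat (filter \<phi> [i..<j]))"

text \<open>By this rule the outputs of successive passes, and of the rounds of nested loops, merge
  into the output of one long pass.\<close>

lemma sel_append: "i \<le> j \<Longrightarrow> j \<le> m \<Longrightarrow> sel \<phi> i j @ sel \<phi> j m = sel \<phi> i m"
  unfolding sel_def by (metis concat_append filter_append le_Suc_ex map_append upt_add_eq_append)

lemma sel_empty [simp]: "sel \<phi> i i = []"
  by (simp add: sel_def)

lemma srun_visit:
  assumes "i < X" "p (scan (counting s w i)) = \<phi> i"
  shows "srun (visit p) (counting s w i) (16 * X + 23) (counting s (w @ sel \<phi> i (Suc i)) (Suc i))"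
proof -
  have 1: "srun (Cond p print Skip) (counting s w i) ((10 * X + 12) + 1) (counting s (w @ sel \<phi> i (Suc i)) i)"
  proof (rule srun_Cond)
    assume "p (scan (counting s w i))"
    then show "srun print (counting s w i) (10 * X + 12) (counting s (w @ sel \<phi> i (Suc i)) i)"
      using srun_print[of i X s w] assms by (simp add: sel_def)
  next
    assume "\<not> p (scan (counting s w i))"
    then show "srun Skip (counting s w i) (10 * X + 12) (counting s (w @ sel \<phi> i (Suc i)) i)"
      using assms srun_Skip by (simp add: sel_def)
  qed
  show ?thesis unfolding visit_def
    by (rule srun_mono[OF srun_Seq[OF 1 srun_inc_counting[OF assms(1)]]]) simp
qed

lemma wf_inc [simp]: "7 < T \<Longrightarrow> 2 < S \<Longrightarrow> wf_com T S inc"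
  by (simp add: inc_def)

lemma wf_print [simp]: "7 < T \<Longrightarrow> 2 < S \<Longrightarrow> wf_com T S print"
  by (simp add: print_def)

lemma wf_visit [simp]: "7 < T \<Longrightarrow> 2 < S \<Longrightarrow> wf_com T S (visit p)"
  by (simp add: visit_def)

definition head_at :: "nat list \<Rightarrow> nat \<Rightarrow> zipper" where
  "head_at xs j = (rev (take j xs) @ [6], drop j xs)"

lemma cur_head_at: "j < length xs \<Longrightarrow> cur (head_at xs j) = xs ! j"
  by (simp add: head_at_def cur_def flip: Cons_nth_drop_Suc)

text \<open>A body that advances the counter by \<open>n\<close> may itself be a loop over
  \<open>n\<close> symbols. Nested loops thus enumerate pairs in row-major order, which is the order
  of \<open>node_index\<close>.\<close>

lemma srun_For_count:
  assumes t: "t \<noteq> 0" "t \<noteq> 7" "s t = ([6], xs)" and xs: "0 \<notin> set xs" "6 \<notin> set xs"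
    and body: "\<And>j w. j < length xs \<Longrightarrow> srun c (counting (s(t := head_at xs j)) w (i + j * n)) B
        (counting (s(t := head_at xs j)) (w @ sel \<phi> (i + j * n) (i + Suc j * n)) (i + Suc j * n))"
  shows "srun (For t c) (counting s w i) (length xs * (B + 7) + 7)
     (counting s (w @ sel \<phi> i (i + length xs * n)) (i + length xs * n))"
proof (rule srun_For[where st = "\<lambda>j. counting s (w @ sel \<phi> i (i + j * n)) (i + j * n)", OF _ xs])
  fix j assume j: "j < length xs"
  have "sel \<phi> i (i + j * n) @ sel \<phi> (i + j * n) (i + Suc j * n) = sel \<phi> i (i + Suc j * n)"
    by (rule sel_append) auto
  then show "srun c ((counting s (w @ sel \<phi> i (i + j * n)) (i + j * n))(t := (rev (take j xs) @ [6], drop j xs))) B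
      ((counting s (w @ sel \<phi> i (i + Suc j * n)) (i + Suc j * n))(t := (rev (take j xs) @ [6], drop j xs)))"
    using body[OF j, of "w @ sel \<phi> i (i + j * n)"] t(1,2) by (simp add: counting_upd head_at_def)
qed (use t in \<open>auto simp: counting_def fun_eq_iff\<close>)

lemma srun_For_visit:
  assumes t: "t \<noteq> 0" "t \<noteq> 7" "s t = ([6], xs)" and xs: "0 \<notin> set xs" "6 \<notin> set xs"
    and X: "i + length xs \<le> X"
    and p: "\<And>j w. j < length xs \<Longrightarrow> p (scan (counting (s(t := head_at xs j)) w (i + j))) = \<phi> (i + j)"
  shows "srun (For t (visit p)) (counting s w i) (length xs * (16 * X + 30) + 7)
     (counting s (w @ sel \<phi> i (i + length xs)) (i + length xs))"
proof -
  have "srun (visit p) (counting (s(t := head_at xs j)) w (i + j * 1)) (16 * X + 23)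
        (counting (s(t := head_at xs j)) (w @ sel \<phi> (i + j * 1) (i + Suc j * 1)) (i + Suc j * 1))"
    if "j < length xs" for j w
    using srun_visit[of "i + j" X p "s(t := head_at xs j)" w \<phi>] p[OF that] X that by simp
  from srun_For_count[OF t xs this] show ?thesis by (rule srun_conv) auto
qed

lemma srun_For_items_count:
  assumes t: "t \<noteq> 0" "t \<noteq> 7" "s t = ([6], items yss)"
    and yss: "\<And>ys. ys \<in> set yss \<Longrightarrow> 0 \<notin> set ys \<and> 5 \<notin> set ys \<and> 6 \<notin> set ys \<and> length ys \<le> L"
    and body: "\<And>j w. j < length yss \<Longrightarrow> \<exists>u v. yss ! j = u @ v \<and>
        srun c (counting (s(t := (rev (items (take j yss)) @ [6], items (drop j yss)))) w (i + j * n)) B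
        (counting (s(t := (rev u @ rev (items (take j yss)) @ [6], v @ 5 # items (drop (Suc j) yss))))
           (w @ sel \<phi> (i + j * n) (i + Suc j * n)) (i + Suc j * n))"
  shows "srun (For_items t c) (counting s w i) (length yss * (B + 6 * L + 10) + 7)
     (counting s (w @ sel \<phi> i (i + length yss * n)) (i + length yss * n))"
proof (rule srun_For_items[where st = "\<lambda>j. counting s (w @ sel \<phi> i (i + j * n)) (i + j * n)", OF _ yss])
  fix j assume j: "j < length yss"
  have "sel \<phi> i (i + j * n) @ sel \<phi> (i + j * n) (i + Suc j * n) = sel \<phi> i (i + Suc j * n)"
    by (rule sel_append) auto
  then show "\<exists>u v. yss ! j = u @ v \<and>
      srun c ((counting s (w @ sel \<phi> i (i + j * n)) (i + j * n))(t := (rev (items (take j yss)) @ [6], items (drop j yss)))) B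
      ((counting s (w @ sel \<phi> i (i + Suc j * n)) (i + Suc j * n))(t := (rev u @ rev (items (take j yss)) @ [6], v @ 5 # items (drop (Suc j) yss))))"
    using body[OF j, of "w @ sel \<phi> i (i + j * n)"] t(1,2) by (simp add: counting_upd)
qed (use t in \<open>auto simp: counting_def fun_eq_iff\<close>)

definition copy_to_items :: "nat \<Rightarrow> com" where
  "copy_to_items t = For t (em 2 (\<lambda>a. a t))"

lemma srun_copy_to_items:
  assumes "t \<noteq> 2" "s t = ([6], xs)" "0 \<notin> set xs" "6 \<notin> set xs" "s 2 = (l, [])"
  shows "srun (copy_to_items t) s (8 * length xs + 7) (s(2 := (rev xs @ l, [])))"
proof -
  have "srun (For t (em 2 (\<lambda>a. a t))) s (length xs * (1 + 7) + 7) (s(2 := (rev xs @ l, [])))"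
  proof (rule srun_For[where st = "\<lambda>i. s(2 := (rev (take i xs) @ l, []))", OF _ assms(3,4)])
    fix i assume i: "i < length xs"
    then have d: "drop i xs = xs ! i # drop (Suc i) xs" by (simp add: Cons_nth_drop_Suc)
    show "srun (em 2 (\<lambda>a. a t)) (s(2 := (rev (take i xs) @ l, []), t := (rev (take i xs) @ [6], drop i xs))) 1
        (s(2 := (rev (take (Suc i) xs) @ l, []), t := (rev (take i xs) @ [6], drop i xs)))"
      by (rule srun_em') (use i assms(1) in \<open>auto simp: d take_Suc_conv_app_nth fun_eq_iff\<close>)
  qed (use assms in \<open>auto simp: fun_eq_iff\<close>)
  then show ?thesis unfolding copy_to_items_def by (rule srun_mono) simp
qed

definition read_nat :: "nat \<Rightarrow> com" where
  "read_nat t = Seq (Loop (\<lambda>a. a 1 = 1) (Seq (rt 1) (Seq (em t (\<lambda>a. a 1)) (rt 1))))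
     (Seq (rt 1) (Seq (rt 1) (rew t)))"

lemma srun_read_nat:
  assumes t: "t \<noteq> 1" "s t = ([6], [])" and s1: "s 1 = (l, sys (enc_nat n @ r))"
  shows "srun (read_nat t) s (10 * length (bin n) + 20)
     (s(1 := (rev (sys (enc_nat n)) @ l, sys r), t := ([6], sys (bin n))))"
proof -
  let ?b = "bin n"
  define st where "st i = s(1 := (rev (sys (tag (take i ?b))) @ l, sys (tag (drop i ?b) @ [True, False] @ r)),
     t := (rev (sys (take i ?b)) @ [6], []))" for i
  have s0: "st 0 = s" using t s1 by (auto simp: st_def enc_nat_def fun_eq_iff tag_def)
  have 1: "srun (Loop (\<lambda>a. a 1 = 1) (Seq (rt 1) (Seq (em t (\<lambda>a. a 1)) (rt 1)))) (st 0)
      (length ?b * ((1 + (1 + 1 + 1) + 1) + 2) + 1) (st (length ?b))"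
  proof (rule srun_Loop)
    fix i assume i: "i < length ?b"
    then have d: "drop i ?b = ?b ! i # drop (Suc i) ?b" by (simp add: Cons_nth_drop_Suc)
    show "scan (st i) 1 = 1" using t by (simp add: st_def d tag_def)
    let ?R = "sys (tag (drop (Suc i) ?b) @ [True, False] @ r)"
    let ?L = "rev (sys (tag (take i ?b))) @ l"
    let ?s1 = "s(1 := (1 # ?L, sy (?b ! i) # ?R), t := (rev (sys (take i ?b)) @ [6], []))"
    let ?s2 = "s(1 := (1 # ?L, sy (?b ! i) # ?R), t := (rev (sys (take (Suc i) ?b)) @ [6], []))"
    have a: "srun (rt 1) (st i) 1 ?s1"
      by (rule srun_rt') (use t in \<open>auto simp: st_def d tag_def fun_eq_iff\<close>)
    have b: "srun (em t (\<lambda>a. a 1)) ?s1 1 ?s2"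
      by (rule srun_em') (use t i in \<open>auto simp: take_Suc_conv_app_nth fun_eq_iff\<close>)
    have c: "srun (rt 1) ?s2 1 (st (Suc i))"
      by (rule srun_rt') (use t i in \<open>auto simp: st_def take_Suc_conv_app_nth tag_def fun_eq_iff\<close>)
    show "srun (Seq (rt 1) (Seq (em t (\<lambda>a. a 1)) (rt 1))) (st i) (1 + (1 + 1 + 1) + 1) (st (Suc i))"
      by (rule srun_Seq[OF a srun_Seq[OF b c]])
  next
    show "scan (st (length ?b)) 1 \<noteq> 1" using t by (simp add: st_def tag_def)
  qed
  let ?s1 = "s(1 := (2 # rev (sys (tag ?b)) @ l, 1 # sys r), t := (rev (sys ?b) @ [6], []))"
  let ?s2 = "s(1 := (1 # 2 # rev (sys (tag ?b)) @ l, sys r), t := (rev (sys ?b) @ [6], []))"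
  have 2: "srun (rt 1) (st (length ?b)) 1 ?s1"
    by (rule srun_rt') (use t in \<open>auto simp: st_def tag_def fun_eq_iff\<close>)
  have 3: "srun (rt 1) ?s1 1 ?s2" by (rule srun_rt') (use t in \<open>auto simp: fun_eq_iff\<close>)
  have 4: "srun (rew t) ?s2 (3 * length (sys ?b) + 5) (?s2(t := ([6], sys ?b @ [])))"
    by (rule srun_rew) (use in_sys[of 6 ?b] in auto)
  show ?thesis unfolding read_nat_def
    by (rule srun_conv[OF srun_Seq[OF 1 srun_Seq[OF 2 srun_Seq[OF 3 4]]] s0])
       (auto simp: enc_nat_def fun_eq_iff)
qed

lemma wf_copy_read [simp]: "t < T \<Longrightarrow> 2 < T \<Longrightarrow> wf_com T S (copy_to_items t)"
  "t < T \<Longrightarrow> 2 < T \<Longrightarrow> wf_com T S (read_nat t)"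
  by (auto simp: copy_to_items_def read_nat_def)

section \<open>Comparing two claims\<close>

definition walk :: com where
  "walk = Loop (\<lambda>a. a 2 = a 3 \<and> (a 2 = 1 \<or> a 2 = 2)) (Seq (rt 2) (rt 3))"

text \<open>The separator \<open>c\<close> is not a bit, so both heads stop at the first difference
  or where one word ends. In particular the words are equal exactly if both rests are empty.\<close>

lemma srun_walk:
  assumes "set x \<subseteq> {1, 2}" "set x' \<subseteq> {1, 2}" "3 \<le> c"
  shows "\<exists>u d d'. x = u @ d \<and> x' = u @ d' \<and> (d = [] \<or> d' = [] \<or> hd d \<noteq> hd d') \<and>
     srun walk (s(2 := (l, x @ c # r), 3 := (l', x' @ c # r'))) (5 * length x + 1)
       (s(2 := (rev u @ l, d @ c # r), 3 := (rev u @ l', d' @ c # r')))"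
  using assms(1,2)
proof (induction x arbitrary: x' l l')
  case Nil
  have "srun walk (s(2 := (l, [] @ c # r), 3 := (l', x' @ c # r'))) 1 (s(2 := (l, [] @ c # r), 3 := (l', x' @ c # r')))"
    unfolding walk_def by (rule srun_Loop_False) (use assms(3) in auto)
  then show ?case
    by - (rule exI[of _ "[]"], rule exI[of _ "[]"], rule exI[of _ x'], simp del: fun_upd_apply)
next
  case (Cons a x)
  show ?case
  proof (cases "x' \<noteq> [] \<and> hd x' = a")
    case True
    then obtain x'' where x'': "x' = a # x''" by (cases x') auto
    have px: "set x \<subseteq> {1, 2}" "set x'' \<subseteq> {1, 2}" using Cons.prems x'' by auto
    let ?s = "s(2 := (l, (a # x) @ c # r), 3 := (l', x' @ c # r'))"
    let ?s1 = "s(2 := (a # l, x @ c # r), 3 := (l', x' @ c # r'))"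
    let ?s2 = "s(2 := (a # l, x @ c # r), 3 := (a # l', x'' @ c # r'))"
    obtain u d d' where IH: "x = u @ d" "x'' = u @ d'" "d = [] \<or> d' = [] \<or> hd d \<noteq> hd d'"
      "srun walk ?s2 (5 * length x + 1) (s(2 := (rev u @ a # l, d @ c # r), 3 := (rev u @ a # l', d' @ c # r')))"
      using Cons.IH[OF px, of "a # l" "a # l'"] by blast
    have 1: "srun (rt 2) ?s 1 ?s1" by (rule srun_rt') (auto simp: fun_eq_iff)
    have 2: "srun (rt 3) ?s1 1 ?s2" by (rule srun_rt') (auto simp: fun_eq_iff x'')
    have "srun walk ?s ((1 + 1 + 1) + (5 * length x + 1) + 2) (s(2 := (rev u @ a # l, d @ c # r), 3 := (rev u @ a # l', d' @ c # r')))"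
      unfolding walk_def
      by (rule srun_Loop_True[OF _ srun_Seq[OF 1 2] IH(4)[unfolded walk_def]]) (use Cons.prems x'' in auto)
    then have "srun walk ?s (5 * length (a # x) + 1)
        (s(2 := (rev (a # u) @ l, d @ c # r), 3 := (rev (a # u) @ l', d' @ c # r')))"
      by (rule srun_conv) auto
    then show ?thesis using IH(1-3) x'' by (metis append_Cons)
  next
    case False
    have "srun walk (s(2 := (l, (a # x) @ c # r), 3 := (l', x' @ c # r'))) 1 (s(2 := (l, (a # x) @ c # r), 3 := (l', x' @ c # r')))"
      unfolding walk_def by (rule srun_Loop_False) (use False Cons.prems assms(3) in \<open>cases x'; auto\<close>)
    then have "srun walk (s(2 := (l, (a # x) @ c # r), 3 := (l', x' @ c # r'))) (5 * length (a # x) + 1) (s(2 := (l, (a # x) @ c # r), 3 := (l', x' @ c # r')))"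
      by (rule srun_mono) simp
    moreover have "a # x = [] \<or> x' = [] \<or> hd (a # x) \<noteq> hd x'" using False by auto
    ultimately show ?thesis
      by - (rule exI[of _ "[]"], rule exI[of _ "a # x"], rule exI[of _ x'], simp del: fun_upd_apply)
  qed
qed

definition claim_string :: "nat list \<Rightarrow> nat list \<Rightarrow> nat list" where
  "claim_string v a = v @ 3 # a @ [4]"

text \<open>Labels are compared only if both heads have reached the separator 3, that is, if the
  vertices agree. The flag on tape 8 is raised but never cleared, so two calls in a row compute the
  disjunction in \<open>clash\<close>.\<close>

definition compare_claims :: com where
  "compare_claims = Seq (Seq walk
     (Cond (\<lambda>a. a 2 = 3 \<and> a 3 = 3)
        (Seq (rt 2) (Seq (rt 3) (Seq walk (Cond (\<lambda>a. a 2 \<noteq> a 3) (wr 8 1) Skip)))) Skip))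
     (Seq (skip_to 2 (\<lambda>x. x = 4)) (Seq (rt 2) (Seq (skip_to 3 (\<lambda>x. x = 4)) (rt 3))))"

lemma srun_compare_claims:
  assumes b: "set v \<subseteq> {1, 2}" "set a \<subseteq> {1, 2}" "set v' \<subseteq> {1, 2}" "set a' \<subseteq> {1, 2}"
    and L: "length v + length a + 2 \<le> L" "length v' + length a' + 2 \<le> L"
  shows "srun compare_claims
     (s(2 := (l, claim_string v a @ r), 3 := (l', claim_string v' a' @ r'), 8 := ([], [f])))
     (20 * L + 20)
     (s(2 := (rev (claim_string v a) @ l, r), 3 := (rev (claim_string v' a') @ l', r'),
        8 := ([], [if v = v' \<and> a \<noteq> a' then 1 else f])))"
proof -
  let ?f = "if v = v' \<and> a \<noteq> a' then 1 else f"
  let ?c = "Cond (\<lambda>a. a 2 = 3 \<and> a 3 = 3)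
        (Seq (rt 2) (Seq (rt 3) (Seq walk (Cond (\<lambda>a. a 2 \<noteq> a 3) (wr 8 1) Skip)))) Skip"
  let ?s0 = "s(2 := (l, claim_string v a @ r), 3 := (l', claim_string v' a' @ r'), 8 := ([], [f]))"
  \<comment> \<open>Wherever the comparison stops, the rests \<open>h\<close> and \<open>h'\<close>
    contain no 4. Skipping to 4 therefore takes both heads to the ends of their own claims.\<close>
  have "\<exists>g h g' h'. claim_string v a = g @ h @ [4] \<and> claim_string v' a' = g' @ h' @ [4] \<and> 4 \<notin> set h \<and> 4 \<notin> set h' \<and>
      srun (Seq walk ?c) ?s0 (10 * L + 15)
      (s(2 := (rev g @ l, h @ 4 # r), 3 := (rev g' @ l', h' @ 4 # r'), 8 := ([], [?f])))"
  proof -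
    obtain u d d' where u: "v = u @ d" "v' = u @ d'" "d = [] \<or> d' = [] \<or> hd d \<noteq> hd d'"
      and w: "srun walk ((s(8 := ([], [f])))(2 := (l, v @ 3 # a @ 4 # r), 3 := (l', v' @ 3 # a' @ 4 # r'))) (5 * length v + 1)
       ((s(8 := ([], [f])))(2 := (rev u @ l, d @ 3 # a @ 4 # r), 3 := (rev u @ l', d' @ 3 # a' @ 4 # r')))"
      using srun_walk[OF b(1,3) order_refl, of "s(8 := ([], [f]))" l "a @ 4 # r" l' "a' @ 4 # r'"] by blast
    have w1: "srun walk ?s0 (5 * L + 1)
       (s(2 := (rev u @ l, d @ 3 # a @ 4 # r), 3 := (rev u @ l', d' @ 3 # a' @ 4 # r'), 8 := ([], [f])))"
      by (rule srun_conv[OF w]) (use L in \<open>auto simp: claim_string_def fun_eq_iff\<close>)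
    have bd: "set d \<subseteq> {1, 2}" "set d' \<subseteq> {1, 2}" using b u by auto
    show ?thesis
    proof (cases "d = [] \<and> d' = []")
      case False
      have "v \<noteq> v'" using u False by auto
      have "srun ?c (s(2 := (rev u @ l, d @ 3 # a @ 4 # r), 3 := (rev u @ l', d' @ 3 # a' @ 4 # r'), 8 := ([], [f]))) (0 + 1)
         (s(2 := (rev u @ l, d @ 3 # a @ 4 # r), 3 := (rev u @ l', d' @ 3 # a' @ 4 # r'), 8 := ([], [f])))"
        by (rule srun_Cond_False[OF _ srun_Skip]) (use False bd in \<open>cases d; cases d'; auto\<close>)
      from srun_Seq[OF w1 this] have "srun (Seq walk ?c) ?s0 (10 * L + 15)
         (s(2 := (rev u @ l, (d @ 3 # a) @ 4 # r), 3 := (rev u @ l', (d' @ 3 # a') @ 4 # r'), 8 := ([], [?f])))"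
        by (rule srun_conv) (use \<open>v \<noteq> v'\<close> in auto)
      moreover have "4 \<notin> set (d @ 3 # a)" "4 \<notin> set (d' @ 3 # a')" using bd b by auto
      moreover have "claim_string v a = u @ (d @ 3 # a) @ [4]" "claim_string v' a' = u @ (d' @ 3 # a') @ [4]"
        by (simp_all add: claim_string_def u)
      ultimately show ?thesis by blast
    next
      case True
      then have vv: "v = v'" "v = u" using u by auto
      let ?s1 = "s(2 := (rev u @ l, 3 # a @ 4 # r), 3 := (rev u @ l', 3 # a' @ 4 # r'), 8 := ([], [f]))"
      let ?s2 = "s(2 := (3 # rev u @ l, a @ 4 # r), 3 := (rev u @ l', 3 # a' @ 4 # r'), 8 := ([], [f]))"
      let ?s3 = "s(2 := (3 # rev u @ l, a @ 4 # r), 3 := (3 # rev u @ l', a' @ 4 # r'), 8 := ([], [f]))"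
      have 1: "srun (rt 2) ?s1 1 ?s2" by (rule srun_rt') (auto simp: fun_eq_iff)
      have 2: "srun (rt 3) ?s2 1 ?s3" by (rule srun_rt') (auto simp: fun_eq_iff)
      have le34: "3 \<le> (4::nat)" by simp
      obtain g h h' where g: "a = g @ h" "a' = g @ h'" "h = [] \<or> h' = [] \<or> hd h \<noteq> hd h'"
        and w': "srun walk ((s(8 := ([], [f])))(2 := (3 # rev u @ l, a @ 4 # r), 3 := (3 # rev u @ l', a' @ 4 # r'))) (5 * length a + 1)
          ((s(8 := ([], [f])))(2 := (rev g @ 3 # rev u @ l, h @ 4 # r), 3 := (rev g @ 3 # rev u @ l', h' @ 4 # r')))"
        using srun_walk[OF b(2,4) le34, of "s(8 := ([], [f]))" "3 # rev u @ l" r "3 # rev u @ l'" r'] by blast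
      let ?s4 = "s(2 := (rev g @ 3 # rev u @ l, h @ 4 # r), 3 := (rev g @ 3 # rev u @ l', h' @ 4 # r'), 8 := ([], [f]))"
      let ?s5 = "s(2 := (rev g @ 3 # rev u @ l, h @ 4 # r), 3 := (rev g @ 3 # rev u @ l', h' @ 4 # r'), 8 := ([], [?f]))"
      have 3: "srun walk ?s3 (5 * length a + 1) ?s4"
        by (rule srun_conv[OF w']) (auto simp: fun_eq_iff)
      have bh: "set h \<subseteq> {1, 2}" "set h' \<subseteq> {1, 2}" using b g by auto
      have ne: "scan ?s4 2 \<noteq> scan ?s4 3 \<longleftrightarrow> a \<noteq> a'"
        using g bh by (cases h; cases h'; auto)
      have 4: "srun (Cond (\<lambda>a. a 2 \<noteq> a 3) (wr 8 1) Skip) ?s4 (1 + 1) ?s5"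
      proof (rule srun_Cond)
        assume "scan ?s4 2 \<noteq> scan ?s4 3"
        then have "a \<noteq> a'" using ne by blast
        then show "srun (wr 8 1) ?s4 1 ?s5" by (intro srun_wr') (auto simp: fun_eq_iff vv)
      next
        assume "\<not> scan ?s4 2 \<noteq> scan ?s4 3"
        then have "a = a'" using ne by blast
        then have "?s5 = ?s4" by (simp add: vv)
        then show "srun Skip ?s4 1 ?s5" using srun_Skip[of ?s4 1] by simp
      qed
      have 5: "srun ?c ?s1 ((1 + (1 + ((5 * length a + 1) + (1 + 1) + 1) + 1) + 1) + 1) ?s5"
        by (rule srun_Cond_True[OF _ srun_Seq[OF 1 srun_Seq[OF 2 srun_Seq[OF 3 4]]]]) simp
      have w1': "srun walk ?s0 (5 * L + 1) ?s1" using w1 True by simp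
      have "srun (Seq walk ?c) ?s0 (10 * L + 15)
          (s(2 := (rev (u @ 3 # g) @ l, h @ 4 # r), 3 := (rev (u @ 3 # g) @ l', h' @ 4 # r'), 8 := ([], [?f])))"
        by (rule srun_conv[OF srun_Seq[OF w1' 5]]) (use L in auto)
      moreover have "4 \<notin> set h" "4 \<notin> set h'" using bh by auto
      moreover have "claim_string v a = (u @ 3 # g) @ h @ [4]" "claim_string v' a' = (u @ 3 # g) @ h' @ [4]"
        using vv g by (simp_all add: claim_string_def)
      ultimately show ?thesis by blast
    qed
  qed
  then obtain g h g' h' where e: "claim_string v a = g @ h @ [4]" "claim_string v' a' = g' @ h' @ [4]"
    "4 \<notin> set h" "4 \<notin> set h'" and 1: "srun (Seq walk ?c) ?s0 (10 * L + 15)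
      (s(2 := (rev g @ l, h @ 4 # r), 3 := (rev g' @ l', h' @ 4 # r'), 8 := ([], [?f])))" by blast
  have lh: "length h \<le> L" "length h' \<le> L"
    using arg_cong[OF e(1), of length] arg_cong[OF e(2), of length] L by (auto simp: claim_string_def)
  let ?s1 = "s(2 := (rev g @ l, h @ 4 # r), 3 := (rev g' @ l', h' @ 4 # r'), 8 := ([], [?f]))"
  let ?s2 = "s(2 := (rev h @ rev g @ l, 4 # r), 3 := (rev g' @ l', h' @ 4 # r'), 8 := ([], [?f]))"
  let ?s3 = "s(2 := (4 # rev h @ rev g @ l, r), 3 := (rev g' @ l', h' @ 4 # r'), 8 := ([], [?f]))"
  let ?s4 = "s(2 := (4 # rev h @ rev g @ l, r), 3 := (rev h' @ rev g' @ l', 4 # r'), 8 := ([], [?f]))"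
  let ?s5 = "s(2 := (4 # rev h @ rev g @ l, r), 3 := (4 # rev h' @ rev g' @ l', r'), 8 := ([], [?f]))"
  have 2: "srun (skip_to 2 (\<lambda>x. x = 4)) ?s1 (3 * L + 1) ?s2"
    by (rule srun_conv[OF srun_skip_to[of ?s1 2 "rev g @ l" h "4 # r"]]) (use e lh in \<open>auto simp: fun_eq_iff\<close>)
  have 3: "srun (rt 2) ?s2 1 ?s3" by (rule srun_rt') (auto simp: fun_eq_iff)
  have 4: "srun (skip_to 3 (\<lambda>x. x = 4)) ?s3 (3 * L + 1) ?s4"
    by (rule srun_conv[OF srun_skip_to[of ?s3 3 "rev g' @ l'" h' "4 # r'"]]) (use e lh in \<open>auto simp: fun_eq_iff\<close>)
  have 5: "srun (rt 3) ?s4 1 ?s5" by (rule srun_rt') (auto simp: fun_eq_iff)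
  show ?thesis unfolding compare_claims_def
    by (rule srun_conv[OF srun_Seq[OF 1 srun_Seq[OF 2 srun_Seq[OF 3 srun_Seq[OF 4 5]]]]])
       (use L in \<open>auto simp: e\<close>)
qed

lemma wf_compare_claims [simp]: "8 < T \<Longrightarrow> 1 < S \<Longrightarrow> wf_com T S compare_claims"
  by (simp add: compare_claims_def walk_def)

section \<open>Pebblings of cost zero\<close>

lemma pebble_steps_append:
  "pebble_steps V E R C ss C' \<Longrightarrow> pebble_steps V E R C' ss' C'' \<Longrightarrow> pebble_steps V E R C (ss @ ss') C''"
  by (induction rule: pebble_steps.induct) (auto intro: pebble_steps.Cons)

lemma pebble_steps_one:
  "pebble_step V E C s C' \<Longrightarrow> card {v. fst C' v = Some Red} \<le> R \<Longrightarrow> pebble_steps V E R C [s] C'"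
  by (auto intro: pebble_steps.intros)

lemma delete_all:
  assumes "finite K" "\<And>v. v \<in> K \<Longrightarrow> c v \<noteq> None" "card {v. c v = Some Red} \<le> R"
    "finite {v. c v = Some Red}"
  shows "\<exists>ss. pebble_steps V E R (c, D) ss (\<lambda>v. if v \<in> K then None else c v, D) \<and> cost ss = 0"
  using assms
proof (induction K arbitrary: c rule: finite_induct)
  case empty
  then show ?case by (auto intro!: exI[of _ "[]"] pebble_steps.Nil simp: cost_def)
next
  case (insert k K)
  let ?c = "c(k := None)"
  have sub: "{v. ?c v = Some Red} \<subseteq> {v. c v = Some Red}" by auto
  have le: "card {v. ?c v = Some Red} \<le> R"
    using card_mono[OF insert.prems(3) sub] insert.prems(2) by linarith
  have "\<exists>ss. pebble_steps V E R (?c, D) ss (\<lambda>v. if v \<in> K then None else ?c v, D) \<and> cost ss = 0"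
    using insert.hyps insert.prems(1) le finite_subset[OF sub insert.prems(3)]
    by (intro insert.IH) auto
  then obtain ss where ss: "pebble_steps V E R (?c, D) ss (\<lambda>v. if v \<in> K then None else ?c v, D)" "cost ss = 0"
    by blast
  have "(\<lambda>v. if v \<in> K then None else ?c v) = (\<lambda>v. if v \<in> insert k K then None else c v)" by auto
  then have "pebble_steps V E R (c, D) (Delete k # ss) (\<lambda>v. if v \<in> insert k K then None else c v, D)"
    using ss(1) le insert.prems(1)[of k]
    by (intro pebble_steps.Cons[where C' = "(?c, D)"]) (auto intro: pebble_step.delete)
  then show ?case using ss(2) by (intro exI[of _ "Delete k # ss"]) (simp add: cost_def)
qed

text \<open>A computed node that is not live has no use left in a free pebbling, so its pebble can
  be deleted.\<close>

definition live :: "'v set \<Rightarrow> ('v \<times> 'v) set \<Rightarrow> 'v set \<Rightarrow> 'v set" where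
  "live V E D = {v \<in> D. v \<in> sinks V E \<or> (\<exists>w. (v, w) \<in> E \<and> w \<notin> D)}"

text \<open>Only canonical configurations are considered, in which exactly the live nodes are red.
  They depend on the computed set alone, so a pebbling can be described by a growing set.\<close>

definition free_reach :: "'v set \<Rightarrow> ('v \<times> 'v) set \<Rightarrow> nat \<Rightarrow> 'v set \<Rightarrow> bool" where
  "free_reach V E R D \<longleftrightarrow> finite D \<and> (\<exists>ss. cost ss = 0 \<and>
     pebble_steps V E R (\<lambda>_. None, {}) ss (\<lambda>v. if v \<in> live V E D then Some Red else None, D))"

lemma live_subset: "live V E D \<subseteq> D"
  by (auto simp: live_def)

lemma free_reach_empty: "free_reach V E R {}"
  unfolding free_reach_def live_def by (auto intro!: exI[of _ "[]"] pebble_steps.Nil simp: cost_def)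

lemma free_reach_insert:
  assumes D: "free_reach V E R D" and v: "v \<in> V" "v \<notin> D" and pr: "\<And>u. (u, v) \<in> E \<Longrightarrow> u \<in> D"
    and R: "card (insert v (live V E D)) \<le> R"
  shows "free_reach V E R (insert v D)"
proof -
  let ?L = "live V E"
  let ?c = "\<lambda>u. if u \<in> ?L D then Some Red else None"
  obtain ss where fin: "finite D" and ss: "cost ss = 0" "pebble_steps V E R (\<lambda>_. None, {}) ss (?c, D)"
    using D unfolding free_reach_def by blast
  have red: "{u. (?c(v \<mapsto> Red)) u = Some Red} = insert v (?L D)" by auto
  have finL: "finite (insert v (?L D))" using finite_subset[OF live_subset fin] by simp
  have "?c u = Some Red" if "(u, v) \<in> E" for u
    using pr[OF that] that v(2) unfolding live_def by auto
  then have step: "pebble_step V E (?c, D) (Compute v) (?c(v \<mapsto> Red), insert v D)"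
    using v by (intro pebble_step.compute) auto
  have 1: "pebble_steps V E R (?c, D) [Compute v] (?c(v \<mapsto> Red), insert v D)"
    by (rule pebble_steps_one[OF step]) (use R red in simp)
  define K where "K = insert v (?L D) - ?L (insert v D)"
  obtain ss' where ss': "pebble_steps V E R (?c(v \<mapsto> Red), insert v D) ss'
      (\<lambda>u. if u \<in> K then None else (?c(v \<mapsto> Red)) u, insert v D)" "cost ss' = 0"
  proof -
    have "finite K" using finL by (simp add: K_def)
    moreover have "(?c(v \<mapsto> Red)) u \<noteq> None" if "u \<in> K" for u using that by (auto simp: K_def)
    moreover have "card {u. (?c(v \<mapsto> Red)) u = Some Red} \<le> R" unfolding red by (rule R)
    moreover have "finite {u. (?c(v \<mapsto> Red)) u = Some Red}" unfolding red by (rule finL)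
    ultimately show ?thesis using delete_all[of K "?c(v \<mapsto> Red)" R V E "insert v D"] that by blast
  qed
  have "?L (insert v D) \<subseteq> insert v (?L D)" unfolding live_def by auto
  then have e: "(\<lambda>u. if u \<in> K then None else (?c(v \<mapsto> Red)) u) =
      (\<lambda>u. if u \<in> ?L (insert v D) then Some Red else None)"
    unfolding K_def by (auto simp: fun_eq_iff)
  have "pebble_steps V E R (\<lambda>_. None, {}) (ss @ [Compute v] @ ss')
      (\<lambda>u. if u \<in> ?L (insert v D) then Some Red else None, insert v D)"
    unfolding e[symmetric] by (rule pebble_steps_append[OF ss(2) pebble_steps_append[OF 1 ss'(1)]])
  moreover have "cost (ss @ [Compute v] @ ss') = 0" using ss ss' by (simp add: cost_def)
  ultimately show ?thesis unfolding free_reach_def using fin by blast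
qed

text \<open>While \<open>A\<close> is computed, the live nodes stay inside
  \<open>live V E D \<union> A\<close>, so a single bound covers all intermediate
  configurations.\<close>

lemma free_reach_union:
  assumes "finite A" "free_reach V E R D" "A \<subseteq> V" "A \<inter> D = {}"
    "\<And>u v. v \<in> A \<Longrightarrow> (u, v) \<in> E \<Longrightarrow> u \<in> D" "card (live V E D \<union> A) \<le> R"
  shows "free_reach V E R (D \<union> A)"
  using assms
proof (induction A rule: finite_induct)
  case empty
  then show ?case by simp
next
  case (insert a A)
  have fin: "finite (live V E D \<union> insert a A)"
    using insert.hyps(1) insert.prems(1) finite_subset[OF live_subset] by (auto simp: free_reach_def)
  have le: "card (live V E D \<union> A) \<le> R"
    by (rule order_trans[OF card_mono[OF fin] insert.prems(5)]) auto
  have 1: "free_reach V E R (D \<union> A)" using insert le by (intro insert.IH) auto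
  have "insert a (live V E (D \<union> A)) \<subseteq> live V E D \<union> insert a A" unfolding live_def by auto
  from card_mono[OF fin this] have "card (insert a (live V E (D \<union> A))) \<le> R"
    using insert.prems(5) by linarith
  then have "free_reach V E R (insert a (D \<union> A))"
    using insert.hyps insert.prems by (intro free_reach_insert[OF 1]) auto
  then show ?case by simp
qed

lemma free_reach_pebbling:
  assumes "free_reach V E R V"
  shows "\<exists>ss. is_pebbling V E R ss \<and> cost ss = 0"
proof -
  obtain ss where ss: "cost ss = 0"
    "pebble_steps V E R (\<lambda>_. None, {}) ss (\<lambda>v. if v \<in> live V E V then Some Red else None, V)"
    using assms unfolding free_reach_def by blast
  have "sinks V E \<subseteq> live V E V" unfolding live_def sinks_def by auto
  then have "is_pebbling V E R ss" using ss(2) unfolding is_pebbling_def by fastforce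
  then show ?thesis using ss(1) by blast
qed

text \<open>Cost 0 rules out loading, and a node is computed at most once. So a computed node
  without a red pebble never regains one, and none of its out-neighbours can be computed from then
  on.\<close>

lemma steps_free_lost:
  assumes "pebble_steps V E R C ss C'" "cost ss = 0"
  shows "snd C \<subseteq> snd C' \<and> (\<forall>v \<in> snd C. fst C v \<noteq> Some Red \<longrightarrow>
    fst C' v \<noteq> Some Red \<and> (\<forall>w. (v, w) \<in> E \<longrightarrow> w \<in> snd C' \<longrightarrow> w \<in> snd C))"
  using assms
proof (induction rule: pebble_steps.induct)
  case (Nil C)
  then show ?case by simp
next
  case (Cons C s C' ss C'')
  have "cost ss = 0" "step_cost s = 0" using Cons.prems by (auto simp: cost_def)
  note IH = Cons.IH[OF this(1)]
  have "snd C \<subseteq> snd C' \<and> (\<forall>v \<in> snd C. fst C v \<noteq> Some Red \<longrightarrow>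
    fst C' v \<noteq> Some Red \<and> (\<forall>w. (v, w) \<in> E \<longrightarrow> w \<in> snd C' \<longrightarrow> w \<in> snd C))"
    using Cons.hyps(1) \<open>step_cost s = 0\<close> by cases auto
  then show ?case using IH by blast
qed

definition pred_closed :: "('v \<times> 'v) set \<Rightarrow> 'v set \<Rightarrow> bool" where
  "pred_closed E D \<longleftrightarrow> (\<forall>u v. (u, v) \<in> E \<longrightarrow> v \<in> D \<longrightarrow> u \<in> D)"

lemma steps_computed:
  assumes "pebble_steps V E R C ss C'" "snd C \<subseteq> V" "pred_closed E (snd C)"
    "\<forall>v. fst C v \<noteq> None \<longrightarrow> v \<in> snd C"
  shows "snd C' \<subseteq> V \<and> pred_closed E (snd C') \<and> (\<forall>v. fst C' v \<noteq> None \<longrightarrow> v \<in> snd C')"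
  using assms
proof (induction rule: pebble_steps.induct)
  case (Nil C)
  then show ?case by simp
next
  case (Cons C s C' ss C'')
  have "snd C' \<subseteq> V \<and> pred_closed E (snd C') \<and> (\<forall>v. fst C' v \<noteq> None \<longrightarrow> v \<in> snd C')"
    using Cons.hyps(1) Cons.prems
  proof cases
    case (compute v D c)
    have "u \<in> insert v D" if "(u, w) \<in> E" "w \<in> insert v D" for u w
      using that compute Cons.prems unfolding pred_closed_def by (cases "w = v") force+
    then show ?thesis using compute Cons.prems unfolding pred_closed_def by auto
  qed (use Cons.prems in \<open>auto split: if_splits\<close>)
  then show ?case using Cons.IH by blast
qed

text \<open>The number of computed nodes of \<open>X\<close> grows by at most one per step, so it
  passes through \<open>k\<close>. The run is cut at the \<open>Compute\<close> step where this
  happens.\<close>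

lemma steps_moment:
  assumes "pebble_steps V E R C ss C''" "finite X" "card (X \<inter> snd C) < k" "k \<le> card (X \<inter> snd C'')"
  shows "\<exists>ss1 c D v c' ss2. pebble_steps V E R C ss1 (c, D) \<and>
     pebble_step V E (c, D) (Compute v) (c', insert v D) \<and> card {u. c' u = Some Red} \<le> R \<and>
     pebble_steps V E R (c', insert v D) ss2 C'' \<and> ss = ss1 @ Compute v # ss2 \<and>
     v \<in> X \<and> v \<notin> D \<and> Suc (card (X \<inter> D)) = k"
  using assms
proof (induction rule: pebble_steps.induct)
  case (Nil C)
  then show ?case by simp
next
  case (Cons C s C' ss C'')
  show ?case
  proof (cases "card (X \<inter> snd C') < k")
    case True
    from Cons.IH[OF Cons.prems(1) this Cons.prems(3)] obtain ss1 c D v c' ss2 where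
      *: "pebble_steps V E R C' ss1 (c, D)" "pebble_step V E (c, D) (Compute v) (c', insert v D)"
      "card {u. c' u = Some Red} \<le> R" "pebble_steps V E R (c', insert v D) ss2 C''"
      "ss = ss1 @ Compute v # ss2" "v \<in> X" "v \<notin> D" "Suc (card (X \<inter> D)) = k" by blast
    have "pebble_steps V E R C (s # ss1) (c, D)" by (rule pebble_steps.Cons[OF Cons.hyps(1,2) *(1)])
    then show ?thesis using * by (intro exI[of _ "s # ss1"]) auto
  next
    case False
    show ?thesis using Cons.hyps(1)
    proof cases
      case (compute v D c)
      have v: "v \<in> X"
      proof (rule ccontr)
        assume "v \<notin> X"
        then have "X \<inter> insert v D = X \<inter> D" by auto
        then show False using False Cons.prems compute by simp
      qed
      have "card (X \<inter> insert v D) = Suc (card (X \<inter> D))" using v compute Cons.prems(1) by simp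
      then have "Suc (card (X \<inter> D)) = k" using False Cons.prems(2) compute by simp
      then show ?thesis using compute Cons.hyps v
        by - (rule exI[of _ "[]"], rule exI[of _ c], rule exI[of _ D], rule exI[of _ v],
            rule exI[of _ "c(v \<mapsto> Red)"], rule exI[of _ ss], simp add: pebble_steps.Nil del: fun_upd_apply)
    qed (use False Cons.prems in auto)
  qed
qed

text \<open>Without input and output moves a node has to keep its red pebble until all its
  out-neighbours are computed.\<close>

lemma free_pebbling_moment:
  assumes peb: "is_pebbling V E R ss" "cost ss = 0" and fin: "finite V" and E: "E \<subseteq> V \<times> V"
    and all: "\<And>D. pred_closed E D \<Longrightarrow> sinks V E \<subseteq> D \<Longrightarrow> V \<subseteq> D"
    and X: "X \<subseteq> V" "0 < k" "k \<le> card X"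
  obtains D v where "pred_closed E D" "v \<in> X" "v \<notin> D" "Suc (card (X \<inter> D)) = k"
    "\<And>S. S \<subseteq> {u. (u, v) \<in> E} \<union> {v} \<union> {u \<in> D. \<exists>w. (u, w) \<in> E \<and> w \<notin> D \<and> w \<noteq> v} \<Longrightarrow> card S \<le> R"
proof -
  obtain c1 D1 where st: "pebble_steps V E R (\<lambda>_. None, {}) ss (c1, D1)"
    and fs: "\<forall>v \<in> sinks V E. c1 v \<noteq> None" using peb(1) unfolding is_pebbling_def by blast
  have c1: "D1 \<subseteq> V \<and> pred_closed E D1 \<and> (\<forall>v. c1 v \<noteq> None \<longrightarrow> v \<in> D1)"
    using steps_computed[OF st] by (simp add: pred_closed_def)
  then have D1: "V \<subseteq> D1" using all fs by blast
  have fX: "finite X" using X(1) fin finite_subset by blast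
  have "X \<inter> D1 = X" using D1 X by blast
  then obtain ss1 c D v c' ss2 where *: "pebble_steps V E R (\<lambda>_. None, {}) ss1 (c, D)"
     "pebble_step V E (c, D) (Compute v) (c', insert v D)" "card {u. c' u = Some Red} \<le> R"
     "pebble_steps V E R (c', insert v D) ss2 (c1, D1)" "ss = ss1 @ Compute v # ss2"
     "v \<in> X" "v \<notin> D" "Suc (card (X \<inter> D)) = k"
    using steps_moment[OF st fX, of k] X by auto
  have D: "D \<subseteq> V" "pred_closed E D" "\<forall>v. c v \<noteq> None \<longrightarrow> v \<in> D"
    using steps_computed[OF *(1)] by (simp_all add: pred_closed_def)
  have c': "c' = c(v \<mapsto> Red)" "\<And>u. (u, v) \<in> E \<Longrightarrow> c u = Some Red"
    using *(2) by (auto elim: pebble_step.cases)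
  have cost2: "cost ss2 = 0" using peb(2) *(5) by (simp add: cost_def)
  have red: "{u. (u, v) \<in> E} \<union> {v} \<union> {u \<in> D. \<exists>w. (u, w) \<in> E \<and> w \<notin> D \<and> w \<noteq> v} \<subseteq> {u. c' u = Some Red}"
  proof (intro Un_least)
    show "{u \<in> D. \<exists>w. (u, w) \<in> E \<and> w \<notin> D \<and> w \<noteq> v} \<subseteq> {u. c' u = Some Red}"
    proof (rule subsetI, rule CollectI, rule ccontr)
      fix u assume "u \<in> {u \<in> D. \<exists>w. (u, w) \<in> E \<and> w \<notin> D \<and> w \<noteq> v}" and n: "c' u \<noteq> Some Red"
      then obtain w where w: "u \<in> D" "(u, w) \<in> E" "w \<notin> D" "w \<noteq> v" by blast
      \<comment> \<open>Every node is computed in the end, so \<open>w\<close> is computed after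
        \<open>v\<close>; this is impossible if its input \<open>u\<close> has lost its red pebble
        by now.\<close>
      have "w \<in> D1" using w(2) E D1 by blast
      then show False using steps_free_lost[OF *(4) cost2] w n by auto
    qed
  qed (use c' in auto)
  have "{u. c' u = Some Red} \<subseteq> insert v V" using c' D by auto
  then have "finite {u. c' u = Some Red}" using fin finite_subset by blast
  then have "card S \<le> R" if "S \<subseteq> {u. (u, v) \<in> E} \<union> {v} \<union> {u \<in> D. \<exists>w. (u, w) \<in> E \<and> w \<notin> D \<and> w \<noteq> v}" for S
    using card_mono[of "{u. c' u = Some Red}" S] that red *(3) by force
  then show ?thesis using that D(2) *(6-8) by blast
qed

section \<open>Existence of pebblings of arbitrary cost\<close>

lemma load_all:
  assumes "finite K" "\<And>v. v \<in> K \<Longrightarrow> c v = Some Blue" "card ({v. c v = Some Red} \<union> K) \<le> R"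
    "finite {v. c v = Some Red}"
  shows "\<exists>ss. pebble_steps V E R (c, D) ss (\<lambda>v. if v \<in> K then Some Red else c v, D)"
  using assms
proof (induction K arbitrary: c rule: finite_induct)
  case empty
  then show ?case by (auto intro!: exI[of _ "[]"] pebble_steps.Nil)
next
  case (insert k K)
  let ?c = "c(k \<mapsto> Red)"
  have e: "{v. ?c v = Some Red} = insert k {v. c v = Some Red}" by auto
  have f: "finite ({v. c v = Some Red} \<union> insert k K)" using insert by simp
  have le: "card {v. ?c v = Some Red} \<le> R" unfolding e
    using card_mono[OF f, of "insert k {v. c v = Some Red}"] insert.prems(2) by force
  have "\<exists>ss. pebble_steps V E R (?c, D) ss (\<lambda>v. if v \<in> K then Some Red else ?c v, D)"
  proof (rule insert.IH)
    show "card ({v. ?c v = Some Red} \<union> K) \<le> R" unfolding e using insert.prems(2) by simp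
    show "finite {v. ?c v = Some Red}" unfolding e using insert.prems(3) by simp
  qed (use insert.hyps insert.prems(1) in auto)
  then obtain ss where ss: "pebble_steps V E R (?c, D) ss (\<lambda>v. if v \<in> K then Some Red else ?c v, D)"
    by blast
  have "(\<lambda>v. if v \<in> K then Some Red else ?c v) = (\<lambda>v. if v \<in> insert k K then Some Red else c v)" by auto
  then have "pebble_steps V E R (c, D) (Load k # ss) (\<lambda>v. if v \<in> insert k K then Some Red else c v, D)"
    using ss(1) le insert.prems(1)[of k]
    by (intro pebble_steps.Cons[where C' = "(?c, D)"]) (auto intro: pebble_step.load)
  then show ?case by blast
qed

lemma save_all:
  assumes "finite K" "\<And>v. v \<in> K \<Longrightarrow> c v = Some Red" "card {v. c v = Some Red} \<le> R"
    "finite {v. c v = Some Red}"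
  shows "\<exists>ss. pebble_steps V E R (c, D) ss (\<lambda>v. if v \<in> K then Some Blue else c v, D)"
  using assms
proof (induction K arbitrary: c rule: finite_induct)
  case empty
  then show ?case by (auto intro!: exI[of _ "[]"] pebble_steps.Nil)
next
  case (insert k K)
  let ?c = "c(k \<mapsto> Blue)"
  have sub: "{v. ?c v = Some Red} \<subseteq> {v. c v = Some Red}" by auto
  have le: "card {v. ?c v = Some Red} \<le> R"
    using card_mono[OF insert.prems(3) sub] insert.prems(2) by linarith
  have "\<exists>ss. pebble_steps V E R (?c, D) ss (\<lambda>v. if v \<in> K then Some Blue else ?c v, D)"
    using insert.hyps insert.prems(1) le finite_subset[OF sub insert.prems(3)]
    by (intro insert.IH) auto
  then obtain ss where ss: "pebble_steps V E R (?c, D) ss (\<lambda>v. if v \<in> K then Some Blue else ?c v, D)"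
    by blast
  have "(\<lambda>v. if v \<in> K then Some Blue else ?c v) = (\<lambda>v. if v \<in> insert k K then Some Blue else c v)" by auto
  then have "pebble_steps V E R (c, D) (Save k # ss) (\<lambda>v. if v \<in> insert k K then Some Blue else c v, D)"
    using ss(1) le insert.prems(1)[of k]
    by (intro pebble_steps.Cons[where C' = "(?c, D)"]) (auto intro: pebble_step.save)
  then show ?case by blast
qed

text \<open>The guarantee of an approximation algorithm presupposes that a pebbling exists. Keeping
  every computed node blue needs room only for one node together with its inputs.\<close>

definition blue_reach :: "'v set \<Rightarrow> ('v \<times> 'v) set \<Rightarrow> nat \<Rightarrow> 'v set \<Rightarrow> bool" where
  "blue_reach V E R D \<longleftrightarrow> (\<exists>ss.
     pebble_steps V E R (\<lambda>_. None, {}) ss (\<lambda>v. if v \<in> D then Some Blue else None, D))"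

lemma blue_reach_insert:
  assumes D: "blue_reach V E R D" and v: "v \<in> V" "v \<notin> D" and pr: "\<And>u. (u, v) \<in> E \<Longrightarrow> u \<in> D"
    and fin: "finite {u. (u, v) \<in> E}" and R: "card {u. (u, v) \<in> E} < R"
  shows "blue_reach V E R (insert v D)"
proof -
  let ?P = "{u. (u, v) \<in> E}"
  let ?c0 = "\<lambda>u. if u \<in> D then Some Blue else None"
  let ?c1 = "\<lambda>u. if u \<in> ?P then Some Red else ?c0 u"
  let ?c2 = "?c1(v \<mapsto> Red)"
  obtain ss where ss: "pebble_steps V E R (\<lambda>_. None, {}) ss (?c0, D)"
    using D unfolding blue_reach_def by blast
  have r0: "{u. ?c0 u = Some Red} = {}" by auto
  obtain ss1 where ss1: "pebble_steps V E R (?c0, D) ss1 (?c1, D)"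
    using load_all[of ?P ?c0 R V E D] fin R pr r0 by auto
  have red: "{u. ?c2 u = Some Red} = insert v ?P" by auto
  have card: "card {u. ?c2 u = Some Red} \<le> R" unfolding red using fin R by (simp add: card_insert_if)
  have step: "pebble_step V E (?c1, D) (Compute v) (?c2, insert v D)"
    using v by (intro pebble_step.compute) auto
  have ss2: "pebble_steps V E R (?c1, D) [Compute v] (?c2, insert v D)"
    by (rule pebble_steps_one[OF step]) (use card in simp)
  obtain ss3 where ss3: "pebble_steps V E R (?c2, insert v D) ss3
      (\<lambda>u. if u \<in> insert v ?P then Some Blue else ?c2 u, insert v D)"
    using save_all[of "insert v ?P" ?c2 R V E "insert v D"] fin card red by auto
  have e: "(\<lambda>u. if u \<in> insert v ?P then Some Blue else ?c2 u) =
      (\<lambda>u. if u \<in> insert v D then Some Blue else None)" using pr by (auto simp: fun_eq_iff)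
  show ?thesis unfolding blue_reach_def e[symmetric]
    by (rule exI) (rule pebble_steps_append[OF ss pebble_steps_append[OF ss1 pebble_steps_append[OF ss2 ss3]]])
qed

lemma blue_reach_union:
  assumes "finite A" "blue_reach V E R D" "A \<subseteq> V" "A \<inter> D = {}"
    "\<And>u v. v \<in> A \<Longrightarrow> (u, v) \<in> E \<Longrightarrow> u \<in> D"
    "\<And>v. v \<in> A \<Longrightarrow> finite {u. (u, v) \<in> E} \<and> card {u. (u, v) \<in> E} < R"
  shows "blue_reach V E R (D \<union> A)"
  using assms
proof (induction A rule: finite_induct)
  case (insert a A)
  have 1: "blue_reach V E R (D \<union> A)" using insert by (intro insert.IH) auto
  have "blue_reach V E R (insert a (D \<union> A))"
    using insert.hyps insert.prems by (intro blue_reach_insert[OF 1]) auto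
  then show ?case by simp
qed simp

lemma blue_reach_pebbling:
  assumes "blue_reach V E R V"
  shows "\<exists>ss. is_pebbling V E R ss"
proof -
  obtain ss where "pebble_steps V E R (\<lambda>_. None, {}) ss (\<lambda>v. if v \<in> V then Some Blue else None, V)"
    using assms unfolding blue_reach_def by blast
  then have "is_pebbling V E R ss" unfolding is_pebbling_def sinks_def
    by (intro exI[of _ "\<lambda>v. if v \<in> V then Some Blue else None"] exI[of _ V]) auto
  then show ?thesis by blast
qed

section \<open>The gadget\<close>

text \<open>\<open>Link\<close> and \<open>Guard\<close> are the sources belonging to pairs and to
  single items. Links are indexed by ordered pairs, the diagonal included, so that all counts of
  links become squares.\<close>

datatype node = Link nat nat | Guard nat | Item nat | Final

locale gadget =
  fixes N :: nat and conf :: "nat \<Rightarrow> nat \<Rightarrow> bool" and pad :: "nat \<Rightarrow> bool"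
  assumes conf_pad: "conf p q \<Longrightarrow> \<not> pad p \<and> \<not> pad q"
begin

definition V :: "node set" where
  "V = (\<lambda>(p, q). Link p q) ` ({..<N} \<times> {..<N}) \<union> Guard ` {..<N} \<union> Item ` {..<N} \<union> {Final}"

definition E :: "(node \<times> node) set" where
  "E = {(Link p q, Item u) | p q u. p < N \<and> q < N \<and> u < N \<and> (u = p \<or> u = q)} \<union>
       {(Guard u, Item u) | u. u < N} \<union> {(Link p q, Final) | p q. p < N \<and> q < N \<and> conf p q} \<union>
       {(Guard u, Final) | u. u < N \<and> pad u} \<union> {(Item u, Final) | u. u < N}"

lemma finite_V: "finite V" by (simp add: V_def)

lemma E_subset: "E \<subseteq> V \<times> V" by (auto simp: E_def V_def)

lemma E_Link: "\<lbrakk>p < N; q < N\<rbrakk> \<Longrightarrow> (Link p q, w) \<in> E \<longleftrightarrow> w = Item p \<or> w = Item q \<or> (conf p q \<and> w = Final)"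
  by (auto simp: E_def)

lemma E_Guard: "u < N \<Longrightarrow> (Guard u, w) \<in> E \<longleftrightarrow> w = Item u \<or> (pad u \<and> w = Final)"
  by (auto simp: E_def)

lemma E_Item: "u < N \<Longrightarrow> (Item u, w) \<in> E \<longleftrightarrow> w = Final"
  by (auto simp: E_def)

lemma E_Final: "(Final, w) \<notin> E"
  by (auto simp: E_def)

lemma into_Link: "\<lbrakk>p < N; q < N\<rbrakk> \<Longrightarrow> (w, Link p q) \<notin> E"
  by (auto simp: E_def)

lemma into_Guard: "u < N \<Longrightarrow> (w, Guard u) \<notin> E"
  by (auto simp: E_def)

lemma into_Item: "u < N \<Longrightarrow> (w, Item u) \<in> E \<longleftrightarrow>
    (\<exists>p q. p < N \<and> q < N \<and> (u = p \<or> u = q) \<and> w = Link p q) \<or> w = Guard u"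
  by (auto simp: E_def)

lemma into_Final: "(w, Final) \<in> E \<longleftrightarrow> (\<exists>p q. p < N \<and> q < N \<and> conf p q \<and> w = Link p q) \<or>
    (\<exists>u<N. pad u \<and> w = Guard u) \<or> (\<exists>u<N. w = Item u)"
  by (auto simp: E_def)

lemma sinks_eq: "sinks V E = {Final}"
proof -
  have "\<exists>w. (v, w) \<in> E" if "v \<in> V" "v \<noteq> Final" for v
    using that unfolding V_def by (auto simp: E_Link E_Guard E_Item)
  then show ?thesis by (auto simp: sinks_def E_Final V_def)
qed

text \<open>From every node there is a path to \<open>Final\<close>, the only sink.\<close>

lemma all_needed: "pred_closed E D \<Longrightarrow> sinks V E \<subseteq> D \<Longrightarrow> V \<subseteq> D"
proof -
  assume c: "pred_closed E D" and "sinks V E \<subseteq> D"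
  then have zD: "Final \<in> D" by (simp add: sinks_eq)
  have xD: "Item u \<in> D" if "u < N" for u using c zD that E_Item[of u Final] unfolding pred_closed_def by blast
  have "Guard u \<in> D" if "u < N" for u using c xD that E_Guard[of u "Item u"] unfolding pred_closed_def by blast
  moreover have "Link p q \<in> D" if "p < N" "q < N" for p q
    using c xD that E_Link[of p q "Item p"] unfolding pred_closed_def by blast
  ultimately show "V \<subseteq> D" using xD zD unfolding V_def by auto
qed

definition conflicts :: "nat set \<Rightarrow> (nat \<times> nat) set" where
  "conflicts P = {(p, q). p \<in> P \<and> q \<in> P \<and> conf p q}"

text \<open>\<open>held P u\<close> are the nodes that hold a red pebble when \<open>Item u\<close> is computed right after
  the nodes \<open>Item p\<close> for \<open>p \<in> P\<close>.\<close>

definition held_pairs :: "nat set \<Rightarrow> nat \<Rightarrow> (nat \<times> nat) set" where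
  "held_pairs P u = {(p, q). p < N \<and> q < N \<and> (p \<in> insert u P \<or> q \<in> insert u P) \<and>
     \<not> (p \<in> P \<and> q \<in> P \<and> \<not> conf p q)}"

definition held :: "nat set \<Rightarrow> nat \<Rightarrow> node set" where
  "held P u = (\<lambda>(p, q). Link p q) ` held_pairs P u \<union> Guard ` insert u {p \<in> P. pad p} \<union> Item ` insert u P"

lemma held_subsetI:
  "(\<And>p q. (p, q) \<in> held_pairs P u \<Longrightarrow> Link p q \<in> H) \<Longrightarrow> Guard u \<in> H \<Longrightarrow>
   (\<And>p. p \<in> P \<Longrightarrow> pad p \<Longrightarrow> Guard p \<in> H) \<Longrightarrow> (\<And>p. p \<in> P \<Longrightarrow> Item p \<in> H) \<Longrightarrow>
   Item u \<in> H \<Longrightarrow> held P u \<subseteq> H"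
  unfolding held_def by auto

lemma finite_held_pairs: "finite (held_pairs P u)"
  by (rule finite_subset[of _ "{..<N} \<times> {..<N}"]) (auto simp: held_pairs_def)

lemma finite_held: "finite P \<Longrightarrow> finite (held P u)"
  by (simp add: held_def finite_held_pairs)

text \<open>The \<open>N^2\<close> ordered pairs split into the held ones, those that avoid
  \<open>insert u P\<close>, and the conflict-free ones inside \<open>P\<close>, whose links are no
  longer needed.\<close>

lemma card_held_pairs:
  assumes "P \<subseteq> {..<N}" "u < N" "u \<notin> P"
  shows "card (held_pairs P u) + (N - card P - 1)\<^sup>2 + (card P)\<^sup>2 = N\<^sup>2 + card (conflicts P)"
proof -
  have fP: "finite P" using assms(1) finite_subset by blast
  define W where "W = {..<N} - insert u P"
  have cW: "card W = N - card P - 1" using assms fP by (simp add: W_def card_Diff_subset)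
  have fW: "finite W" by (simp add: W_def)
  have fC: "finite (conflicts P)" by (rule finite_subset[of _ "P \<times> P"]) (use fP in \<open>auto simp: conflicts_def\<close>)
  have sC: "conflicts P \<subseteq> P \<times> P" by (auto simp: conflicts_def)
  have "{..<N} \<times> {..<N} = (held_pairs P u \<union> W \<times> W) \<union> (P \<times> P - conflicts P)"
    using assms by (auto simp: held_pairs_def W_def conflicts_def)
  then have "card ({..<N} \<times> {..<N}) = card ((held_pairs P u \<union> W \<times> W) \<union> (P \<times> P - conflicts P))" by simp
  also have "\<dots> = card (held_pairs P u \<union> W \<times> W) + card (P \<times> P - conflicts P)"
    using finite_held_pairs fW fP by (intro card_Un_disjoint) (auto simp: held_pairs_def W_def conflicts_def)
  also have "card (held_pairs P u \<union> W \<times> W) = card (held_pairs P u) + card (W \<times> W)"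
    using finite_held_pairs fW by (intro card_Un_disjoint) (auto simp: held_pairs_def W_def)
  finally have 1: "N\<^sup>2 = card (held_pairs P u) + (N - card P - 1)\<^sup>2 + card (P \<times> P - conflicts P)"
    by (simp add: card_cartesian_product cW power2_eq_square)
  have "card (P \<times> P - conflicts P) + card (conflicts P) = (card P)\<^sup>2"
    using card_Diff_subset[OF fC sC] card_mono[OF _ sC] fP
    by (simp add: card_cartesian_product power2_eq_square)
  then show ?thesis using 1 by simp
qed

text \<open>Computed claims have released their guards, computed pads have not. The summand 2 stands
  for \<open>Guard u\<close> and \<open>Item u\<close>.\<close>

lemma card_held:
  assumes "P \<subseteq> {..<N}" "u < N" "u \<notin> P"
  shows "card (held P u) = card (held_pairs P u) + card {p \<in> P. pad p} + card P + 2"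
proof -
  have fP: "finite P" using assms(1) finite_subset by blast
  have lt: "p < N" if "p \<in> P" for p using assms(1) that by auto
  have 1: "card ((\<lambda>(p, q). Link p q) ` held_pairs P u) = card (held_pairs P u)"
    by (rule card_image) (auto simp: inj_on_def held_pairs_def)
  have 2: "card (Guard ` insert u {p \<in> P. pad p}) = card {p \<in> P. pad p} + 1"
    using assms fP by (subst card_image) (auto simp: inj_on_def lt)
  have 3: "card (Item ` insert u P) = card P + 1"
    using assms fP by (subst card_image) (auto simp: inj_on_def lt)
  have "card (held P u) = card ((\<lambda>(p, q). Link p q) ` held_pairs P u \<union> Guard ` insert u {p \<in> P. pad p})
      + card (Item ` insert u P)"
    unfolding held_def using finite_held_pairs fP assms(2)
    by (intro card_Un_disjoint) (auto simp: held_pairs_def lt)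
  also have "card ((\<lambda>(p, q). Link p q) ` held_pairs P u \<union> Guard ` insert u {p \<in> P. pad p}) =
      card ((\<lambda>(p, q). Link p q) ` held_pairs P u) + card (Guard ` insert u {p \<in> P. pad p})"
    using finite_held_pairs fP assms(2)
    by (intro card_Un_disjoint) (auto simp: held_pairs_def lt)
  finally show ?thesis using 1 2 3 by simp
qed

text \<open>When the item number \<open>M + 1\<close> is computed, the budget forces the claims
  among the first \<open>M\<close> items to outnumber the conflicts by at least \<open>q\<close>.
  Deleting one endpoint per conflict keeps this surplus.\<close>

lemma free_pebbling_imp_independent:
  assumes peb: "is_pebbling V E R ss" "cost ss = 0" and N: "N = 2 * M" "2 \<le> M"
    and R: "R + q \<le> 2 * M\<^sup>2 + 4 * M + 1"
  obtains S where "S \<subseteq> {p. p < N \<and> \<not> pad p}" "q \<le> card S" "conflicts S = {}"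
proof -
  have cX: "card (Item ` {..<N}) = N" by (subst card_image) (auto simp: inj_on_def)
  have X: "Item ` {..<N} \<subseteq> V" by (auto simp: V_def)
  have "M + 1 \<le> card (Item ` {..<N})" unfolding cX using N by linarith
  then have k: "0 < M + 1" "M + 1 \<le> card (Item ` {..<N})" by simp_all
  obtain D v where D: "pred_closed E D" "v \<in> Item ` {..<N}" "v \<notin> D"
    "Suc (card (Item ` {..<N} \<inter> D)) = M + 1"
    and le: "\<And>S. S \<subseteq> {u. (u, v) \<in> E} \<union> {v} \<union> {u \<in> D. \<exists>w. (u, w) \<in> E \<and> w \<notin> D \<and> w \<noteq> v} \<Longrightarrow> card S \<le> R"
    by (rule free_pebbling_moment[OF peb finite_V E_subset all_needed X k]) (assumption | rule that)+
  obtain u where u: "u < N" "v = Item u" using D(2) by auto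
  define P where "P = {p. p < N \<and> Item p \<in> D}"
  have P: "P \<subseteq> {..<N}" "u \<notin> P" "finite P" using D(3) u by (auto simp: P_def)
  have "Item ` {..<N} \<inter> D = Item ` P" by (auto simp: P_def)
  moreover have "card (Item ` P) = card P" by (rule card_image) (auto simp: inj_on_def P_def)
  ultimately have cP: "card P = M" using D(4) by simp
  \<comment> \<open>From \<open>M + 1 < 2 * M\<close> there is one more uncomputed item
    \<open>w\<close>. It keeps \<open>Final\<close> uncomputed, so every computed input of
    \<open>Final\<close> must still be red.\<close>
  have "card (insert u P) < N" using cP P N by simp
  then obtain w where w: "w < N" "w \<notin> P" "w \<noteq> u"
    by (metis card_lessThan card_mono finite_insert P(3) insertCI lessThan_iff linorder_not_less subsetI)
  have zD: "Final \<notin> D"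
  proof
    assume "Final \<in> D"
    then have "Item w \<in> D" using D(1) E_Item[OF w(1), of Final] unfolding pred_closed_def by blast
    then show False using w by (simp add: P_def)
  qed
  have zv: "Final \<noteq> v" using u by simp
  have yD: "Link p q \<in> D" if "p < N" "q < N" "p \<in> P \<or> q \<in> P" for p q
    using that D(1) E_Link[OF that(1,2)] unfolding pred_closed_def P_def by blast
  have gD: "Guard p \<in> D" if "p \<in> P" for p
    using that D(1) E_Guard unfolding pred_closed_def P_def by blast
  let ?H = "{u. (u, v) \<in> E} \<union> {v} \<union> {u \<in> D. \<exists>w. (u, w) \<in> E \<and> w \<notin> D \<and> w \<noteq> v}"
  have "held P u \<subseteq> ?H"
  proof -
    have "Link p q \<in> ?H" if pq: "(p, q) \<in> held_pairs P u" for p q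
    proof -
      have n: "p < N" "q < N" using pq by (auto simp: held_pairs_def)
      show ?thesis
      proof (cases "p = u \<or> q = u")
        case True
        then show ?thesis using n u by (auto simp: E_Link)
      next
        case False
        then have d: "Link p q \<in> D" using pq yD by (auto simp: held_pairs_def)
        have "\<exists>w. (Link p q, w) \<in> E \<and> w \<notin> D \<and> w \<noteq> v"
        proof (cases "conf p q")
          case True
          then show ?thesis using n zD zv by (auto simp: E_Link)
        next
          case nc: False
          \<comment> \<open>An endpoint outside \<open>P\<close> differs from \<open>u\<close> in
            this case, so it is an uncomputed item that still waits for the link.\<close>
          then have "p \<notin> P \<or> q \<notin> P" using pq by (auto simp: held_pairs_def)
          then show ?thesis using n False u by (auto simp: E_Link P_def)
        qed
        then show ?thesis using d by blast
      qed
    qed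
    moreover have "Guard u \<in> ?H" using u by (auto simp: E_Guard)
    moreover have "Guard p \<in> ?H" if "p \<in> P" "pad p" for p
      using gD[OF that(1)] that zD zv by (auto simp: E_Guard P_def)
    moreover have "Item p \<in> ?H" if "p \<in> P" for p using that zD zv by (auto simp: E_Item P_def)
    moreover have "Item u \<in> ?H" using u by auto
    ultimately show ?thesis by (rule held_subsetI)
  qed
  then have "card (held P u) \<le> R" by (rule le)
  then have 1: "card (held_pairs P u) + card {p \<in> P. pad p} + M + 2 \<le> R"
    using card_held[OF P(1) u(1) P(2)] cP by simp
  define Q where "Q = {p \<in> P. \<not> pad p}"
  have fQ: "finite Q" using P by (simp add: Q_def)
  have "card P = card {p \<in> P. pad p} + card Q"
    unfolding Q_def using P(3) by (subst card_Un_disjoint[symmetric]) (auto intro: arg_cong[of _ _ card])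
  then have 2: "M = card {p \<in> P. pad p} + card Q" using cP by simp
  have CPQ: "conflicts P = conflicts Q" using conf_pad by (auto simp: conflicts_def Q_def)
  have 3: "card (held_pairs P u) + (M - 1)\<^sup>2 + M\<^sup>2 = 4 * M\<^sup>2 + card (conflicts Q)"
    using card_held_pairs[OF P(1) u(1) P(2)] N by (simp add: cP CPQ power2_eq_square)
  \<comment> \<open>Writing \<open>M = m + 1\<close> removes the truncated subtraction; the
    collected bounds are then linear in \<open>m\<^sup>2\<close> and \<open>m\<close>.\<close>
  obtain m where m: "M = Suc m" using N(2) by (cases M) auto
  have qQ: "q + card (conflicts Q) \<le> card Q"
  proof -
    have "(M - 1)\<^sup>2 = m\<^sup>2" "M\<^sup>2 = m\<^sup>2 + 2 * m + 1" by (simp_all add: m power2_eq_square)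
    then show ?thesis using 1 2 3 R m by linarith
  qed
  \<comment> \<open>Removing the first endpoint of every conflict loses at most
    \<open>card (conflicts Q)\<close> elements.\<close>
  define S where "S = Q - fst ` conflicts Q"
  have fC: "finite (conflicts Q)" by (rule finite_subset[of _ "Q \<times> Q"]) (use fQ in \<open>auto simp: conflicts_def\<close>)
  have "card Q - card (fst ` conflicts Q) \<le> card S" unfolding S_def by (rule diff_card_le_card_Diff) (use fC in simp)
  moreover have "card (fst ` conflicts Q) \<le> card (conflicts Q)" by (rule card_image_le[OF fC])
  ultimately have "q \<le> card S" using qQ by linarith
  moreover have "conflicts S = {}"
  proof -
    have "(p, r) \<notin> conflicts S" for p r
    proof
      assume "(p, r) \<in> conflicts S"
      then have "(p, r) \<in> conflicts Q" "p \<in> S" by (auto simp: conflicts_def S_def)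
      then show False by (force simp: S_def)
    qed
    then show ?thesis by auto
  qed
  moreover have "S \<subseteq> {p. p < N \<and> \<not> pad p}" using P(1) by (auto simp: S_def Q_def)
  ultimately show ?thesis using that by blast
qed

text \<open>The computed set between two items: sources are postponed until an item needs them, so
  exactly the links that meet \<open>P\<close> and the guards of \<open>P\<close> have been
  computed.\<close>

definition processed :: "nat set \<Rightarrow> node set" where
  "processed P = (\<lambda>(p, q). Link p q) ` {(p, q). p < N \<and> q < N \<and> (p \<in> P \<or> q \<in> P)} \<union> Guard ` P \<union> Item ` P"

text \<open>The sources that \<open>Item u\<close> still lacks are computed first, then the item.
  All nodes that are red on the way lie in \<open>held P u\<close>, so its size is the peak of this
  stage.\<close>

lemma free_reach_processed_insert:
  assumes r: "free_reach V E R (processed P)" and P: "P \<subseteq> {..<N}" "u < N" "u \<notin> P"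
    and R: "card (held P u) \<le> R"
  shows "free_reach V E R (processed (insert u P))"
proof -
  have fP: "finite P" using P(1) finite_subset by blast
  have lt: "p < N" if "p \<in> P" for p using P(1) that by auto
  define A where "A = (\<lambda>(p, q). Link p q) ` {(p, q). p < N \<and> q < N \<and> (p = u \<or> q = u) \<and> p \<notin> P \<and> q \<notin> P} \<union> {Guard u}"
  have xc: "Item p \<in> processed P \<longleftrightarrow> p \<in> P" if "p < N" for p
    using that by (auto simp: processed_def lt)
  have zc: "Final \<notin> processed P" by (auto simp: processed_def lt)
  have yc: "Link p q \<in> processed P \<longleftrightarrow> p \<in> P \<or> q \<in> P" if "p < N" "q < N" for p q
    using that by (auto simp: processed_def lt)
  have gc: "Guard p \<in> processed P \<longleftrightarrow> p \<in> P" if "p < N" for p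
    using that by (auto simp: processed_def lt)
  have live: "live V E (processed P) \<subseteq> held P u"
  proof
    fix v assume v: "v \<in> live V E (processed P)"
    then have vc: "v \<in> processed P" by (auto simp: live_def)
    then have "v \<noteq> Final" using zc by auto
    then obtain w where w: "(v, w) \<in> E" "w \<notin> processed P" using v by (auto simp: live_def sinks_eq)
    from vc consider p q where "p < N" "q < N" "p \<in> P \<or> q \<in> P" "v = Link p q" | p where "p \<in> P" "v = Guard p"
      | p where "p \<in> P" "v = Item p" by (auto simp: processed_def)
    then show "v \<in> held P u"
    proof cases
      case 1
      then have "(p, q) \<in> held_pairs P u" using w by (auto simp: E_Link held_pairs_def xc)
      then show ?thesis using 1 by (auto simp: held_def)
    next
      case 2
      then have "pad p" using w by (auto simp: E_Guard lt xc)
      then show ?thesis using 2 by (auto simp: held_def)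
    next
      case 3
      then show ?thesis by (auto simp: held_def)
    qed
  qed
  have AH: "A \<subseteq> held P u"
    unfolding A_def held_def held_pairs_def by auto
  have fH: "finite (held P u)" by (rule finite_held[OF fP])
  have fA: "finite A" using AH fH finite_subset by blast
  have r1: "free_reach V E R (processed P \<union> A)"
  proof (rule free_reach_union[OF fA r])
    show "A \<subseteq> V" using P(2) by (auto simp: A_def V_def)
    show "A \<inter> processed P = {}" using P by (auto simp: A_def yc gc)
    show "a \<in> processed P" if "v \<in> A" "(a, v) \<in> E" for a v
      using that P(2) by (auto simp: A_def into_Link into_Guard)
    show "card (live V E (processed P) \<union> A) \<le> R"
      using card_mono[OF fH, of "live V E (processed P) \<union> A"] live AH R by auto
  qed
  have e: "processed P \<union> A \<union> {Item u} = processed (insert u P)"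
    using P by (auto simp: processed_def A_def image_iff)
  have xA: "Item u \<notin> A" using P(2) by (auto simp: A_def)
  have "live V E (processed P \<union> A) \<union> {Item u} \<subseteq> held P u"
  proof -
    have "live V E (processed P \<union> A) \<subseteq> live V E (processed P) \<union> A" by (auto simp: live_def)
    then show ?thesis using live AH by (auto simp: held_def)
  qed
  from card_mono[OF fH this] have c: "card (live V E (processed P \<union> A) \<union> {Item u}) \<le> R" using R by linarith
  have "free_reach V E R (processed P \<union> A \<union> {Item u})"
  proof (rule free_reach_union[OF _ r1 _ _ _ c])
    show "{Item u} \<subseteq> V" using P(2) by (auto simp: V_def)
    show "{Item u} \<inter> (processed P \<union> A) = {}" using P xA by (auto simp: xc)
    show "a \<in> processed P \<union> A" if "v \<in> {Item u}" "(a, v) \<in> E" for a v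
    proof -
      from that consider p q where "p < N" "q < N" "u = p \<or> u = q" "a = Link p q" | "a = Guard u"
        using P(2) by (auto simp: into_Item)
      then show ?thesis by cases (auto simp: A_def processed_def)
    qed
  qed simp
  then show ?thesis unfolding e .
qed

lemma card_Final_inputs: "card {v. (v, Final) \<in> E} \<le> card (conflicts {..<N}) + 2 * N" "finite {v. (v, Final) \<in> E}"
proof -
  have fC: "finite (conflicts {..<N})"
    by (rule finite_subset[of _ "{..<N} \<times> {..<N}"]) (auto simp: conflicts_def)
  have s: "{v. (v, Final) \<in> E} \<subseteq> (\<lambda>(p, q). Link p q) ` conflicts {..<N} \<union> (Guard ` {..<N} \<union> Item ` {..<N})"
    by (auto simp: into_Final conflicts_def)
  have f: "finite ((\<lambda>(p, q). Link p q) ` conflicts {..<N} \<union> (Guard ` {..<N} \<union> Item ` {..<N}))" using fC by simp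
  show "finite {v. (v, Final) \<in> E}" using finite_subset[OF s f] .
  have "card {v. (v, Final) \<in> E} \<le> card ((\<lambda>(p, q). Link p q) ` conflicts {..<N}) + (card (Guard ` {..<N}) + card (Item ` {..<N}))"
    using card_mono[OF f s] card_Un_le[of "(\<lambda>(p, q). Link p q) ` conflicts {..<N}" "Guard ` {..<N} \<union> Item ` {..<N}"]
      card_Un_le[of "Guard ` {..<N}" "Item ` {..<N}"] by linarith
  also have "\<dots> \<le> card (conflicts {..<N}) + (N + N)"
    using card_image_le[OF fC] card_image_le[of "{..<N}" Guard] card_image_le[of "{..<N}" Item] by (intro add_mono) auto
  finally show "card {v. (v, Final) \<in> E} \<le> card (conflicts {..<N}) + 2 * N" by simp
qed

lemma V_processed: "V = processed {..<N} \<union> {Final}" "Final \<notin> processed {..<N}"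
  by (auto simp: V_def processed_def image_iff)

text \<open>Once the order of the items is fixed, sources are computed as late as possible. Each
  item then needs room for \<open>held\<close>, and the last stage only for \<open>Final\<close> and
  its inputs.\<close>

lemma free_pebbling_of_order:
  assumes us: "distinct us" "set us = {..<N}"
    and R: "\<And>j. j < N \<Longrightarrow> card (held (set (take j us)) (us ! j)) \<le> R"
    and Rz: "card (conflicts {..<N}) + 2 * N < R"
  shows "\<exists>ss. is_pebbling V E R ss \<and> cost ss = 0"
proof -
  have len: "length us = N" using us distinct_card by fastforce
  have "free_reach V E R (processed (set (take j us)))" if "j \<le> N" for j
    using that
  proof (induction j)
    case 0
    then show ?case using free_reach_empty by (simp add: processed_def)
  next
    case (Suc j)
    have "us ! j \<notin> set (take j us)" using us(1) Suc.prems len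
      by (metis Suc_le_eq distinct_take id_take_nth_drop not_distinct_conv_prefix take_Suc_conv_app_nth)
    moreover have "set (take j us) \<subseteq> {..<N}" using us(2) set_take_subset by fastforce
    moreover have "us ! j < N" using us(2) len Suc.prems nth_mem by fastforce
    ultimately have "free_reach V E R (processed (insert (us ! j) (set (take j us))))"
      using Suc R by (intro free_reach_processed_insert) auto
    then show ?case using Suc.prems len by (simp add: take_Suc_conv_app_nth)
  qed
  from this[of N] have r: "free_reach V E R (processed {..<N})" using us len by simp
  have sub: "live V E (processed {..<N}) \<subseteq> {v. (v, Final) \<in> E}"
  proof
    fix v assume v: "v \<in> live V E (processed {..<N})"
    then have "v \<noteq> Final" using V_processed(2) by (auto simp: live_def)
    then obtain w where w: "(v, w) \<in> E" "w \<notin> processed {..<N}" using v by (auto simp: live_def sinks_eq)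
    then have "w = Final" using E_subset V_processed(1) by auto
    then show "v \<in> {v. (v, Final) \<in> E}" using w by simp
  qed
  have "card (live V E (processed {..<N}) \<union> {Final}) \<le> card {v. (v, Final) \<in> E} + 1"
    using card_Un_le[of "live V E (processed {..<N})" "{Final}"] card_mono[OF card_Final_inputs(2) sub] by simp
  then have c: "card (live V E (processed {..<N}) \<union> {Final}) \<le> R" using card_Final_inputs(1) Rz by linarith
  have "free_reach V E R (processed {..<N} \<union> {Final})"
  proof (rule free_reach_union[OF _ r _ _ _ c])
    show "a \<in> processed {..<N}" if "v \<in> {Final}" "(a, v) \<in> E" for a v
      using that E_subset V_processed(1) E_Final by auto
  qed (use V_processed in auto)
  then show ?thesis using free_reach_pebbling V_processed(1) by simp
qed

text \<open>The order is: the chosen claims, then all pads, then the other claims. The pads carry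
  the pebbling across the peak without conflicts, and the other claims come so late that the
  quadratic term has fallen by more than their conflicts can add.\<close>

lemma independent_imp_free_pebbling:
  assumes S: "S \<subseteq> {p. p < N \<and> \<not> pad p}" "card S = q" "conflicts S = {}"
    and N: "N = 2 * M" "2 * n \<le> M" "0 < n" and n: "card {p. p < N \<and> \<not> pad p} = n"
    and R: "R + q = 2 * M\<^sup>2 + 4 * M + 1"
  shows "\<exists>ss. is_pebbling V E R ss \<and> cost ss = 0"
proof -
  define Vs where "Vs = {p. p < N \<and> \<not> pad p}"
  define Ds where "Ds = {p. p < N \<and> pad p}"
  have fin: "finite Vs" "finite Ds" by (simp_all add: Vs_def Ds_def)
  have finS: "finite S" by (rule finite_subset[OF S(1)]) simp
  have qn: "q \<le> n" using card_mono[OF fin(1), of S] S(1,2) n by (simp add: Vs_def)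
  have "{..<N} = Vs \<union> Ds" "Vs \<inter> Ds = {}" unfolding Vs_def Ds_def by auto
  then have cN: "N = n + card Ds"
    using card_Un_disjoint[OF fin] n card_lessThan[of N] by (simp add: Vs_def)
  obtain ls where ls: "set ls = S" "distinct ls" using finite_distinct_list[OF finS] by blast
  obtain ld where ld: "set ld = Ds" "distinct ld" using finite_distinct_list[OF fin(2)] by blast
  obtain lr where lr: "set lr = Vs - S" "distinct lr" using finite_distinct_list[of "Vs - S"] fin by blast
  define us where "us = ls @ ld @ lr"
  have len: "length ls = q" "length ld = card Ds"
    using ls ld S(2) distinct_card by metis+
  have us: "distinct us" "set us = {..<N}"
    using ls ld lr S(1) unfolding us_def Vs_def Ds_def by auto
  have lenus: "length us = N" using us distinct_card by fastforce
  have cVs: "card (conflicts {..<N}) \<le> n\<^sup>2"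
  proof -
    have "conflicts {..<N} \<subseteq> Vs \<times> Vs" using conf_pad by (auto simp: conflicts_def Vs_def)
    from card_mono[OF _ this] show ?thesis using fin n by (simp add: card_cartesian_product Vs_def power2_eq_square)
  qed
  show ?thesis
  proof (rule free_pebbling_of_order[OF us])
    have "n\<^sup>2 + q + 4 * M < 2 * M\<^sup>2 + 4 * M + 1"
    proof -
      have "q \<le> n\<^sup>2" using qn N(3) self_le_power[of n 2] by simp
      moreover have "n\<^sup>2 \<le> M\<^sup>2" using N by (simp add: power_mono)
      ultimately show ?thesis by linarith
    qed
    then show "card (conflicts {..<N}) + 2 * N < R" using cVs R N by linarith
  next
    fix j assume j: "j < N"
    define P where "P = set (take j us)"
    have uj: "us ! j < N" using us(2) lenus j nth_mem by fastforce
    have P: "P \<subseteq> {..<N}" using us(2) set_take_subset by (fastforce simp: P_def)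
    have un: "us ! j \<notin> P"
      using us(1) lenus j by (auto simp: P_def in_set_conv_nth nth_eq_iff_index_eq)
    have cP: "card P = j" using us(1) lenus j by (simp add: P_def distinct_card)
    define a b where "a = card (conflicts P)" and "b = card {p \<in> P. pad p}"
    \<comment> \<open>The counts of \<open>held\<close> add up to
      \<open>2 * M^2 + 4 * M + 1 - 2 * (M - j)^2 - j + a + b\<close>, so this inequality is the
      budget condition at stage \<open>j\<close>.\<close>
    have key: "int (a + b + q) \<le> int j + 2 * (int M - int j)\<^sup>2"
    proof -
      consider "j < q" | "q \<le> j" "j \<le> q + card Ds" | "q + card Ds < j" by linarith
      then show ?thesis
      proof cases
        case 1
        then have "P \<subseteq> S" using len ls by (auto simp: P_def us_def dest: in_set_takeD)
        then have "conflicts P \<subseteq> conflicts S" "{p \<in> P. pad p} = {}"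
          using S(1) by (auto simp: conflicts_def)
        then have "conflicts P = {}" "{p \<in> P. pad p} = {}" using S(3) by auto
        then have ab: "a = 0" "b = 0" by (simp_all only: a_def b_def card.empty)
        \<comment> \<open>\<open>j < q\<close>, \<open>q \<le> n\<close> and
          \<open>2 * n \<le> M\<close> put the stage at least \<open>q\<close> items before the
          peak, so the square alone pays for \<open>q\<close>.\<close>
        have d: "int M - int j \<ge> int q" using 1 qn N by linarith
        then have "int q * 1 \<le> (int M - int j) * (int M - int j)" using 1 by (intro mult_mono) auto
        then show ?thesis using ab by (simp add: power2_eq_square)
      next
        case 2
        then have P2: "P = S \<union> set (take (j - q) ld)" using len ls by (auto simp: P_def us_def)
        have Ds: "set (take (j - q) ld) \<subseteq> Ds" using ld set_take_subset by fastforce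
        have "conflicts P = conflicts S"
          using conf_pad Ds unfolding P2 by (auto simp: conflicts_def Ds_def)
        then have "a = 0" using S(3) by (simp add: a_def)
        moreover have "{p \<in> P. pad p} = set (take (j - q) ld)"
          using Ds S(1) unfolding P2 by (auto simp: Ds_def)
        \<comment> \<open>Here \<open>a + b + q = j\<close>, so the condition holds even at
          \<open>j = M\<close>, where the square vanishes and the budget is used up.\<close>
        then have "b = j - q" using ld len 2 by (simp add: b_def distinct_card)
        ultimately show ?thesis using 2 by simp
      next
        case 3
        have "conflicts P \<subseteq> conflicts {..<N}" using P by (auto simp: conflicts_def)
        then have "a \<le> card (conflicts {..<N})"
          unfolding a_def by (intro card_mono finite_subset[of "conflicts {..<N}" "{..<N} \<times> {..<N}"]) (auto simp: conflicts_def)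
        then have a: "a \<le> n\<^sup>2" using cVs by linarith
        have "b \<le> card Ds" unfolding b_def using P fin by (intro card_mono) (auto simp: Ds_def)
        then have bq: "int b + int q \<le> int j" using 3 by linarith
        \<comment> \<open>Fewer than \<open>n\<close> items are left and
          \<open>2 * n \<le> M\<close>, so the peak lies at least \<open>n\<close> items back and
          the square outweighs the at most \<open>n^2\<close> conflicts.\<close>
        have "int j - int M \<ge> int n" using 3 cN N by linarith
        then have "(int n)\<^sup>2 \<le> (int j - int M)\<^sup>2" by (intro power_mono) auto
        then have "int a \<le> (int M - int j)\<^sup>2" using a by (simp add: power2_commute flip: of_nat_power)
        moreover have "0 \<le> (int M - int j)\<^sup>2" by simp
        ultimately show ?thesis using bq by linarith
      qed
    qed
    have c: "card (held P (us ! j)) = card (held_pairs P (us ! j)) + b + j + 2"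
      using card_held[OF P uj un] by (simp add: cP b_def)
    have h: "card (held_pairs P (us ! j)) + (N - j - 1)\<^sup>2 + j\<^sup>2 = N\<^sup>2 + a"
      using card_held_pairs[OF P uj un] by (simp add: cP a_def)
    have "int (N - j - 1) = 2 * int M - int j - 1" using j N by simp
    then have h': "int (card (held_pairs P (us ! j))) + (2 * int M - int j - 1)\<^sup>2 + (int j)\<^sup>2 = (2 * int M)\<^sup>2 + int a"
      using arg_cong[OF h, of int] N by simp
    have "int R + int q = 2 * (int M)\<^sup>2 + 4 * int M + 1" using arg_cong[OF R, of int] by simp
    then have "int (card (held P (us ! j))) \<le> int R"
      using h' key unfolding c by (simp add: power2_eq_square algebra_simps)
    then show "card (held (set (take j us)) (us ! j)) \<le> R" by (simp add: P_def)
  qed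
qed

lemma pebbling_exists:
  assumes "card (conflicts {..<N}) + 2 * N < R" "1 \<le> N"
  shows "\<exists>ss. is_pebbling V E R ss"
proof -
  define A where "A = (\<lambda>(p, q). Link p q) ` ({..<N} \<times> {..<N}) \<union> Guard ` {..<N}"
  have 0: "blue_reach V E R {}" unfolding blue_reach_def
    by (rule exI[of _ "[]"]) (simp add: pebble_steps.Nil)
  have noA: "(w, v) \<notin> E" if "v \<in> A" for v w using that by (auto simp: A_def into_Link into_Guard)
  have 1: "blue_reach V E R ({} \<union> A)"
    by (rule blue_reach_union[OF _ 0]) (use assms noA in \<open>auto simp: A_def V_def\<close>)
  have px: "finite {w. (w, Item u) \<in> E} \<and> card {w. (w, Item u) \<in> E} < R" if u: "u < N" for u
  proof -
    \<comment> \<open>\<open>Link u u\<close> is listed only once, which brings the in-degree of an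
      item down to at most \<open>2 * N\<close>, hence below \<open>R\<close>.\<close>
    have s: "{w. (w, Item u) \<in> E} \<subseteq> insert (Guard u) (Link u ` {..<N} \<union> (\<lambda>p. Link p u) ` ({..<N} - {u}))"
      using u by (auto simp: into_Item image_iff)
    have "card (Link u ` {..<N} \<union> (\<lambda>p. Link p u) ` ({..<N} - {u})) \<le> card (Link u ` {..<N}) + card ((\<lambda>p. Link p u) ` ({..<N} - {u}))"
      by (rule card_Un_le)
    also have "\<dots> \<le> N + (N - 1)"
      using card_image_le[of "{..<N}" "Link u"] card_image_le[of "{..<N} - {u}" "\<lambda>p. Link p u"] u
      by (intro add_mono) auto
    finally have "card (insert (Guard u) (Link u ` {..<N} \<union> (\<lambda>p. Link p u) ` ({..<N} - {u}))) \<le> 2 * N"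
      using assms(2) by (intro card_insert_le_m1) auto
    then show ?thesis using card_mono[OF _ s] finite_subset[OF s] assms(1) by fastforce
  qed
  have 2: "blue_reach V E R ({} \<union> A \<union> Item ` {..<N})"
  proof (rule blue_reach_union[OF _ 1])
    show "w \<in> {} \<union> A" if "v \<in> Item ` {..<N}" "(w, v) \<in> E" for w v
      using that by (auto simp: into_Item A_def)
  qed (use px in \<open>auto simp: A_def V_def\<close>)
  have "blue_reach V E R ({} \<union> A \<union> Item ` {..<N} \<union> {Final})"
  proof (rule blue_reach_union[OF _ 2])
    show "w \<in> {} \<union> A \<union> Item ` {..<N}" if "v \<in> {Final}" "(w, v) \<in> E" for w v
      using that by (auto simp: into_Final A_def)
    show "finite {u. (u, v) \<in> E} \<and> card {u. (u, v) \<in> E} < R" if "v \<in> {Final}" for v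
      using that card_Final_inputs assms(1) by fastforce
  qed (auto simp: A_def V_def)
  moreover have "{} \<union> A \<union> Item ` {..<N} \<union> {Final} = V" by (auto simp: A_def V_def)
  ultimately show ?thesis using blue_reach_pebbling by simp
qed

end

section \<open>Renaming the nodes of a pebbling\<close>

definition relabelled :: "('v \<Rightarrow> 'w) \<Rightarrow> 'v set \<Rightarrow> 'v config \<Rightarrow> 'w config \<Rightarrow> bool" where
  "relabelled \<phi> V C C' \<longleftrightarrow> (\<forall>v\<in>V. fst C' (\<phi> v) = fst C v) \<and> (\<forall>w. w \<notin> \<phi> ` V \<longrightarrow> fst C' w = None) \<and>
     (\<forall>v. v \<notin> V \<longrightarrow> fst C v = None) \<and> snd C \<subseteq> V \<and> snd C' = \<phi> ` snd C"

lemma relabelled_update: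
  assumes "relabelled \<phi> V (c, D) (c', D')" "inj_on \<phi> V" "v \<in> V"
  shows "relabelled \<phi> V (c(v := o'), D) (c'(\<phi> v := o'), D')"
proof -
  have "\<phi> w = \<phi> v \<longleftrightarrow> w = v" if "w \<in> V" for w using assms(2,3) that by (auto simp: inj_on_def)
  then show ?thesis using assms(1,3) unfolding relabelled_def by auto
qed

lemma relabelled_step:
  assumes \<phi>: "inj_on \<phi> V" and E: "E \<subseteq> V \<times> V" and st: "pebble_step V E C s C1"
    and r: "relabelled \<phi> V C C'"
  shows "\<exists>C1'. pebble_step (\<phi> ` V) (map_prod \<phi> \<phi> ` E) C' (map_step \<phi> s) C1' \<and> relabelled \<phi> V C1 C1'"
proof -
  obtain c' D' where C': "C' = (c', D')" by fastforce
  have inV: "v \<in> V" if "fst C v \<noteq> None" for v using r that unfolding relabelled_def by auto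
  have val: "c' (\<phi> v) = fst C v" if "v \<in> V" for v using r that C' unfolding relabelled_def by auto
  show ?thesis using st
  proof cases
    case (load c v D)
    then have v: "v \<in> V" using inV[of v] by auto
    have "pebble_step (\<phi> ` V) (map_prod \<phi> \<phi> ` E) (c', D') (Load (\<phi> v)) (c'(\<phi> v \<mapsto> Red), D')"
      using load val[OF v] by (intro pebble_step.load) auto
    then show ?thesis using load C' relabelled_update[OF _ \<phi> v, of c D c' D'] r
      by (intro exI[of _ "(c'(\<phi> v \<mapsto> Red), D')"]) (simp del: fun_upd_apply)
  next
    case (save c v D)
    then have v: "v \<in> V" using inV[of v] by auto
    have "pebble_step (\<phi> ` V) (map_prod \<phi> \<phi> ` E) (c', D') (Save (\<phi> v)) (c'(\<phi> v \<mapsto> Blue), D')"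
      using save val[OF v] by (intro pebble_step.save) auto
    then show ?thesis using save C' relabelled_update[OF _ \<phi> v, of c D c' D'] r
      by (intro exI[of _ "(c'(\<phi> v \<mapsto> Blue), D')"]) (simp del: fun_upd_apply)
  next
    case (compute v D c)
    have D: "D \<subseteq> V" "D' = \<phi> ` D" using r compute C' unfolding relabelled_def by auto
    have "c' u = Some Red" if "(u, \<phi> v) \<in> map_prod \<phi> \<phi> ` E" for u
    proof -
      obtain a b where ab: "(a, b) \<in> E" "u = \<phi> a" "\<phi> v = \<phi> b" using \<open>(u, \<phi> v) \<in> map_prod \<phi> \<phi> ` E\<close> by auto
      have "a \<in> V" "b \<in> V" using ab E by auto
      then have "b = v" using ab(3) \<phi> compute(4) by (auto simp: inj_on_def)
      then show ?thesis using ab compute val[OF \<open>a \<in> V\<close>] by auto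
    qed
    moreover have "\<phi> v \<notin> D'" using D compute \<phi> by (auto simp: inj_on_def)
    ultimately have "pebble_step (\<phi> ` V) (map_prod \<phi> \<phi> ` E) (c', D') (Compute (\<phi> v)) (c'(\<phi> v \<mapsto> Red), insert (\<phi> v) D')"
      using compute by (intro pebble_step.compute) auto
    moreover have "relabelled \<phi> V (c(v \<mapsto> Red), insert v D) (c'(\<phi> v \<mapsto> Red), insert (\<phi> v) D')"
      using relabelled_update[OF _ \<phi> compute(4), of c D c' D'] r compute C' unfolding relabelled_def by auto
    ultimately show ?thesis using compute C'
      by (intro exI[of _ "(c'(\<phi> v \<mapsto> Red), insert (\<phi> v) D')"]) (simp del: fun_upd_apply)
  next
    case (delete c v D)
    then have v: "v \<in> V" using inV[of v] by auto
    have "pebble_step (\<phi> ` V) (map_prod \<phi> \<phi> ` E) (c', D') (Delete (\<phi> v)) (c'(\<phi> v := None), D')"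
      using delete val[OF v] by (intro pebble_step.delete) auto
    then show ?thesis using delete C' relabelled_update[OF _ \<phi> v, of c D c' D'] r
      by (intro exI[of _ "(c'(\<phi> v := None), D')"]) (simp del: fun_upd_apply)
  qed
qed

text \<open>The red nodes after renaming lie in the image of the red nodes before it, so the bound
  \<open>R\<close> is preserved.\<close>

lemma relabelled_steps:
  assumes "pebble_steps V E R C ss C1" "inj_on \<phi> V" "E \<subseteq> V \<times> V" "finite V" "relabelled \<phi> V C C'"
  shows "\<exists>C1'. pebble_steps (\<phi> ` V) (map_prod \<phi> \<phi> ` E) R C' (map (map_step \<phi>) ss) C1' \<and> relabelled \<phi> V C1 C1'"
  using assms
proof (induction arbitrary: C' rule: pebble_steps.induct)
  case (Nil C)
  then show ?case by (intro exI[of _ C']) (simp add: pebble_steps.Nil)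
next
  case (Cons C s C1 ss C2)
  obtain C1' where C1': "pebble_step (\<phi> ` V) (map_prod \<phi> \<phi> ` E) C' (map_step \<phi> s) C1'" "relabelled \<phi> V C1 C1'"
    using relabelled_step[OF Cons.prems(1,2) Cons.hyps(1) Cons.prems(4)] by blast
  have s: "{w. fst C1' w = Some Red} \<subseteq> \<phi> ` {v. fst C1 v = Some Red}"
    using C1'(2) unfolding relabelled_def by force
  have "v \<in> V" if "fst C1 v = Some Red" for v
    using C1'(2) that unfolding relabelled_def by (cases "v \<in> V") auto
  then have "{v. fst C1 v = Some Red} \<subseteq> V" by blast
  then have "finite {v. fst C1 v = Some Red}" using Cons.prems(3) by (rule finite_subset)
  then have le: "card {w. fst C1' w = Some Red} \<le> R"
    using card_mono[OF _ s] card_image_le[of "{v. fst C1 v = Some Red}" \<phi>] Cons.hyps(2) by fastforce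
  obtain C2' where C2': "pebble_steps (\<phi> ` V) (map_prod \<phi> \<phi> ` E) R C1' (map (map_step \<phi>) ss) C2'" "relabelled \<phi> V C2 C2'"
    using Cons.IH[OF Cons.prems(1-3) C1'(2)] by blast
  show ?case unfolding list.map
    by (rule exI[of _ C2']) (intro conjI pebble_steps.Cons[OF C1'(1) le C2'(1)] C2'(2))
qed

lemma cost_map_step: "cost (map (map_step \<phi>) ss) = cost ss"
proof -
  have "step_cost (map_step \<phi> s) = step_cost s" for s by (cases s) auto
  then show ?thesis by (simp add: cost_def o_def)
qed

text \<open>Pebbles lie on nodes of \<open>V\<close> only, so injectivity on \<open>V\<close>
  suffices. It is applied to the numbering of the gadget and to the inverse of that
  numbering.\<close>

lemma relabel_pebbling:
  assumes "is_pebbling V E R ss" "inj_on \<phi> V" "E \<subseteq> V \<times> V" "finite V"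
  shows "is_pebbling (\<phi> ` V) (map_prod \<phi> \<phi> ` E) R (map (map_step \<phi>) ss)"
proof -
  obtain c D where c: "pebble_steps V E R (\<lambda>_. None, {}) ss (c, D)" "\<forall>v \<in> sinks V E. c v \<noteq> None"
    using assms(1) unfolding is_pebbling_def by blast
  have "relabelled \<phi> V (\<lambda>_. None, {}) (\<lambda>_. None, {})" by (simp add: relabelled_def)
  from relabelled_steps[OF c(1) assms(2-4) this] obtain c' D' where
    c': "pebble_steps (\<phi> ` V) (map_prod \<phi> \<phi> ` E) R (\<lambda>_. None, {}) (map (map_step \<phi>) ss) (c', D')"
    "relabelled \<phi> V (c, D) (c', D')" by fastforce
  have "c' w \<noteq> None" if w: "w \<in> sinks (\<phi> ` V) (map_prod \<phi> \<phi> ` E)" for w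
  proof -
    obtain v where v: "v \<in> V" "w = \<phi> v" using w unfolding sinks_def by auto
    have "(v, u) \<notin> E" for u using w v unfolding sinks_def by force
    then have "v \<in> sinks V E" using v by (simp add: sinks_def)
    then have "c v \<noteq> None" using c(2) by blast
    then show ?thesis using c'(2) v unfolding relabelled_def by simp
  qed
  then show ?thesis using c'(1) unfolding is_pebbling_def by blast
qed

section \<open>The gadget as a numbered graph\<close>

definition node_index :: "nat \<Rightarrow> node \<Rightarrow> nat" where
  "node_index N v = (case v of Link p q \<Rightarrow> p * N + q | Guard u \<Rightarrow> N * N + u
     | Item u \<Rightarrow> N * N + N + u | Final \<Rightarrow> N * N + 2 * N)"

definition final_inputs :: "nat \<Rightarrow> (nat \<Rightarrow> nat \<Rightarrow> bool) \<Rightarrow> (nat \<Rightarrow> bool) \<Rightarrow> nat list" where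
  "final_inputs N conf pad = filter (\<lambda>i. conf (i div N) (i mod N)) [0..<N * N] @
     map ((+) (N * N)) (filter pad [0..<N]) @ [N * N + N..<N * N + N + N]"

text \<open>The order is links row by row, then guards, items and the sink. A program can print the
  lists by counting, and every edge leads to a larger number.\<close>

definition gadget_graph :: "nat \<Rightarrow> (nat \<Rightarrow> nat \<Rightarrow> bool) \<Rightarrow> (nat \<Rightarrow> bool) \<Rightarrow> nat list list" where
  "gadget_graph N conf pad = replicate (N * N + N) [] @
     map (\<lambda>u. filter (\<lambda>i. i div N = u \<or> i mod N = u) [0..<N * N] @ [N * N + u]) [0..<N] @
     [final_inputs N conf pad]"

lemma index_lt:
  assumes "p < N" "q < N"
  shows "p * N + q < N * (N::nat)"
proof -
  have "p * N + q < Suc p * N" using assms by simp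
  also have "\<dots> \<le> N * N" using assms by (intro mult_le_mono1) simp
  finally show ?thesis .
qed

context gadget
begin

lemma inj_node_index: "inj_on (node_index N) V"
proof -
  have 1: "p = p' \<and> q = q'" if "p * N + q = p' * N + q'" "q < N" "q' < N" for p q p' q'
  proof -
    have "(p * N + q) div N = (p' * N + q') div N" "(p * N + q) mod N = (p' * N + q') mod N"
      using that(1) by simp_all
    then show ?thesis using that(2,3) by simp
  qed
  show ?thesis
    by (rule inj_onI) (auto simp: V_def node_index_def dest: 1 index_lt)
qed

lemma gadget_nodes: "nodes (gadget_graph N conf pad) = node_index N ` V"
proof -
  have "node_index N ` V = (\<lambda>(p, q). p * N + q) ` ({..<N} \<times> {..<N}) \<union>
     (+) (N * N) ` {..<N} \<union> (+) (N * N + N) ` {..<N} \<union> {N * N + 2 * N}"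
    by (auto simp: V_def node_index_def image_Un image_image split_beta)
  also have "(\<lambda>(p, q). p * N + q) ` ({..<N} \<times> {..<N}) = {..<N * N}"
  proof
    show "{..<N * N} \<subseteq> (\<lambda>(p, q). p * N + q) ` ({..<N} \<times> {..<N})"
    proof
      fix i assume "i \<in> {..<N * N}"
      then have "i div N < N" "i mod N < N" "i = i div N * N + i mod N"
        by (cases "N = 0"; simp add: less_mult_imp_div_less)+
      then show "i \<in> (\<lambda>(p, q). p * N + q) ` ({..<N} \<times> {..<N})"
        by (intro image_eqI[of _ _ "(i div N, i mod N)"]) auto
    qed
  qed (auto simp: index_lt)
  also have "(+) (N * N) ` {..<N} = {N * N..<N * N + N}"
    using image_add_atLeastLessThan[of "N * N" 0 N] by (simp add: lessThan_atLeast0 add.commute)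
  also have "(+) (N * N + N) ` {..<N} = {N * N + N..<N * N + N + N}"
    using image_add_atLeastLessThan[of "N * N + N" 0 N] by (simp add: lessThan_atLeast0 add_ac)
  finally show ?thesis by (auto simp: nodes_def gadget_graph_def)
qed

text \<open>For an item, \<open>j = N * N + N + u\<close>, so that the entry \<open>j - N\<close> is
  the number of its guard.\<close>

lemma gadget_nth:
  assumes "j < length (gadget_graph N conf pad)"
  shows "gadget_graph N conf pad ! j = (if j < N * N + N then []
     else if j < N * N + 2 * N then filter (\<lambda>i. i div N = j - N * N - N \<or> i mod N = j - N * N - N) [0..<N * N] @ [j - N]
     else final_inputs N conf pad)"
proof -
  define A B where "A = replicate (N * N + N) ([] :: nat list)"
    and "B = map (\<lambda>u. filter (\<lambda>i. i div N = u \<or> i mod N = u) [0..<N * N] @ [N * N + u]) [0..<N]"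
  have g: "gadget_graph N conf pad = A @ B @ [final_inputs N conf pad]"
    by (simp add: gadget_graph_def A_def B_def)
  have l: "length A = N * N + N" "length B = N" by (simp_all add: A_def B_def)
  consider "j < N * N + N" | u where "u < N" "j = N * N + N + u" | "j = N * N + N + N"
    using assms l less_Suc_eq unfolding g by (metis (no_types, lifting) add.assoc add_less_cancel_left
        le_iff_add length_append length_append_singleton linorder_not_le)
  then show ?thesis
  proof cases
    case 1
    then show ?thesis unfolding g by (simp add: nth_append l) (simp add: A_def)
  next
    case 2
    then show ?thesis unfolding g by (simp add: nth_append l) (simp add: B_def)
  next
    case 3
    then show ?thesis unfolding g by (simp add: nth_append l)
  qed
qed

lemma gadget_edges: "edges (gadget_graph N conf pad) = map_prod (node_index N) (node_index N) ` E"
proof -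
  have len: "length (gadget_graph N conf pad) = N * N + 2 * N + 1" by (simp add: gadget_graph_def)
  have dm: "i div N < N" "i mod N < N" "i div N * N + i mod N = i" if "i < N * N" for i
    using that by (cases "N = 0"; simp add: less_mult_imp_div_less)+
  have dm': "(p * N + q) div N = p" "(p * N + q) mod N = q" if "q < N" for p q using that by auto
  have edgeI: "(i, j) \<in> map_prod (node_index N) (node_index N) ` E"
    if "(a, b) \<in> E" "i = node_index N a" "j = node_index N b" for a b i j
    using that by force
  have linkI: "(i, j) \<in> map_prod (node_index N) (node_index N) ` E"
    if i: "i < N * N" and b: "(Link (i div N) (i mod N), b) \<in> E" "j = node_index N b" for b i j
    by (rule edgeI[OF b(1) _ b(2)]) (simp add: node_index_def)
  have "(i, j) \<in> map_prod (node_index N) (node_index N) ` E"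
    if j: "j < N * N + 2 * N + 1" and i: "i \<in> set (gadget_graph N conf pad ! j)" for i j
  proof -
    have jl: "j < length (gadget_graph N conf pad)" using j len by simp
    consider "j < N * N + N" | "N * N + N \<le> j" "j < N * N + 2 * N" | "j = N * N + 2 * N"
      using j by linarith
    then show ?thesis
    proof cases
      case 1
      then show ?thesis using i by (simp add: gadget_nth[OF jl])
    next
      case 2
      define u where "u = j - N * N - N"
      have u: "u < N" "j = node_index N (Item u)" using 2 by (auto simp: u_def node_index_def)
      from i 2 consider "i < N * N" "i div N = u \<or> i mod N = u" | "i = N * N + u"
        by (auto simp: gadget_nth[OF jl] u_def)
      then show ?thesis
      proof cases
        case 1
        have "(Link (i div N) (i mod N), Item u) \<in> E" using dm(1,2)[OF 1(1)] 1(2) by (auto simp: E_Link)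
        then show ?thesis by (rule linkI[OF 1(1) _ u(2)])
      next
        case 2
        have "(Guard u, Item u) \<in> E" using u by (simp add: E_Guard)
        then show ?thesis by (rule edgeI[OF _ _ u(2)]) (simp add: node_index_def 2)
      qed
    next
      case 3
      then have jf: "j = node_index N Final" by (simp add: node_index_def)
      have "gadget_graph N conf pad ! j = final_inputs N conf pad" using gadget_nth[OF jl] 3 by simp
      then have "i \<in> set (final_inputs N conf pad)" using i by simp
      then consider "i < N * N" "conf (i div N) (i mod N)" | u where "u < N" "pad u" "i = N * N + u"
        | "N * N + N \<le> i" "i < N * N + N + N"
        by (auto simp: final_inputs_def)
      then show ?thesis
      proof cases
        case 1
        have "(Link (i div N) (i mod N), Final) \<in> E" using dm(1,2)[OF 1(1)] 1(2) by (simp add: E_Link)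
        then show ?thesis by (rule linkI[OF 1(1) _ jf])
      next
        case (2 u)
        have "(Guard u, Final) \<in> E" using 2 by (simp add: E_Guard)
        then show ?thesis by (rule edgeI[OF _ _ jf]) (simp add: node_index_def 2)
      next
        case 3
        define u where "u = i - (N * N + N)"
        have "(Item u, Final) \<in> E" using 3 by (simp add: E_Item u_def)
        then show ?thesis by (rule edgeI[OF _ _ jf]) (use 3 in \<open>simp add: node_index_def u_def\<close>)
      qed
    qed
  qed
  moreover have "node_index N b < N * N + 2 * N + 1 \<and> node_index N a \<in> set (gadget_graph N conf pad ! node_index N b)"
    if "(a, b) \<in> E" for a b
  proof -
    from that consider p q u where "a = Link p q" "b = Item u" "p < N" "q < N" "u < N" "u = p \<or> u = q"
      | u where "a = Guard u" "b = Item u" "u < N" | p q where "a = Link p q" "b = Final" "p < N" "q < N" "conf p q"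
      | u where "a = Guard u" "b = Final" "u < N" "pad u" | u where "a = Item u" "b = Final" "u < N"
      unfolding E_def by blast
    then show ?thesis
    proof cases
      case 1
      then show ?thesis using index_lt[of p N q] dm'[of q p] by (auto simp: gadget_nth len node_index_def)
    next
      case 3
      then show ?thesis using index_lt[of p N q] dm'[of q p] by (auto simp: gadget_nth len node_index_def final_inputs_def)
    qed (auto simp: gadget_nth len node_index_def final_inputs_def)
  qed
  ultimately show ?thesis unfolding edges_def len by (auto 0 3)
qed

text \<open>The numbering is topological, so acyclicity follows from the well-foundedness of
  \<open><\<close>.\<close>

lemma gadget_is_dag: "is_dag (gadget_graph N conf pad)"
proof -
  have "distinct us" if "us \<in> set (gadget_graph N conf pad)" for us
    using that by (auto simp: gadget_graph_def final_inputs_def distinct_map)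
  moreover have "edges (gadget_graph N conf pad) \<subseteq> nodes (gadget_graph N conf pad) \<times> nodes (gadget_graph N conf pad)"
    unfolding gadget_edges gadget_nodes using E_subset by auto
  moreover have "edges (gadget_graph N conf pad) \<subseteq> less_than"
  proof -
    have "node_index N a < node_index N b" if "(a, b) \<in> E" for a b
      using that by (auto simp: E_def node_index_def dest: index_lt[of _ N] intro: trans_less_add1)
    then show ?thesis unfolding gadget_edges by auto
  qed
  then have "acyclic (edges (gadget_graph N conf pad))"
    using acyclic_subset wf_acyclic[OF wf_less_than] by blast
  ultimately show ?thesis unfolding is_dag_def by blast
qed

lemma gadget_pebbling:
  assumes "is_pebbling V E R ss"
  shows "\<exists>ss'. is_pebbling (nodes (gadget_graph N conf pad)) (edges (gadget_graph N conf pad)) R ss' \<and> cost ss' = cost ss"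
  using relabel_pebbling[OF assms inj_node_index E_subset finite_V]
  by (auto simp: gadget_nodes gadget_edges cost_map_step)

lemma pebbling_gadget:
  assumes "is_pebbling (nodes (gadget_graph N conf pad)) (edges (gadget_graph N conf pad)) R ss"
  shows "\<exists>ss'. is_pebbling V E R ss' \<and> cost ss' = cost ss"
proof -
  let ?\<phi> = "inv_into V (node_index N)"
  have 1: "?\<phi> ` node_index N ` V = V" using inj_node_index by (simp add: image_image)
  have "(map_prod ?\<phi> ?\<phi> \<circ> map_prod (node_index N) (node_index N)) ` E = id ` E"
    using E_subset inj_node_index by (intro image_cong) (auto simp: map_prod_def)
  then have 2: "map_prod ?\<phi> ?\<phi> ` map_prod (node_index N) (node_index N) ` E = E" by (simp add: image_comp)
  have "is_pebbling (?\<phi> ` node_index N ` V) (map_prod ?\<phi> ?\<phi> ` map_prod (node_index N) (node_index N) ` E) R (map (map_step ?\<phi>) ss)"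
    by (rule relabel_pebbling) (use assms E_subset finite_V gadget_nodes gadget_edges in \<open>auto simp: inj_on_inv_into\<close>)
  then show ?thesis unfolding 1 2 using cost_map_step by blast
qed

end

section \<open>From unique games to pebblings\<close>

text \<open>A claim does not clash with itself, so both copies of one claim can be chosen, whereas
  different labels for one left vertex always clash.\<close>

definition clash :: "nat \<times> nat \<times> nat \<times> nat \<Rightarrow> nat \<times> nat \<times> nat \<times> nat \<Rightarrow> bool" where
  "clash = (\<lambda>(v, a, w, b) (v', a', w', b'). (v = v' \<and> a \<noteq> a') \<or> (w = w' \<and> b \<noteq> b'))"

text \<open>Sixteen positions belong to each pair of an edge and a label \<open>a\<close> of its left vertex:
  two copies of the claim that this label and the matching label on the right are chosen,
  each followed by seven pads.  Doubling makes the threshold \<open>length I\<close> correspond to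
  half of the edges.\<close>

definition claim :: "nat \<Rightarrow> unique_game \<Rightarrow> nat \<Rightarrow> nat \<times> nat \<times> nat \<times> nat" where
  "claim k I t = (case I ! (t div k) of (v, w, \<pi>) \<Rightarrow> (v, t mod k, w, \<pi> ! (t mod k)))"

definition is_pad :: "nat \<Rightarrow> bool" where
  "is_pad p \<longleftrightarrow> p mod 8 \<noteq> 0"

definition claims_clash :: "nat \<Rightarrow> unique_game \<Rightarrow> nat \<Rightarrow> nat \<Rightarrow> bool" where
  "claims_clash k I p q \<longleftrightarrow> \<not> is_pad p \<and> \<not> is_pad q \<and> clash (claim k I (p div 16)) (claim k I (q div 16))"

definition ug_size :: "nat \<Rightarrow> unique_game \<Rightarrow> nat" where
  "ug_size k I = 16 * (length I * k)"

definition ug_graph :: "nat \<Rightarrow> unique_game \<Rightarrow> nat list list" where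
  "ug_graph k I = gadget_graph (ug_size k I) (claims_clash k I) is_pad"

text \<open>The number \<open>2 * M\<^sup>2 + 4 * M + 1 - length I\<close> for \<open>M = 8 * length I * k\<close>, in a form that a counter
  reaches without subtraction: each edge contributes \<open>32 * k - 1\<close>.\<close>

definition ug_budget :: "nat \<Rightarrow> unique_game \<Rightarrow> nat" where
  "ug_budget k I = 8 * (length I * k) * ug_size k I + length I * (32 * k - 1) + 1"

lemma gadget_ug: "gadget (claims_clash k I) is_pad"
  by unfold_locales (auto simp: claims_clash_def)

lemma card_nonpads: "card {p. p < 16 * n \<and> \<not> is_pad p} = 2 * n"
proof -
  have "{p. p < 16 * n \<and> \<not> is_pad p} = (*) 8 ` {..<2 * n}"
    by (auto simp: is_pad_def image_iff intro!: bexI[of _ "_ div 8"])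
  moreover have "inj_on ((*) 8) {..<2 * n}" by (auto simp: inj_on_def)
  ultimately show ?thesis by (simp add: card_image)
qed

lemma ug_budget_eq:
  assumes "0 < k"
  shows "ug_budget k I + length I = 2 * (8 * (length I * k))\<^sup>2 + 4 * (8 * (length I * k)) + 1"
proof -
  obtain k' where "k = Suc k'" using assms by (cases k) auto
  then show ?thesis by (simp add: ug_budget_def ug_size_def power2_eq_square algebra_simps)
qed

text \<open>Labellings are functions on all natural numbers, hence in general infinitely many. The
  maximum in \<open>ug_value\<close> makes sense because the fraction takes at most
  \<open>length I + 1\<close> values.\<close>

lemma finite_fractions:
  "finite {satisfied_fraction I a b | a b. range a \<subseteq> {..<k} \<and> range b \<subseteq> {..<k}}"
proof (rule finite_subset)
  show "{satisfied_fraction I a b | a b. range a \<subseteq> {..<k} \<and> range b \<subseteq> {..<k}} \<subseteq>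
      (\<lambda>j. real j / real (length I)) ` {..length I}"
    by (auto simp: satisfied_fraction_def)
qed simp

lemma satisfied_fraction_card:
  "satisfied_fraction I a b =
     real (card {j. j < length I \<and> (case I ! j of (v, w, \<pi>) \<Rightarrow> \<pi> ! a v = b w)}) / real (length I)"
  by (simp add: satisfied_fraction_def length_filter_conv_card)

lemma ug_game_pos:
  assumes "is_unique_game k I" "0 < k"
  shows "0 < length I" "2 \<le> 8 * (length I * k)"
proof -
  show "0 < length I" using assms(1) by (simp add: is_unique_game_def)
  then have "0 < length I * k" using assms(2) by simp
  then show "2 \<le> 8 * (length I * k)" by linarith
qed

text \<open>An optimal labelling satisfies at least half of the edges; the two copies of the claims
  it makes on these edges give at least \<open>length I\<close> compatible positions.\<close>

lemma ug_value_high_imp_free_pebbling: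
  assumes I: "is_unique_game k I" "0 < k" and val: "ug_value k I \<ge> 1/2"
  shows "\<exists>ss. is_pebbling (nodes (ug_graph k I)) (edges (ug_graph k I)) (ug_budget k I) ss \<and> cost ss = 0"
proof -
  let ?A = "{satisfied_fraction I a b | a b. range a \<subseteq> {..<k} \<and> range b \<subseteq> {..<k}}"
  interpret gadget "ug_size k I" "claims_clash k I" is_pad by (rule gadget_ug)
  have m: "0 < length I" "2 \<le> 8 * (length I * k)" using ug_game_pos[OF I] .
  have "satisfied_fraction I (\<lambda>_. 0) (\<lambda>_. 0) \<in> ?A" using I(2) by auto
  then have "ug_value k I \<in> ?A" unfolding ug_value_def using finite_fractions by (intro Max_in) auto
  then obtain a b where ab: "range a \<subseteq> {..<k}" "ug_value k I = satisfied_fraction I a b" by auto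
  define J where "J = {j. j < length I \<and> (case I ! j of (v, w, \<pi>) \<Rightarrow> \<pi> ! a v = b w)}"
  have "real (card J) / real (length I) \<ge> 1/2"
    using val ab(2) by (simp add: satisfied_fraction_card J_def)
  then have cJ: "length I \<le> 2 * card J" using m(1) by (simp add: field_simps)
  have ak: "a v < k" for v using ab(1) by auto
  \<comment> \<open>Position \<open>16 * t + 8 * e\<close> holds copy \<open>e\<close> of claim
    number \<open>t\<close>, where \<open>t\<close> is \<open>j * k\<close> plus the label of the
    left vertex.\<close>
  define pos where "pos = (\<lambda>(j, e). ((j * k + a (fst (I ! j))) * 2 + e) * 8)"
  define S where "S = pos ` (J \<times> {0, 1::nat})"
  have pos: "pos (j, e) < ug_size k I \<and> \<not> is_pad (pos (j, e)) \<and> pos (j, e) div 16 div k = j \<and>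
      pos (j, e) div 16 mod k = a (fst (I ! j)) \<and> pos (j, e) div 8 mod 2 = e"
    if je: "j \<in> J" "e \<in> {0, 1}" for j e
  proof -
    define t where "t = j * k + a (fst (I ! j))"
    have p: "pos (j, e) = (t * 2 + e) * 8" by (simp add: pos_def t_def)
    have e: "e < 2" using je by auto
    have "t < Suc j * k" using ak[of "fst (I ! j)"] by (simp add: t_def)
    also have "\<dots> \<le> length I * k" using je(1) unfolding J_def by (intro mult_le_mono1) auto
    finally have t: "t < length I * k" .
    have "pos (j, e) < ug_size k I" using t e by (simp add: p ug_size_def)
    moreover have "pos (j, e) div 16 = t" using e by (simp add: p)
    moreover have "pos (j, e) div 8 mod 2 = e" "pos (j, e) mod 8 = 0" using e by (simp_all add: p)
    moreover have "t div k = j" "t mod k = a (fst (I ! j))" using ak[of "fst (I ! j)"] by (simp_all add: t_def)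
    ultimately show ?thesis by (simp add: is_pad_def)
  qed
  have "inj_on pos (J \<times> {0, 1})"
  proof (rule inj_on_inverseI[where g = "\<lambda>p. (p div 16 div k, p div 8 mod 2)"])
    fix s assume "s \<in> J \<times> {0, 1::nat}"
    then obtain j e where "s = (j, e)" "j \<in> J" "e \<in> {0, 1}" by blast
    then show "(pos s div 16 div k, pos s div 8 mod 2) = s" using pos[of j e] by simp
  qed
  then have "card S = card (J \<times> {0, 1::nat})" unfolding S_def by (rule card_image)
  then have cS: "card S = 2 * card J" by (simp add: card_cartesian_product)
  \<comment> \<open>The budget is tuned to exactly \<open>length I\<close> chosen claims, so a
    surplus is cut off.\<close>
  obtain T where T: "T \<subseteq> S" "card T = length I"
    using obtain_subset_with_card_n[of "length I" S] cJ unfolding cS by metis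
  have claim: "\<exists>v w. claim k I (p div 16) = (v, a v, w, b w)" if p: "p \<in> S" for p
  proof -
    obtain j e where je: "j \<in> J" "e \<in> {0, 1}" "p = pos (j, e)" using p unfolding S_def by blast
    obtain v w \<pi> where I': "I ! j = (v, w, \<pi>)" by (cases "I ! j")
    have "\<pi> ! a v = b w" using je(1) I' by (simp add: J_def)
    then show ?thesis using pos[OF je(1,2)] I' je(3) by (auto simp: claim_def)
  qed
  have "\<not> claims_clash k I p q" if "p \<in> S" "q \<in> S" for p q
    using claim[OF that(1)] claim[OF that(2)] by (auto simp: claims_clash_def clash_def)
  then have cT: "conflicts T = {}" using T(1) by (auto simp: conflicts_def)
  have Ts: "T \<subseteq> {p. p < ug_size k I \<and> \<not> is_pad p}"
  proof
    fix p assume "p \<in> T"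
    then obtain j e where "j \<in> J" "e \<in> {0, 1}" "p = pos (j, e)" using T(1) unfolding S_def by blast
    then show "p \<in> {p. p < ug_size k I \<and> \<not> is_pad p}" using pos[of j e] by simp
  qed
  have "\<exists>ss. is_pebbling V E (ug_budget k I) ss \<and> cost ss = 0"
    by (rule independent_imp_free_pebbling[OF Ts T(2) cT, where M = "8 * (length I * k)" and n = "2 * (length I * k)"])
       (use m ug_budget_eq[OF I(2)] card_nonpads in \<open>auto simp: ug_size_def\<close>)
  then show ?thesis using gadget_pebbling unfolding ug_graph_def by metis
qed

text \<open>Compatible claims define a partial labelling. An edge owns at most two of the chosen
  positions, the copies of one claim, so \<open>length I\<close> positions satisfy at least half of
  the edges.\<close>

lemma free_pebbling_imp_ug_value_high:
  assumes I: "is_unique_game k I" "0 < k"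
    and peb: "is_pebbling (nodes (ug_graph k I)) (edges (ug_graph k I)) (ug_budget k I) ss" "cost ss = 0"
  shows "ug_value k I \<ge> 1/2"
proof -
  let ?A = "{satisfied_fraction I a b | a b. range a \<subseteq> {..<k} \<and> range b \<subseteq> {..<k}}"
  interpret gadget "ug_size k I" "claims_clash k I" is_pad by (rule gadget_ug)
  have m: "0 < length I" "2 \<le> 8 * (length I * k)" using ug_game_pos[OF I] .
  obtain ss' where ss': "is_pebbling V E (ug_budget k I) ss'" "cost ss' = 0"
    using pebbling_gadget peb unfolding ug_graph_def by metis
  obtain S where S: "S \<subseteq> {p. p < ug_size k I \<and> \<not> is_pad p}" "length I \<le> card S" "conflicts S = {}"
    by (rule free_pebbling_imp_independent[OF ss', where M = "8 * (length I * k)" and q = "length I"])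
       (use m ug_budget_eq[OF I(2), of I] in \<open>auto simp: ug_size_def\<close>)
  have nc: "\<not> clash (claim k I (p div 16)) (claim k I (q div 16))" if "p \<in> S" "q \<in> S" for p q
    using S(1,3) that by (auto simp: conflicts_def claims_clash_def)
  \<comment> \<open>A vertex that no chosen claim mentions gets 0, which is a label because
    \<open>0 < k\<close>. Elsewhere the choice does not matter, as chosen claims agree on
    labels.\<close>
  define a where "a v = (if \<exists>p\<in>S. fst (claim k I (p div 16)) = v
     then fst (snd (claim k I ((SOME p. p \<in> S \<and> fst (claim k I (p div 16)) = v) div 16))) else 0)" for v
  define b where "b w = (if \<exists>p\<in>S. fst (snd (snd (claim k I (p div 16)))) = w
     then snd (snd (snd (claim k I ((SOME p. p \<in> S \<and> fst (snd (snd (claim k I (p div 16)))) = w) div 16)))) else 0)" for w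
  have a: "a v = l" if "p \<in> S" "claim k I (p div 16) = (v, l, w, l')" for p v l w l'
  proof -
    define p' where "p' = (SOME p. p \<in> S \<and> fst (claim k I (p div 16)) = v)"
    have ex: "\<exists>p. p \<in> S \<and> fst (claim k I (p div 16)) = v" using that by (metis fst_conv)
    then have "p' \<in> S \<and> fst (claim k I (p' div 16)) = v" unfolding p'_def by (rule someI_ex)
    moreover have "a v = fst (snd (claim k I (p' div 16)))" using ex by (auto simp: a_def p'_def)
    ultimately show ?thesis using nc[of p p'] that by (cases "claim k I (p' div 16)") (auto simp: clash_def)
  qed
  have b: "b w = l'" if "p \<in> S" "claim k I (p div 16) = (v, l, w, l')" for p v l w l'
  proof -
    define p' where "p' = (SOME p. p \<in> S \<and> fst (snd (snd (claim k I (p div 16)))) = w)"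
    have ex: "\<exists>p. p \<in> S \<and> fst (snd (snd (claim k I (p div 16)))) = w" using that by (metis fst_conv snd_conv)
    then have "p' \<in> S \<and> fst (snd (snd (claim k I (p' div 16)))) = w" unfolding p'_def by (rule someI_ex)
    moreover have "b w = snd (snd (snd (claim k I (p' div 16))))" using ex by (auto simp: b_def p'_def)
    ultimately show ?thesis using nc[of p p'] that by (cases "claim k I (p' div 16)") (auto simp: clash_def)
  qed
  have jlt: "p div 16 div k < length I" if "p \<in> S" for p
  proof -
    have "p < 16 * (length I * k)" using S(1) that by (auto simp: ug_size_def)
    then have "p div 16 < length I * k" by (simp add: less_mult_imp_div_less mult.commute)
    then show ?thesis by (simp add: less_mult_imp_div_less)
  qed
  have bounds: "l < k \<and> l' < k" if pS: "p \<in> S" and cl: "claim k I (p div 16) = (v, l, w, l')" for p v l w l'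
  proof -
    obtain \<pi> where \<pi>: "I ! (p div 16 div k) = (v, w, \<pi>)" "l = p div 16 mod k" "l' = \<pi> ! l"
      using cl by (auto simp: claim_def split: prod.splits)
    have "(v, w, \<pi>) \<in> set I" using \<pi>(1) jlt[OF pS] by (metis nth_mem)
    then have d: "distinct \<pi>" "set \<pi> = {..<k}" using I(1) by (auto simp: is_unique_game_def)
    then have "length \<pi> = k" using distinct_card by fastforce
    then show ?thesis using \<pi> d I(2) nth_mem[of l \<pi>] by auto
  qed
  have ra: "range a \<subseteq> {..<k}"
  proof (rule image_subsetI)
    fix v show "a v \<in> {..<k}"
    proof (cases "\<exists>p\<in>S. fst (claim k I (p div 16)) = v")
      case True
      then obtain p l w l' where p: "p \<in> S" "claim k I (p div 16) = (v, l, w, l')" by (metis prod.collapse)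
      then show ?thesis using a bounds by auto
    next
      case False
      then show ?thesis using I(2) by (simp add: a_def)
    qed
  qed
  have rb: "range b \<subseteq> {..<k}"
  proof (rule image_subsetI)
    fix w show "b w \<in> {..<k}"
    proof (cases "\<exists>p\<in>S. fst (snd (snd (claim k I (p div 16)))) = w")
      case True
      then obtain p l v l' where p: "p \<in> S" "claim k I (p div 16) = (v, l, w, l')" by (metis prod.collapse)
      then show ?thesis using b bounds by auto
    next
      case False
      then show ?thesis using I(2) by (simp add: b_def)
    qed
  qed
  define J where "J = {j. j < length I \<and> (case I ! j of (v, w, \<pi>) \<Rightarrow> \<pi> ! a v = b w)}"
  \<comment> \<open>The edge and the copy determine a chosen position: the labelling forces its
    label, and claims stand at multiples of 8.\<close>
  define \<psi> where "\<psi> p = (p div 16 div k, p div 8 mod 2)" for p :: nat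
  have lab: "p div 16 mod k = a (fst (I ! (p div 16 div k))) \<and> p div 16 div k \<in> J" if "p \<in> S" for p
  proof -
    obtain v w \<pi> where I': "I ! (p div 16 div k) = (v, w, \<pi>)" by (cases "I ! (p div 16 div k)")
    then have c: "claim k I (p div 16) = (v, p div 16 mod k, w, \<pi> ! (p div 16 mod k))" by (simp add: claim_def)
    show ?thesis using a[OF that c] b[OF that c] I' jlt[OF that] by (simp add: J_def)
  qed
  have inj: "inj_on \<psi> S"
  proof (rule inj_onI)
    fix p q assume p: "p \<in> S" and q: "q \<in> S" and e: "\<psi> p = \<psi> q"
    have 1: "p div 16 div k = q div 16 div k" "p div 8 mod 2 = q div 8 mod 2" using e by (simp_all only: \<psi>_def prod.inject)
    then have "p div 16 mod k = q div 16 mod k" using lab[OF p] lab[OF q] by (simp only:)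
    then have "p div 16 = q div 16" using 1(1) by (metis div_mult_mod_eq)
    then have "p div 8 div 2 = q div 8 div 2" by (simp add: div_mult2_eq[symmetric])
    then have "p div 8 = q div 8" using 1(2) by (metis div_mult_mod_eq)
    moreover have "\<not> is_pad p" "\<not> is_pad q" using S(1) p q by blast+
    then have "p mod 8 = q mod 8" by (simp add: is_pad_def)
    ultimately show "p = q" by (metis div_mult_mod_eq)
  qed
  have "\<psi> ` S \<subseteq> J \<times> {0, 1}"
  proof (rule image_subsetI)
    fix p assume "p \<in> S"
    moreover have "p div 8 mod 2 \<in> {0, 1}" by (cases "even (p div 8)") (simp_all add: odd_iff_mod_2_eq_one)
    ultimately show "\<psi> p \<in> J \<times> {0, 1}" using lab[of p] unfolding \<psi>_def by blast
  qed
  from card_mono[OF _ this] have "card S \<le> 2 * card J"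
    using card_image[OF inj] by (simp add: J_def card_cartesian_product)
  then have "real (length I) \<le> 2 * real (card J)" using S(2) by linarith
  then have "1/2 \<le> satisfied_fraction I a b"
    using m(1) by (simp add: satisfied_fraction_card J_def[symmetric] field_simps)
  also have "\<dots> \<le> ug_value k I" unfolding ug_value_def using ra rb by (intro Max_ge finite_fractions) auto
  finally show ?thesis .
qed

lemma ug_graph_is_dag: "is_dag (ug_graph k I)"
proof -
  interpret gadget "ug_size k I" "claims_clash k I" is_pad by (rule gadget_ug)
  show ?thesis using gadget_is_dag by (simp add: ug_graph_def)
qed

lemma ug_graph_pebbling_exists:
  assumes I: "is_unique_game k I" "0 < k"
  shows "\<exists>ss. is_pebbling (nodes (ug_graph k I)) (edges (ug_graph k I)) (ug_budget k I) ss"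
proof -
  interpret gadget "ug_size k I" "claims_clash k I" is_pad by (rule gadget_ug)
  define n where "n = length I * k"
  have m: "0 < length I" "0 < n" using ug_game_pos[OF I] by (simp_all add: n_def)
  have "conflicts {..<ug_size k I} \<subseteq> {p. p < 16 * n \<and> \<not> is_pad p} \<times> {p. p < 16 * n \<and> \<not> is_pad p}"
    by (auto simp: conflicts_def claims_clash_def ug_size_def n_def)
  from card_mono[OF _ this] have "card (conflicts {..<ug_size k I}) \<le> 4 * n\<^sup>2"
    by (simp add: card_cartesian_product card_nonpads power2_eq_square)
  moreover have "length I \<le> n" using I(2) by (simp add: n_def)
  moreover have "n \<le> n\<^sup>2" using m(2) by (simp add: power2_eq_square)
  moreover have "ug_budget k I + length I = 128 * n\<^sup>2 + 32 * n + 1"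
    using ug_budget_eq[OF I(2), of I] by (simp add: n_def power_mult_distrib)
  moreover have "ug_size k I = 16 * n" by (simp add: ug_size_def n_def)
  ultimately have "card (conflicts {..<ug_size k I}) + 2 * ug_size k I < ug_budget k I" using m by linarith
  from pebbling_exists[OF this] obtain ss where "is_pebbling V E (ug_budget k I) ss"
    using m by (auto simp: ug_size_def n_def)
  then show ?thesis using gadget_pebbling unfolding ug_graph_def by blast
qed

section \<open>Computing the reduction\<close>

text \<open>Tape 0 receives the output and tape 1 holds the input.  Tapes 2 and 3 hold the claims at the
  positions \<open>0, \<dots>, N - 1\<close>, each ended by 5 and empty for a pad; within a claim, each vertex is ended
  by 3 and each label by 4.  Tapes 4, 5 and 6 hold \<open>N\<close> in unary, tape 7 a binary counter, tape 8 the
  outcome of a comparison, tapes 9, 10 and 11 the vertices and the label being read, and tape 12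
  the number \<open>N / 2\<close> in unary.  Labels of left vertices are written in unary because the program
  knows them, being constants, while all other numbers are copied from the input.\<close>

definition item_string :: "nat \<times> nat \<times> nat \<times> nat \<Rightarrow> nat list" where
  "item_string = (\<lambda>(v, a, w, b). claim_string (sys (bin v)) (replicate a 1) @ claim_string (sys (bin w)) (sys (bin b)))"

definition pos_string :: "nat \<Rightarrow> unique_game \<Rightarrow> nat \<Rightarrow> nat list" where
  "pos_string k I p = (if is_pad p then [] else item_string (claim k I (p div 16)))"

definition pos_strings :: "nat \<Rightarrow> unique_game \<Rightarrow> nat \<Rightarrow> nat list list" where
  "pos_strings k I n = map (pos_string k I) [0..<n]"

text \<open>A claim is followed by its own end marker and by those of seven empty pads, hence
  \<open>replicate 8 5\<close>.\<close>

lemma pos_string_block: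
  "items (map (pos_string k I) [16 * t..<16 * Suc t]) =
     item_string (claim k I t) @ replicate 8 5 @ item_string (claim k I t) @ replicate 8 5"
proof -
  have 1: "[16 * t..<16 * Suc t] = map ((+) (16 * t)) [0..<16]"
    by (rule nth_equalityI) auto
  have 2: "[0..<16] = [0,1,2,3,4,5,6,7,8,9,10,11,12,13,14,15::nat]" by code_simp
  have mod8: "(16 * t + c) mod 8 = c mod 8" for c
  proof -
    have "16 * t + c = c + 8 * (2 * t)" by simp
    then show ?thesis by (metis mod_mult_self2)
  qed
  have div16: "(16 * t + c) div 16 = t" if "c < 16" for c using that by simp
  have rep: "replicate 8 (5::nat) = [5,5,5,5,5,5,5,5]" by (simp add: numeral_eq_Suc)
  have "map (pos_string k I) [16 * t..<16 * Suc t] =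
      map (\<lambda>c. if c mod 8 = 0 then item_string (claim k I t) else []) [0..<16]"
    unfolding 1 map_map by (rule map_cong) (simp_all add: pos_string_def is_pad_def mod8 div16)
  then show ?thesis unfolding 2 by (simp add: rep)
qed

lemma items_pos_strings_Suc:
  "items (pos_strings k I (16 * Suc t)) = items (pos_strings k I (16 * t)) @
     item_string (claim k I t) @ replicate 8 5 @ item_string (claim k I t) @ replicate 8 5"
proof -
  have "[0..<16 * Suc t] = [0..<16 * t] @ [16 * t..<16 * Suc t]"
    using upt_add_eq_append[of 0 "16 * t" 16] by (simp add: add.commute)
  then show ?thesis unfolding pos_strings_def by (simp only: map_append concat_append pos_string_block)
qed

text \<open>One call accounts for eight positions, so it puts four marks on tape 12, which is to
  hold half of the number of positions.\<close>

definition emit_item :: "nat \<Rightarrow> com" where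
  "emit_item a = Seq (copy_to_items 9) (Seq (ems 2 (3 # replicate a 1 @ [4])) (Seq (copy_to_items 10)
     (Seq (ems 2 [3]) (Seq (copy_to_items 11) (Seq (ems 2 (4 # replicate 8 5)) (ems 12 (replicate 4 1)))))))"

lemma sys_not [simp]: "6 \<notin> set (sys x)" "5 \<notin> set (sys x)"
  using in_sys[of _ x] by fastforce+

lemma srun_emit_item:
  assumes s: "s 9 = ([6], sys (bin v))" "s 10 = ([6], sys (bin w))" "s 11 = ([6], sys (bin b))"
    "s 2 = (l, [])" "s 12 = (h, [])"
    and n: "length (bin v) \<le> n" "length (bin w) \<le> n" "length (bin b) \<le> n"
  shows "srun (emit_item a) s (24 * n + 2 * a + 70)
     (s(2 := (rev (item_string (v, a, w, b) @ replicate 8 5) @ l, []), 12 := (replicate 4 1 @ h, [])))"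
proof -
  let ?l1 = "rev (sys (bin v)) @ l" let ?l2 = "rev (3 # replicate a 1 @ [4]) @ ?l1"
  let ?l3 = "rev (sys (bin w)) @ ?l2" let ?l4 = "rev [3] @ ?l3"
  let ?l5 = "rev (sys (bin b)) @ ?l4" let ?l6 = "rev (4 # replicate 8 5) @ ?l5"
  have 1: "srun (copy_to_items 9) s (8 * length (sys (bin v)) + 7) (s(2 := (?l1, [])))"
    by (rule srun_copy_to_items) (use s in auto)
  have 2: "srun (ems 2 (3 # replicate a 1 @ [4])) (s(2 := (?l1, []))) (2 * length (3 # replicate a (1::nat) @ [4])) (s(2 := (?l2, [])))"
    by (rule srun_eq[OF srun_ems]) auto
  have 3: "srun (copy_to_items 10) (s(2 := (?l2, []))) (8 * length (sys (bin w)) + 7) (s(2 := (?l3, [])))"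
    by (rule srun_eq[OF srun_copy_to_items]) (use s in auto)
  have 4: "srun (ems 2 [3]) (s(2 := (?l3, []))) (2 * length [3::nat]) (s(2 := (?l4, [])))"
    by (rule srun_eq[OF srun_ems]) auto
  have 5: "srun (copy_to_items 11) (s(2 := (?l4, []))) (8 * length (sys (bin b)) + 7) (s(2 := (?l5, [])))"
    by (rule srun_eq[OF srun_copy_to_items]) (use s in auto)
  have 6: "srun (ems 2 (4 # replicate 8 5)) (s(2 := (?l5, []))) (2 * length (4 # replicate 8 (5::nat))) (s(2 := (?l6, [])))"
    by (rule srun_eq[OF srun_ems]) auto
  have 7: "srun (ems 12 (replicate 4 1)) (s(2 := (?l6, []))) (2 * length (replicate 4 (1::nat))) (s(2 := (?l6, []), 12 := (rev (replicate 4 1) @ h, [])))"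
    by (rule srun_ems) (use s in auto)
  show ?thesis unfolding emit_item_def
    by (rule srun_eq[OF srun_Seq[OF 1 srun_Seq[OF 2 srun_Seq[OF 3 srun_Seq[OF 4 srun_Seq[OF 5 srun_Seq[OF 6 7]]]]]]])
       (use n in \<open>auto simp: item_string_def claim_string_def\<close>)
qed

definition label_prog :: "nat \<Rightarrow> com" where
  "label_prog a = Seq (read_nat 11) (Seq (emit_item a) (Seq (emit_item a) (clear 11)))"

primrec labels_prog :: "nat \<Rightarrow> com" where
  "labels_prog 0 = Skip"
| "labels_prog (Suc a) = Seq (labels_prog a) (label_prog a)"

lemma srun_label_prog:
  assumes s: "s 9 = ([6], sys (bin v))" "s 10 = ([6], sys (bin w))" "s 11 = ([6], [])"
    "s 2 = (l, [])" "s 12 = (h, [])" "s 1 = (i, sys (enc_nat b @ r))"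
    and n: "length (bin v) \<le> n" "length (bin w) \<le> n" "length (bin b) \<le> n"
  shows "srun (label_prog a) s (70 * n + 4 * a + 180)
     (s(1 := (rev (sys (enc_nat b)) @ i, sys r),
        2 := (rev (item_string (v, a, w, b) @ replicate 8 5 @ item_string (v, a, w, b) @ replicate 8 5) @ l, []),
        12 := (replicate 8 1 @ h, [])))"
proof -
  let ?e = "item_string (v, a, w, b) @ replicate 8 5"
  let ?s1 = "s(1 := (rev (sys (enc_nat b)) @ i, sys r), 11 := ([6], sys (bin b)))"
  let ?s2 = "?s1(2 := (rev ?e @ l, []), 12 := (replicate 4 1 @ h, []))"
  let ?s3 = "?s2(2 := (rev ?e @ rev ?e @ l, []), 12 := (replicate 4 1 @ replicate 4 1 @ h, []))"
  have 1: "srun (read_nat 11) s (10 * length (bin b) + 20) ?s1"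
    by (rule srun_read_nat) (use s in auto)
  have 2: "srun (emit_item a) ?s1 (24 * n + 2 * a + 70) ?s2"
    by (rule srun_emit_item) (use s n in auto)
  have 3: "srun (emit_item a) ?s2 (24 * n + 2 * a + 70) ?s3"
    by (rule srun_emit_item) (use s n in auto)
  have 4: "srun (clear 11) ?s3 (8 * length (sys (bin b)) + 10) (?s3(11 := ([6], [])))"
    by (rule srun_clear) auto
  have r: "replicate 4 (Suc 0) @ replicate 4 (Suc 0) = replicate 8 (Suc 0)" by (simp flip: replicate_add)
  show ?thesis unfolding label_prog_def
    by (rule srun_eq[OF srun_Seq[OF 1 srun_Seq[OF 2 srun_Seq[OF 3 4]]]])
       (use s n in \<open>auto simp: r fun_eq_iff\<close>)
qed

text \<open>The counter collects the linear part of \<open>ug_budget\<close> during the parsing,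
  \<open>32 * k - 1\<close> per edge; the quadratic part has to wait until \<open>N\<close> is
  known.\<close>

definition edge_prog :: "nat \<Rightarrow> com" where
  "edge_prog k = Seq (((Seq inc) ^^ (32 * k - 1)) Skip) (Seq (read_nat 9) (Seq (read_nat 10)
     (Seq (labels_prog k) (Seq (clear 9) (Seq (clear 10) (Seq (rt 1) (rt 1)))))))"

lemma srun_incs:
  assumes "s 7 = ([6], sys (bin i))" "i + n \<le> X"
  shows "srun (((Seq inc) ^^ n) Skip) s (n * (6 * X + 10)) (s(7 := ([6], sys (bin (i + n)))))"
  using assms
proof (induction n arbitrary: i s)
  case 0
  then have "s(7 := ([6], sys (bin (i + 0)))) = s" by (simp add: fun_upd_idem)
  then show ?case using srun_Skip[of s 0] by simp
next
  case (Suc n)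
  let ?s = "s(7 := ([6], sys (bin (Suc i))))"
  have "length (bin i) \<le> X" using length_bin[of i] Suc.prems(2) by simp
  then have 1: "srun inc s (6 * X + 9) ?s"
    by (intro srun_eq[OF srun_inc[of s "bin i"]]) (use Suc.prems in \<open>auto simp: bin_Suc\<close>)
  have 2: "srun (((Seq inc) ^^ n) Skip) ?s (n * (6 * X + 10)) (?s(7 := ([6], sys (bin (Suc i + n)))))"
    by (rule Suc.IH) (use Suc.prems in auto)
  have "srun (Seq inc (((Seq inc) ^^ n) Skip)) s (Suc n * (6 * X + 10)) (s(7 := ([6], sys (bin (i + Suc n)))))"
    by (rule srun_eq[OF srun_Seq[OF 1 2]]) auto
  then show ?case by (simp only: funpow.simps o_apply)
qed

section \<open>Parsing an encoded game\<close>

locale game =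
  fixes k :: nat and I :: unique_game
  assumes game: "is_unique_game k I" and k: "0 < k"
begin

abbreviation "m \<equiv> length I"
abbreviation "N \<equiv> ug_size k I"

lemma edge:
  assumes "j < m"
  obtains v w \<pi> where "I ! j = (v, w, \<pi>)" "length \<pi> = k"
    "\<And>a. a < k \<Longrightarrow> claim k I (j * k + a) = (v, a, w, \<pi> ! a)"
proof -
  obtain v w \<pi> where e: "I ! j = (v, w, \<pi>)" by (cases "I ! j")
  then have "(v, w, \<pi>) \<in> set I" using assms by (metis nth_mem)
  then have "distinct \<pi>" "set \<pi> = {..<k}" using game by (auto simp: is_unique_game_def)
  then have "length \<pi> = k" using distinct_card by fastforce
  moreover have "claim k I (j * k + a) = (v, a, w, \<pi> ! a)" if "a < k" for a
    using that e by (simp add: claim_def)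
  ultimately show ?thesis using that[of v w \<pi>] e by blast
qed

lemma m_pos: "0 < m" using game by (simp add: is_unique_game_def)

definition edge_bits :: "bool list list" where
  "edge_bits = map (\<lambda>(v, w, \<pi>). enc_list (v # w # \<pi>)) I"

lemma enc_ug_edge_bits: "enc_ug I = concat edge_bits"
  unfolding enc_ug_def enc_def edge_bits_def map_map o_def
  by (rule arg_cong[of _ _ concat]) (auto intro!: map_cong)

text \<open>\<open>t\<close> counts the pairs of an edge and a label read so far; each is worth
  sixteen positions and eight marks on tape 12.\<close>

definition parse_store :: "(nat \<Rightarrow> zipper) \<Rightarrow> bool list \<Rightarrow> bool list \<Rightarrow> nat \<Rightarrow> nat \<Rightarrow> nat \<Rightarrow> zipper" where
  "parse_store s u r t c = s(1 := (rev (sys u) @ [6], sys r),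
     2 := (rev (items (pos_strings k I (16 * t))) @ [6], []),
     7 := ([6], sys (bin c)), 12 := (replicate (8 * t) 1 @ [6], []))"

lemma srun_labels_prog:
  assumes e: "I ! j = (v, w, \<pi>)" "length \<pi> = k" "\<And>a. a < k \<Longrightarrow> claim k I (j * k + a) = (v, a, w, \<pi> ! a)"
    and s: "s 9 = ([6], sys (bin v))" "s 10 = ([6], sys (bin w))" "s 11 = ([6], [])"
    and n: "length (bin v) \<le> n" "length (bin w) \<le> n" "\<And>a. a < k \<Longrightarrow> length (bin (\<pi> ! a)) \<le> n"
    and a: "a \<le> k"
  shows "srun (labels_prog a) (parse_store s u (concat (map enc_nat \<pi>) @ r) (j * k) c) (a * (70 * n + 4 * k + 181))
     (parse_store s (u @ concat (map enc_nat (take a \<pi>))) (concat (map enc_nat (drop a \<pi>)) @ r) (j * k + a) c)"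
  using a
proof (induction a)
  case 0
  show ?case using srun_Skip[of _ 0] by simp
next
  case (Suc a)
  let ?s = "parse_store s (u @ concat (map enc_nat (take a \<pi>))) (concat (map enc_nat (drop a \<pi>)) @ r) (j * k + a) c"
  have d: "drop a \<pi> = \<pi> ! a # drop (Suc a) \<pi>" using Suc.prems e(2) by (simp add: Cons_nth_drop_Suc)
  have tk: "take (Suc a) \<pi> = take a \<pi> @ [\<pi> ! a]" using Suc.prems e(2) by (simp add: take_Suc_conv_app_nth)
  have c: "claim k I (j * k + a) = (v, a, w, \<pi> ! a)" using e(3) Suc.prems by simp
  have S: "j * k + Suc a = Suc (j * k + a)" by simp
  have 1: "srun (labels_prog a) (parse_store s u (concat (map enc_nat \<pi>) @ r) (j * k) c) (a * (70 * n + 4 * k + 181)) ?s"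
    using Suc by simp
  have "srun (label_prog a) ?s (70 * n + 4 * a + 180)
     (?s(1 := (rev (sys (enc_nat (\<pi> ! a))) @ rev (sys (u @ concat (map enc_nat (take a \<pi>)))) @ [6], sys (concat (map enc_nat (drop (Suc a) \<pi>)) @ r)),
        2 := (rev (item_string (v, a, w, \<pi> ! a) @ replicate 8 5 @ item_string (v, a, w, \<pi> ! a) @ replicate 8 5) @ rev (items (pos_strings k I (16 * (j * k + a)))) @ [6], []),
        12 := (replicate 8 1 @ replicate (8 * (j * k + a)) 1 @ [6], [])))"
    by (rule srun_label_prog) (use s n Suc.prems in \<open>auto simp: parse_store_def d\<close>)
  then have 2: "srun (label_prog a) ?s (70 * n + 4 * k + 180)
     (parse_store s (u @ concat (map enc_nat (take (Suc a) \<pi>))) (concat (map enc_nat (drop (Suc a) \<pi>)) @ r) (j * k + Suc a) c)"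
  proof (rule srun_eq)
    have "replicate (8 * (j * k + Suc a)) (1::nat) = replicate 8 1 @ replicate (8 * (j * k + a)) 1"
      by (simp flip: replicate_add)
    then show "?s(1 := (rev (sys (enc_nat (\<pi> ! a))) @ rev (sys (u @ concat (map enc_nat (take a \<pi>)))) @ [6], sys (concat (map enc_nat (drop (Suc a) \<pi>)) @ r)),
        2 := (rev (item_string (v, a, w, \<pi> ! a) @ replicate 8 5 @ item_string (v, a, w, \<pi> ! a) @ replicate 8 5) @ rev (items (pos_strings k I (16 * (j * k + a)))) @ [6], []),
        12 := (replicate 8 1 @ replicate (8 * (j * k + a)) 1 @ [6], [])) =
      parse_store s (u @ concat (map enc_nat (take (Suc a) \<pi>))) (concat (map enc_nat (drop (Suc a) \<pi>)) @ r) (j * k + Suc a) c"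
      unfolding S parse_store_def items_pos_strings_Suc c tk
      by (auto simp: fun_eq_iff)
  qed (use Suc.prems in simp)
  show ?case unfolding labels_prog.simps
    by (rule srun_mono[OF srun_Seq[OF 1 2]]) simp
qed

lemma srun_edge_prog:
  assumes j: "j < m" and s: "s 9 = ([6], [])" "s 10 = ([6], [])" "s 11 = ([6], [])"
    and X: "c + (32 * k - 1) \<le> X" and n: "length (edge_bits ! j) \<le> n"
  shows "srun (edge_prog k) (parse_store s u (edge_bits ! j @ r) (j * k) c)
     (32 * k * (6 * X + 10) + k * (70 * n + 4 * k + 181) + 40 * n + 80)
     (parse_store s (u @ edge_bits ! j) r (Suc j * k) (c + (32 * k - 1)))"
proof -
  obtain v w \<pi> where e: "I ! j = (v, w, \<pi>)" "length \<pi> = k" "\<And>a. a < k \<Longrightarrow> claim k I (j * k + a) = (v, a, w, \<pi> ! a)"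
    by (rule edge[OF j]) (rule that, assumption+)
  have b: "edge_bits ! j = enc_nat v @ enc_nat w @ concat (map enc_nat \<pi>) @ [True, True]"
    using e(1) j by (simp add: edge_bits_def enc_list_def)
  have lb: "length (bin x) \<le> length (enc_nat x)" for x
  proof -
    have "length (tag y) = 2 * length y" for y by (induction y) (auto simp: tag_def)
    then show ?thesis by (simp add: enc_nat_def)
  qed
  have n': "length (bin v) \<le> n" "length (bin w) \<le> n" using n lb[of v] lb[of w] by (simp_all add: b)
  have na: "length (bin (\<pi> ! a)) \<le> n" if "a < k" for a
  proof -
    have "enc_nat (\<pi> ! a) \<in> set (map enc_nat \<pi>)" using that e(2) by simp
    then have "length (enc_nat (\<pi> ! a)) \<le> length (concat (map enc_nat \<pi>))"
      by (auto simp: length_concat intro!: member_le_sum_list)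
    then show ?thesis using lb[of "\<pi> ! a"] n by (simp add: b)
  qed
  let ?c = "c + (32 * k - 1)"
  let ?r = "concat (map enc_nat \<pi>) @ [True, True] @ r"
  have 1: "srun (((Seq inc) ^^ (32 * k - 1)) Skip) (parse_store s u (edge_bits ! j @ r) (j * k) c) ((32 * k - 1) * (6 * X + 10))
      (parse_store s u (edge_bits ! j @ r) (j * k) ?c)"
    by (rule srun_eq[OF srun_incs]) (use X in \<open>auto simp: parse_store_def fun_eq_iff\<close>)
  let ?s9 = "s(9 := ([6], sys (bin v)))" let ?s10 = "s(9 := ([6], sys (bin v)), 10 := ([6], sys (bin w)))"
  have 2: "srun (read_nat 9) (parse_store s u (edge_bits ! j @ r) (j * k) ?c) (10 * n + 20)
      (parse_store ?s9 (u @ enc_nat v) (enc_nat w @ ?r) (j * k) ?c)"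
    by (rule srun_eq[OF srun_read_nat[where n = v and r = "enc_nat w @ ?r"]])
       (use s n' in \<open>auto simp: parse_store_def b fun_eq_iff\<close>)
  have 3: "srun (read_nat 10) (parse_store ?s9 (u @ enc_nat v) (enc_nat w @ ?r) (j * k) ?c) (10 * n + 20)
      (parse_store ?s10 (u @ enc_nat v @ enc_nat w) ?r (j * k) ?c)"
    by (rule srun_eq[OF srun_read_nat[where n = w and r = ?r]])
       (use s n' in \<open>auto simp: parse_store_def fun_eq_iff\<close>)
  have "srun (labels_prog k) (parse_store ?s10 (u @ enc_nat v @ enc_nat w) ?r (j * k) ?c) (k * (70 * n + 4 * k + 181))
     (parse_store ?s10 ((u @ enc_nat v @ enc_nat w) @ concat (map enc_nat (take k \<pi>))) (concat (map enc_nat (drop k \<pi>)) @ [True, True] @ r) (j * k + k) ?c)"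
    by (rule srun_labels_prog[OF e]) (use s n' na in auto)
  then have 4: "srun (labels_prog k) (parse_store ?s10 (u @ enc_nat v @ enc_nat w) ?r (j * k) ?c) (k * (70 * n + 4 * k + 181))
     (parse_store ?s10 (u @ enc_nat v @ enc_nat w @ concat (map enc_nat \<pi>)) ([True, True] @ r) (j * k + k) ?c)"
    by (rule srun_eq) (simp_all add: e(2))
  let ?u = "u @ enc_nat v @ enc_nat w @ concat (map enc_nat \<pi>)"
  let ?sc = "s(10 := ([6], sys (bin w)))"
  have 5: "srun (clear 9) (parse_store ?s10 ?u ([True, True] @ r) (j * k + k) ?c) (8 * n + 10) (parse_store ?sc ?u ([True, True] @ r) (j * k + k) ?c)"
    by (rule srun_eq[OF srun_clear[where xs = "sys (bin v)"]]) (use s n' in \<open>auto simp: parse_store_def fun_eq_iff\<close>)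
  have 6: "srun (clear 10) (parse_store ?sc ?u ([True, True] @ r) (j * k + k) ?c) (8 * n + 10) (parse_store s ?u ([True, True] @ r) (j * k + k) ?c)"
    by (rule srun_eq[OF srun_clear[where xs = "sys (bin w)"]]) (use s n' in \<open>auto simp: parse_store_def fun_eq_iff\<close>)
  have 7: "srun (rt 1) (parse_store s ?u ([True, True] @ r) (j * k + k) ?c) 1 (parse_store s (?u @ [True]) (True # r) (j * k + k) ?c)"
    by (rule srun_rt') (auto simp: parse_store_def fun_eq_iff)
  have 8: "srun (rt 1) (parse_store s (?u @ [True]) (True # r) (j * k + k) ?c) 1 (parse_store s (u @ edge_bits ! j) r (Suc j * k) ?c)"
    by (rule srun_rt') (auto simp: parse_store_def b add.commute fun_eq_iff)
  have le: "(32 * k - 1) * (6 * X + 10) \<le> 32 * k * (6 * X + 10)" by (intro mult_le_mono1) simp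
  show ?thesis unfolding edge_prog_def
    by (rule srun_mono[OF srun_Seq[OF 1 srun_Seq[OF 2 srun_Seq[OF 3 srun_Seq[OF 4 srun_Seq[OF 5 srun_Seq[OF 6 srun_Seq[OF 7 8]]]]]]]]) (use le in linarith)
qed

lemma srun_parse:
  assumes s: "s 9 = ([6], [])" "s 10 = ([6], [])" "s 11 = ([6], [])"
    and X: "m * (32 * k - 1) \<le> X" and n: "length (enc_ug I) \<le> n"
  shows "srun (Loop (\<lambda>a. a 1 \<noteq> 0) (edge_prog k)) (parse_store s [] (enc_ug I) 0 0)
     (m * (32 * k * (6 * X + 10) + k * (70 * n + 4 * k + 181) + 40 * n + 82) + 1)
     (parse_store s (enc_ug I) [] (m * k) (m * (32 * k - 1)))"
proof -
  define st where "st j = parse_store s (concat (take j edge_bits)) (concat (drop j edge_bits)) (j * k) (j * (32 * k - 1))" for j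
  have len: "length edge_bits = m" by (simp add: edge_bits_def)
  have "srun (Loop (\<lambda>a. a 1 \<noteq> 0) (edge_prog k)) (st 0)
     (m * ((32 * k * (6 * X + 10) + k * (70 * n + 4 * k + 181) + 40 * n + 80) + 2) + 1) (st m)"
  proof (rule srun_Loop)
    fix j assume j: "j < m"
    have d: "concat (drop j edge_bits) = edge_bits ! j @ concat (drop (Suc j) edge_bits)"
      using j len by (metis Cons_nth_drop_Suc concat.simps(2))
    have tk: "concat (take (Suc j) edge_bits) = concat (take j edge_bits) @ edge_bits ! j"
      using j len by (simp add: take_Suc_conv_app_nth)
    have "edge_bits ! j \<noteq> []" using j by (auto simp: edge_bits_def enc_list_def split: prod.splits)
    then show "scan (st j) 1 \<noteq> 0" by (cases "edge_bits ! j") (auto simp: st_def parse_store_def d)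
    have "Suc j * (32 * k - 1) \<le> m * (32 * k - 1)" using j by (intro mult_le_mono1) simp
    then have c: "j * (32 * k - 1) + (32 * k - 1) \<le> X" using X by simp
    have "enc_ug I = concat (take j edge_bits) @ concat (drop j edge_bits)"
      by (simp add: enc_ug_edge_bits flip: concat_append)
    then have "length (edge_bits ! j) \<le> n" using n d by simp
    from srun_edge_prog[OF j s c this, of "concat (take j edge_bits)" "concat (drop (Suc j) edge_bits)"]
    show "srun (edge_prog k) (st j) (32 * k * (6 * X + 10) + k * (70 * n + 4 * k + 181) + 40 * n + 80) (st (Suc j))"
      unfolding st_def d tk by (rule srun_eq) (simp_all add: add.commute)
  next
    show "\<not> scan (st m) 1 \<noteq> 0" by (simp add: st_def parse_store_def len)
  qed
  then show ?thesis
    by (rule srun_conv) (simp_all add: st_def len enc_ug_edge_bits)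
qed

end

lemma wf_edge_prog: "12 < T \<Longrightarrow> 6 < S \<Longrightarrow> wf_com T S (edge_prog k)"
proof -
  assume T: "12 < T" "6 < S"
  have "wf_com T S (((Seq inc) ^^ n) Skip)" for n by (induction n) (use T in auto)
  moreover have "wf_com T S (labels_prog n)" for n
    by (induction n) (use T in \<open>auto simp: label_prog_def emit_item_def\<close>)
  ultimately show ?thesis using T by (simp add: edge_prog_def)
qed

section \<open>Preparing the work tapes\<close>

primrec sentinels :: "nat list \<Rightarrow> com" where
  "sentinels [] = Skip"
| "sentinels (t # ts) = Seq (em t (\<lambda>_. 6)) (sentinels ts)"

lemma srun_sentinels:
  "distinct ts \<Longrightarrow> (\<And>t. t \<in> set ts \<Longrightarrow> s t = ([], [])) \<Longrightarrow>
   srun (sentinels ts) s (2 * length ts) (\<lambda>t. if t \<in> set ts then ([6], []) else s t)"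
proof (induction ts arbitrary: s)
  case Nil
  show ?case using srun_Skip[of s 0] by simp
next
  case (Cons t ts)
  let ?s = "s(t := ([6], []))"
  have 1: "srun (em t (\<lambda>_. 6)) s 1 ?s" by (rule srun_em') (use Cons.prems in auto)
  have 2: "srun (sentinels ts) ?s (2 * length ts) (\<lambda>t. if t \<in> set ts then ([6], []) else ?s t)"
    by (rule Cons.IH) (use Cons.prems in auto)
  show ?case unfolding sentinels.simps
    by (rule srun_eq[OF srun_Seq[OF 1 2]]) (use Cons.prems in \<open>auto simp: fun_eq_iff\<close>)
qed

text \<open>Every position, pad or claim, contributes exactly one end marker 5, so counting these
  markers yields \<open>N\<close> in unary.\<close>

definition duplicate :: com where
  "duplicate = For 2 (Seq (em 3 (\<lambda>a. a 2))
     (Cond (\<lambda>a. a 2 = 5) (Seq (em 4 (\<lambda>_. 1)) (Seq (em 5 (\<lambda>_. 1)) (em 6 (\<lambda>_. 1)))) Skip))"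

definition arrange :: com where
  "arrange = Seq (rew 2) (Seq duplicate (Seq (rew 3) (Seq (rew 4) (Seq (rew 5) (Seq (rew 6) (rew 12))))))"

lemma srun_duplicate:
  assumes s: "s 2 = ([6], xs)" "s 3 = ([6], [])" "s 4 = ([6], [])" "s 5 = ([6], [])" "s 6 = ([6], [])"
    and xs: "0 \<notin> set xs" "6 \<notin> set xs" and n: "n = length (filter (\<lambda>x. x = 5) xs)"
  shows "srun duplicate s (15 * length xs + 7)
     (s(3 := (rev xs @ [6], []), 4 := (replicate n 1 @ [6], []), 5 := (replicate n 1 @ [6], []), 6 := (replicate n 1 @ [6], [])))"
proof -
  define c where "c i = length (filter (\<lambda>x. x = 5) (take i xs))" for i
  define st where "st i = s(3 := (rev (take i xs) @ [6], []), 4 := (replicate (c i) 1 @ [6], []),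
      5 := (replicate (c i) 1 @ [6], []), 6 := (replicate (c i) 1 @ [6], []))" for i
  have "srun duplicate s (length xs * 15 + 7) (st (length xs))"
    unfolding duplicate_def
  proof (rule srun_conv[OF srun_For[where st = st and t = 2 and xs = xs and B = 8, OF _ xs refl refl]])
    fix i assume i: "i < length xs"
    then have d: "drop i xs = xs ! i # drop (Suc i) xs" by (simp add: Cons_nth_drop_Suc)
    have cS: "c (Suc i) = (if xs ! i = 5 then Suc (c i) else c i)"
      using i by (simp add: c_def take_Suc_conv_app_nth)
    let ?z = "(rev (take i xs) @ [6], drop i xs)"
    let ?s1 = "(st i)(2 := ?z, 3 := (rev (take (Suc i) xs) @ [6], []))"
    have 1: "srun (em 3 (\<lambda>a. a 2)) ((st i)(2 := ?z)) 1 ?s1"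
      by (rule srun_em') (use i in \<open>auto simp: st_def d take_Suc_conv_app_nth fun_eq_iff\<close>)
    have 2: "srun (Cond (\<lambda>a. a 2 = 5) (Seq (em 4 (\<lambda>_. 1)) (Seq (em 5 (\<lambda>_. 1)) (em 6 (\<lambda>_. 1)))) Skip) ?s1 6 ((st (Suc i))(2 := ?z))"
    proof (cases "xs ! i = 5")
      case True
      let ?s2 = "?s1(4 := (replicate (c (Suc i)) 1 @ [6], []))"
      let ?s3 = "?s2(5 := (replicate (c (Suc i)) 1 @ [6], []))"
      have a: "srun (em 4 (\<lambda>_. 1)) ?s1 1 ?s2" by (rule srun_em') (auto simp: st_def cS True)
      have b: "srun (em 5 (\<lambda>_. 1)) ?s2 1 ?s3" by (rule srun_em') (auto simp: st_def cS True)
      have e: "srun (em 6 (\<lambda>_. 1)) ?s3 1 ((st (Suc i))(2 := ?z))"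
        by (rule srun_em') (auto simp: st_def cS True fun_eq_iff)
      show ?thesis
        by (rule srun_mono[OF srun_Cond_True[OF _ srun_Seq[OF a srun_Seq[OF b e]]]]) (use True in \<open>auto simp: d\<close>)
    next
      case False
      have "?s1 = (st (Suc i))(2 := ?z)" using False by (auto simp: st_def cS fun_eq_iff)
      moreover have "srun (Cond (\<lambda>a. a 2 = 5) (Seq (em 4 (\<lambda>_. 1)) (Seq (em 5 (\<lambda>_. 1)) (em 6 (\<lambda>_. 1)))) Skip) ?s1 (0 + 1) ?s1"
        by (rule srun_Cond_False[OF _ srun_Skip]) (use False in \<open>simp add: d\<close>)
      ultimately show ?thesis by (auto elim: srun_mono)
    qed
    show "srun (Seq (em 3 (\<lambda>a. a 2)) (Cond (\<lambda>a. a 2 = 5) (Seq (em 4 (\<lambda>_. 1)) (Seq (em 5 (\<lambda>_. 1)) (em 6 (\<lambda>_. 1)))) Skip))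
      ((st i)(2 := ?z)) 8 ((st (Suc i))(2 := ?z))"
      by (rule srun_mono[OF srun_Seq[OF 1 2]]) simp
  qed (use s in \<open>auto simp: st_def c_def fun_eq_iff\<close>)
  then show ?thesis by (rule srun_eq) (auto simp: st_def c_def n fun_eq_iff)
qed

lemma srun_arrange:
  assumes s: "s 2 = (rev xs @ [6], [])" "s 3 = ([6], [])" "s 4 = ([6], [])" "s 5 = ([6], [])" "s 6 = ([6], [])"
      "s 12 = (replicate h 1 @ [6], [])"
    and xs: "0 \<notin> set xs" "6 \<notin> set xs" and n: "n = length (filter (\<lambda>x. x = 5) xs)"
  shows "srun arrange s (35 * length xs + 3 * h + 50)
     (s(2 := ([6], xs), 3 := ([6], xs), 4 := ([6], replicate n 1), 5 := ([6], replicate n 1), 6 := ([6], replicate n 1),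
        12 := ([6], replicate h 1)))"
proof -
  let ?u = "(replicate n 1 @ [6], []) :: zipper" let ?r = "([6], replicate n 1) :: zipper"
  let ?s1 = "s(2 := ([6], xs))"
  let ?s2 = "?s1(3 := (rev xs @ [6], []), 4 := ?u, 5 := ?u, 6 := ?u)"
  let ?s3 = "?s1(3 := ([6], xs), 4 := ?u, 5 := ?u, 6 := ?u)"
  let ?s4 = "?s1(3 := ([6], xs), 4 := ?r, 5 := ?u, 6 := ?u)"
  let ?s5 = "?s1(3 := ([6], xs), 4 := ?r, 5 := ?r, 6 := ?u)"
  let ?s6 = "?s1(3 := ([6], xs), 4 := ?r, 5 := ?r, 6 := ?r)"
  have nl: "n \<le> length xs" using n by simp
  have 1: "srun (rew 2) s (3 * length xs + 5) ?s1" by (rule srun_eq[OF srun_rew[where xs = xs]]) (use s xs in auto)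
  have 2: "srun duplicate ?s1 (15 * length xs + 7) ?s2"
    by (rule srun_eq[OF srun_duplicate[OF _ _ _ _ _ xs n]]) (use s in auto)
  have 3: "srun (rew 3) ?s2 (3 * length xs + 5) ?s3"
    by (rule srun_eq[OF srun_rew[where xs = xs]]) (use xs in \<open>auto simp: fun_eq_iff\<close>)
  have 4: "srun (rew 4) ?s3 (3 * n + 5) ?s4"
    by (rule srun_eq[OF srun_rew[where xs = "replicate n 1"]]) (auto simp: fun_eq_iff)
  have 5: "srun (rew 5) ?s4 (3 * n + 5) ?s5"
    by (rule srun_eq[OF srun_rew[where xs = "replicate n 1"]]) (auto simp: fun_eq_iff)
  have 6: "srun (rew 6) ?s5 (3 * n + 5) ?s6"
    by (rule srun_eq[OF srun_rew[where xs = "replicate n 1"]]) (auto simp: fun_eq_iff)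
  have 7: "srun (rew 12) ?s6 (3 * h + 5) (?s6(12 := ([6], replicate h 1)))"
    by (rule srun_eq[OF srun_rew[where xs = "replicate h 1"]]) (use s in \<open>auto simp: fun_eq_iff\<close>)
  show ?thesis unfolding arrange_def
    by (rule srun_eq[OF srun_Seq[OF 1 srun_Seq[OF 2 srun_Seq[OF 3 srun_Seq[OF 4 srun_Seq[OF 5 srun_Seq[OF 6 7]]]]]]])
       (use nl in auto)
qed

lemma srun_write_end: "srun (ems 0 [2, 2]) (counting s w i) 4 (counting s (w @ [True, True]) i)"
  by (rule srun_eq[OF srun_ems]) (auto simp: out_def counting_def fun_eq_iff)

lemma srun_reset: "i \<le> X \<Longrightarrow> srun (clear 7) (counting s w i) (8 * X + 10) (counting s w 0)"
  using length_bin[of i]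
  by (intro srun_eq[OF srun_clear[where xs = "sys (bin i)"]]) (auto simp: counting_def fun_eq_iff bin.simps[of 0])

section \<open>Printing the pebbling instance\<close>

definition write_budget :: com where
  "write_budget = Seq (For 12 (For 4 inc)) (Seq inc (Seq print (Seq (ems 0 [2, 2]) (clear 7))))"

lemma sel_False [simp]: "sel (\<lambda>_. False) i j = []"
  by (simp add: sel_def)

text \<open>With \<open>n = N\<close>, with \<open>h = N / 2\<close> from tape 12 and with the
  linear part of the budget as \<open>c\<close>, the printed number is \<open>ug_budget\<close>. The
  reset to 0 prepares the counter for the node numbers.\<close>

lemma srun_write_budget:
  assumes s: "s 12 = ([6], replicate h 1)" "s 4 = ([6], replicate n 1)" and X: "c + h * n + 1 \<le> X"
  shows "srun write_budget (counting s w c) (h * (n * (6 * X + 16) + 14) + 24 * X + 60)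
     (counting s (w @ enc_list [c + h * n + 1]) 0)"
proof -
  have inner: "srun (For 4 inc) (counting (s(12 := z)) w' (c + j * n)) (n * (6 * X + 16) + 7)
      (counting (s(12 := z)) (w' @ sel (\<lambda>_. False) (c + j * n) (c + Suc j * n)) (c + Suc j * n))"
    if j: "j < h" for j w' z
  proof -
    have le: "c + j * n + n \<le> X"
    proof -
      have "Suc j * n \<le> h * n" using j by (intro mult_le_mono1) simp
      then show ?thesis using X by simp
    qed
    have "srun (For 4 inc) (counting (s(12 := z)) w' (c + j * n)) (length (replicate n (1::nat)) * ((6 * X + 9) + 7) + 7)
      (counting (s(12 := z)) (w' @ sel (\<lambda>_. False) (c + j * n) (c + j * n + length (replicate n (1::nat)) * 1)) (c + j * n + length (replicate n (1::nat)) * 1))"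
    proof (rule srun_For_count)
      fix i w assume "i < length (replicate n (1::nat))"
      then have "c + j * n + i < X" using le by simp
      from srun_inc_counting[OF this]
      show "srun inc (counting ((s(12 := z))(4 := head_at (replicate n 1) i)) w (c + j * n + i * 1)) (6 * X + 9)
          (counting ((s(12 := z))(4 := head_at (replicate n 1) i)) (w @ sel (\<lambda>_. False) (c + j * n + i * 1) (c + j * n + Suc i * 1)) (c + j * n + Suc i * 1))"
        by simp
    qed (use s in auto)
    then show ?thesis by (rule srun_eq) (simp_all add: add.commute add.left_commute)
  qed
  have "srun (For 12 (For 4 inc)) (counting s w c) (length (replicate h (1::nat)) * ((n * (6 * X + 16) + 7) + 7) + 7)
     (counting s (w @ sel (\<lambda>_. False) c (c + length (replicate h (1::nat)) * n)) (c + length (replicate h (1::nat)) * n))"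
    by (rule srun_For_count) (use s inner in auto)
  then have 1: "srun (For 12 (For 4 inc)) (counting s w c) (h * (n * (6 * X + 16) + 14) + 7) (counting s w (c + h * n))"
    by (rule srun_eq) auto
  let ?c = "c + h * n"
  have 2: "srun inc (counting s w ?c) (6 * X + 9) (counting s w (Suc ?c))"
    by (rule srun_inc_counting) (use X in simp)
  have 3: "srun print (counting s w (Suc ?c)) (10 * X + 12) (counting s (w @ enc_nat (Suc ?c)) (Suc ?c))"
    by (rule srun_print) (use X in simp)
  have 5: "srun (clear 7) (counting s ((w @ enc_nat (Suc ?c)) @ [True, True]) (Suc ?c)) (8 * X + 10)
      (counting s ((w @ enc_nat (Suc ?c)) @ [True, True]) 0)"
    by (rule srun_reset) (use X in simp)
  show ?thesis unfolding write_budget_def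
    by (rule srun_eq[OF srun_Seq[OF 1 srun_Seq[OF 2 srun_Seq[OF 3 srun_Seq[OF srun_write_end 5]]]]])
       (auto simp: enc_list_def)
qed

lemma srun_For_append:
  assumes t: "t \<noteq> 0" "t \<noteq> 7" "s t = ([6], xs)" and xs: "0 \<notin> set xs" "6 \<notin> set xs"
    and body: "\<And>j w. j < length xs \<Longrightarrow> srun c (counting (s(t := head_at xs j)) w i) B
        (counting (s(t := head_at xs j)) (w @ u j) i)"
  shows "srun (For t c) (counting s w i) (length xs * (B + 7) + 7)
     (counting s (w @ concat (map u [0..<length xs])) i)"
proof (rule srun_For[where st = "\<lambda>j. counting s (w @ concat (map u [0..<j])) i", OF _ xs])
  fix j assume j: "j < length xs"
  show "srun c ((counting s (w @ concat (map u [0..<j])) i)(t := (rev (take j xs) @ [6], drop j xs))) B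
      ((counting s (w @ concat (map u [0..<Suc j])) i)(t := (rev (take j xs) @ [6], drop j xs)))"
    using body[OF j, of "w @ concat (map u [0..<j])"] t(1,2) by (simp add: counting_upd head_at_def)
qed (use t in \<open>auto simp: counting_def fun_eq_iff\<close>)

text \<open>The in-neighbour list of a source is empty, and its code is the end marker
  \<open>[True, True]\<close> alone. The nested loop serves the links, the single one the
  guards.\<close>

definition write_sources :: com where
  "write_sources = Seq (For 4 (For 5 (ems 0 [2, 2]))) (For 4 (ems 0 [2, 2]))"

lemma concat_map_const: "concat (map (\<lambda>_. u) xs) = concat (replicate (length xs) u)"
  by (induction xs) auto

lemma concat_replicate_mult: "concat (replicate a (concat (replicate b u))) = concat (replicate (a * b) u)"
  by (induction a) (auto simp: replicate_add)

lemma srun_write_sources: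
  assumes s: "s 4 = ([6], replicate n 1)" "s 5 = ([6], replicate n 1)"
  shows "srun write_sources (counting s w i) (n * (n * 11 + 14) + n * 11 + 20)
     (counting s (w @ concat (replicate (n * n + n) [True, True])) i)"
proof -
  let ?xs = "replicate n (1::nat)"
  have inner: "srun (For 5 (ems 0 [2, 2])) (counting (s(4 := z)) w i) (length ?xs * (4 + 7) + 7)
      (counting (s(4 := z)) (w @ concat (map (\<lambda>_. [True, True]) [0..<length ?xs])) i)" for z w
    by (rule srun_For_append) (use s srun_write_end in auto)
  have 1: "srun (For 4 (For 5 (ems 0 [2, 2]))) (counting s w i) (length ?xs * ((length ?xs * (4 + 7) + 7) + 7) + 7)
      (counting s (w @ concat (map (\<lambda>_. concat (map (\<lambda>_. [True, True]) [0..<length ?xs])) [0..<length ?xs])) i)"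
    by (rule srun_For_append) (use s inner in auto)
  have 2: "srun (For 4 (ems 0 [2, 2])) (counting s w' i) (length ?xs * (4 + 7) + 7)
      (counting s (w' @ concat (map (\<lambda>_. [True, True]) [0..<length ?xs])) i)" for w'
    by (rule srun_For_append) (use s srun_write_end in auto)
  show ?thesis unfolding write_sources_def
    by (rule srun_eq[OF srun_Seq[OF 1 2]])
       (simp add: algebra_simps, auto simp: concat_map_const concat_replicate_mult replicate_add)
qed

definition marked :: "nat \<Rightarrow> nat \<Rightarrow> nat list" where
  "marked n u = map (\<lambda>i. if i = u then 2 else 1) [0..<n]"

lemma marked_props [simp]: "length (marked n u) = n" "0 \<notin> set (marked n u)" "6 \<notin> set (marked n u)"
  "i < n \<Longrightarrow> marked n u ! i = (if i = u then 2 else 1)"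
  by (auto simp: marked_def)

lemma marked_none: "n \<le> u \<Longrightarrow> marked n u = replicate n 1"
  by (rule nth_equalityI) auto

lemma marked_split: "u < n \<Longrightarrow> marked n u = replicate u 1 @ 2 # replicate (n - Suc u) 1"
  by (rule nth_equalityI) (auto simp: nth_append nth_Cons')

text \<open>The number \<open>u\<close> of the current item is kept as a mark on the unary copies of \<open>N\<close>, so that testing
  whether \<open>i div N = u\<close> or \<open>i mod N = u\<close> amounts to looking at two heads.\<close>

definition shift_mark :: "nat \<Rightarrow> com" where
  "shift_mark t = Seq (skip_to t (\<lambda>x. x = 2)) (Seq (wr t 1) (Seq (rt t)
     (Seq (Cond (\<lambda>a. a t \<noteq> 0) (wr t 2) Skip) (rew t))))"

lemma srun_shift_mark:
  assumes s: "s t = ([6], marked n u)" "u < n"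
  shows "srun (shift_mark t) s (6 * n + 20) (s(t := ([6], marked n (Suc u))))"
proof -
  let ?r = "replicate (n - Suc u) (1::nat)"
  have 1: "srun (skip_to t (\<lambda>x. x = 2)) s (3 * length (replicate u (1::nat)) + 1) (s(t := (rev (replicate u 1) @ [6], 2 # ?r)))"
    by (rule srun_skip_to) (use s marked_split in auto)
  have 2: "srun (wr t 1) (s(t := (rev (replicate u 1) @ [6], 2 # ?r))) 1 (s(t := (rev (replicate u 1) @ [6], 1 # ?r)))"
    by (rule srun_wr') auto
  have 3: "srun (rt t) (s(t := (rev (replicate u 1) @ [6], 1 # ?r))) 1 (s(t := (rev (replicate (Suc u) 1) @ [6], ?r)))"
    by (rule srun_rt'[where x = 1 and l = "rev (replicate u 1) @ [6]" and r = ?r])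
       (auto simp: replicate_app_Cons_same)
  let ?s4 = "s(t := (rev (replicate (Suc u) 1) @ [6], if Suc u < n then 2 # replicate (n - Suc (Suc u)) 1 else []))"
  have 4: "srun (Cond (\<lambda>a. a t \<noteq> 0) (wr t 2) Skip) (s(t := (rev (replicate (Suc u) 1) @ [6], ?r))) (1 + 1) ?s4"
  proof (cases "Suc u < n")
    case True
    then have r: "replicate (n - Suc u) (Suc 0) = Suc 0 # replicate (n - Suc (Suc u)) (Suc 0)"
      by (metis Suc_diff_Suc replicate_Suc)
    show ?thesis
      by (rule srun_Cond_True[OF _ srun_wr']) (use True in \<open>auto simp: r\<close>)
  next
    case False
    then have "Suc u = n" using s(2) by simp
    then show ?thesis by (intro srun_Cond_False) (auto simp: srun_Skip)
  qed
  have 5: "srun (rew t) ?s4 (3 * length (replicate (Suc u) (1::nat)) + 5)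
     (?s4(t := ([6], replicate (Suc u) 1 @ (if Suc u < n then 2 # replicate (n - Suc (Suc u)) 1 else []))))"
    by (rule srun_rew) auto
  have m: "replicate (Suc u) 1 @ (if Suc u < n then 2 # replicate (n - Suc (Suc u)) 1 else []) = marked n (Suc u)"
  proof (cases "Suc u < n")
    case True
    then show ?thesis using marked_split[OF True] by simp
  next
    case False
    then have "Suc u = n" using s(2) by simp
    then show ?thesis using marked_none[of n "Suc u"] by simp
  qed
  show ?thesis unfolding shift_mark_def
    by (rule srun_eq[OF srun_Seq[OF 1 srun_Seq[OF 2 srun_Seq[OF 3 srun_Seq[OF 4 5]]]]])
       (use s in \<open>auto simp: m[symmetric] simp del: replicate_Suc\<close>)
qed

definition item_inputs :: "nat \<Rightarrow> nat \<Rightarrow> nat list" where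
  "item_inputs n u = filter (\<lambda>i. i div n = u \<or> i mod n = u) [0..<n * n] @ [n * n + u]"

definition write_item :: com where
  "write_item = Seq (For 5 (For 6 (visit (\<lambda>a. a 5 = 2 \<or> a 6 = 2)))) (Seq (For 5 (visit (\<lambda>a. a 5 = 2)))
     (Seq (ems 0 [2, 2]) (Seq (clear 7) (Seq (shift_mark 5) (shift_mark 6)))))"

text \<open>After the links the counter stands at \<open>n * n\<close>, the number of the first
  guard, so the second pass can go on from there. The mark moves to the next item at the
  end.\<close>

lemma srun_write_item:
  assumes s: "s 5 = ([6], marked n u)" "s 6 = ([6], marked n u)" and u: "u < n" and X: "n * n + n \<le> X"
  shows "srun write_item (counting s w 0) (n * (n * (16 * X + 30) + 14) + n * (16 * X + 30) + 12 * n + 8 * X + 100)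
     (counting (s(5 := ([6], marked n (Suc u)), 6 := ([6], marked n (Suc u)))) (w @ enc_list (item_inputs n u)) 0)"
proof -
  let ?\<phi> = "\<lambda>i. i div n = u \<or> i mod n = u"
  have inner: "srun (For 6 (visit (\<lambda>a. a 5 = 2 \<or> a 6 = 2))) (counting (s(5 := head_at (marked n u) j)) w' (0 + j * n))
      (n * (16 * X + 30) + 7)
      (counting (s(5 := head_at (marked n u) j)) (w' @ sel ?\<phi> (0 + j * n) (0 + Suc j * n)) (0 + Suc j * n))"
    if j: "j < n" for j w'
  proof -
    have le: "j * n + n \<le> X"
    proof -
      have "Suc j * n \<le> n * n" using j by (intro mult_le_mono1) simp
      then show ?thesis using X by simp
    qed
    have "srun (For 6 (visit (\<lambda>a. a 5 = 2 \<or> a 6 = 2))) (counting (s(5 := head_at (marked n u) j)) w' (j * n))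
      (length (marked n u) * (16 * X + 30) + 7)
      (counting (s(5 := head_at (marked n u) j)) (w' @ sel ?\<phi> (j * n) (j * n + length (marked n u))) (j * n + length (marked n u)))"
    proof (rule srun_For_visit)
      fix i w'' assume i: "i < length (marked n u)"
      have c: "cur (head_at (marked n u) j) = marked n u ! j" "cur (head_at (marked n u) i) = marked n u ! i"
        using i j by (simp_all add: cur_head_at)
      have "(j * n + i) div n = j" "(j * n + i) mod n = i" using i by auto
      then show "(scan (counting (s(5 := head_at (marked n u) j, 6 := head_at (marked n u) i)) w'' (j * n + i)) 5 = 2 \<or>
          scan (counting (s(5 := head_at (marked n u) j, 6 := head_at (marked n u) i)) w'' (j * n + i)) 6 = 2) = ?\<phi> (j * n + i)"
        using i j by (auto simp: c)
    qed (use s le in auto)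
    then show ?thesis by (rule srun_conv) (auto simp: add.commute)
  qed
  have "srun (For 5 (For 6 (visit (\<lambda>a. a 5 = 2 \<or> a 6 = 2)))) (counting s w 0)
      (length (marked n u) * ((n * (16 * X + 30) + 7) + 7) + 7)
      (counting s (w @ sel ?\<phi> 0 (0 + length (marked n u) * n)) (0 + length (marked n u) * n))"
    by (rule srun_For_count) (use s inner in auto)
  then have 1: "srun (For 5 (For 6 (visit (\<lambda>a. a 5 = 2 \<or> a 6 = 2)))) (counting s w 0) (n * (n * (16 * X + 30) + 14) + 7)
      (counting s (w @ sel ?\<phi> 0 (n * n)) (n * n))" by (rule srun_eq) auto
  let ?w1 = "w @ sel ?\<phi> 0 (n * n)"
  have "srun (For 5 (visit (\<lambda>a. a 5 = 2))) (counting s ?w1 (n * n)) (length (marked n u) * (16 * X + 30) + 7)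
      (counting s (?w1 @ sel (\<lambda>i. i = n * n + u) (n * n) (n * n + length (marked n u))) (n * n + length (marked n u)))"
  proof (rule srun_For_visit)
    fix i w'' assume i: "i < length (marked n u)"
    then have "cur (head_at (marked n u) i) = marked n u ! i" by (simp add: cur_head_at)
    then show "(scan (counting (s(5 := head_at (marked n u) i)) w'' (n * n + i)) 5 = 2) = (n * n + i = n * n + u)"
      using i by simp
  qed (use s X in auto)
  moreover have "sel (\<lambda>i. i = n * n + u) (n * n) (n * n + n) = enc_nat (n * n + u)"
  proof -
    have "[n * n..<n * n + n] = [n * n..<n * n + u] @ (n * n + u) # [Suc (n * n + u)..<n * n + n]"
      using u by (metis add_less_cancel_left le_add1 less_imp_le_nat upt_conv_Cons upt_add_eq_append le_Suc_ex add.assoc)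
    moreover have "filter (\<lambda>i. i = n * n + u) [n * n..<n * n + u] = []"
      "filter (\<lambda>i. i = n * n + u) [Suc (n * n + u)..<n * n + n] = []" by (auto simp: filter_empty_conv)
    ultimately show ?thesis by (simp add: sel_def)
  qed
  ultimately have 2: "srun (For 5 (visit (\<lambda>a. a 5 = 2))) (counting s ?w1 (n * n)) (n * (16 * X + 30) + 7)
      (counting s (?w1 @ enc_nat (n * n + u)) (n * n + n))" by simp
  let ?w2 = "(?w1 @ enc_nat (n * n + u)) @ [True, True]"
  have 4: "srun (clear 7) (counting s ?w2 (n * n + n)) (8 * X + 10) (counting s ?w2 0)"
    by (rule srun_reset[OF X])
  have 5: "srun (shift_mark 5) (counting s ?w2 0) (6 * n + 20) (counting (s(5 := ([6], marked n (Suc u)))) ?w2 0)"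
    by (rule srun_eq[OF srun_shift_mark[OF _ u]]) (use s in \<open>auto simp: counting_def fun_eq_iff\<close>)
  have 6: "srun (shift_mark 6) (counting (s(5 := ([6], marked n (Suc u)))) ?w2 0) (6 * n + 20)
      (counting (s(5 := ([6], marked n (Suc u)), 6 := ([6], marked n (Suc u)))) ?w2 0)"
    by (rule srun_eq[OF srun_shift_mark[OF _ u]]) (use s in \<open>auto simp: counting_def fun_eq_iff\<close>)
  show ?thesis unfolding write_item_def
    by (rule srun_eq[OF srun_Seq[OF 1 srun_Seq[OF 2 srun_Seq[OF srun_write_end srun_Seq[OF 4 srun_Seq[OF 5 6]]]]]])
       (auto simp: item_inputs_def enc_list_def sel_def)
qed

definition write_items :: com where
  "write_items = Seq (wr 5 2) (Seq (wr 6 2) (For 4 write_item))"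

text \<open>The mark starts at item 0; after the last item it has left the tapes, which are then
  plain unary copies of \<open>N\<close> again.\<close>

lemma srun_write_items:
  assumes s: "s 4 = ([6], replicate n 1)" "s 5 = ([6], replicate n 1)" "s 6 = ([6], replicate n 1)"
    and n: "0 < n" and X: "n * n + n \<le> X"
  shows "srun write_items (counting s w 0)
     (n * (n * (n * (16 * X + 30) + 14) + n * (16 * X + 30) + 12 * n + 8 * X + 107) + 12)
     (counting s (w @ concat (map (\<lambda>u. enc_list (item_inputs n u)) [0..<n])) 0)"
proof -
  define st where "st u = counting (s(5 := ([6], marked n u), 6 := ([6], marked n u)))
     (w @ concat (map (\<lambda>u. enc_list (item_inputs n u)) [0..<u])) 0" for u
  obtain n' where n': "n = Suc n'" using n by (cases n) auto
  have m0: "marked (Suc n') 0 = 2 # replicate n' 1" using marked_split[of 0 "Suc n'"] by simp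
  let ?s1 = "counting (s(5 := ([6], marked n 0))) w 0"
  have 1: "srun (wr 5 2) (counting s w 0) 1 ?s1"
    by (rule srun_wr'[where l = "[6]" and r = "replicate n 1"]) (use s in \<open>auto simp: m0 n' counting_def fun_eq_iff\<close>)
  have 2: "srun (wr 6 2) ?s1 1 (st 0)"
    by (rule srun_wr'[where l = "[6]" and r = "replicate n 1"]) (use s in \<open>auto simp: st_def m0 n' counting_def fun_eq_iff\<close>)
  let ?B = "n * (n * (16 * X + 30) + 14) + n * (16 * X + 30) + 12 * n + 8 * X + 100"
  have 3: "srun (For 4 write_item) (st 0) (length (replicate n (1::nat)) * (?B + 7) + 7) (st n)"
  proof (rule srun_For[where st = st])
    fix i assume "i < length (replicate n (1::nat))"
    then have i: "i < n" by simp
    let ?z = "(rev (take i (replicate n 1)) @ [6], drop i (replicate n 1)) :: zipper"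
    let ?w = "w @ concat (map (\<lambda>u. enc_list (item_inputs n u)) [0..<i])"
    have "srun write_item (counting (s(5 := ([6], marked n i), 6 := ([6], marked n i), 4 := ?z)) ?w 0) ?B
       (counting ((s(5 := ([6], marked n i), 6 := ([6], marked n i), 4 := ?z))(5 := ([6], marked n (Suc i)), 6 := ([6], marked n (Suc i))))
         (?w @ enc_list (item_inputs n i)) 0)"
      by (rule srun_write_item[OF _ _ i X]) auto
    then show "srun write_item ((st i)(4 := ?z)) ?B ((st (Suc i))(4 := ?z))"
      by (rule srun_conv) (auto simp: st_def counting_def fun_eq_iff)
  qed (use s in \<open>auto simp: st_def counting_def fun_eq_iff\<close>)
  have e: "st n = counting s (w @ concat (map (\<lambda>u. enc_list (item_inputs n u)) [0..<n])) 0"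
    using s by (auto simp: st_def marked_none counting_def fun_eq_iff)
  show ?thesis unfolding write_items_def
    by (rule srun_eq[OF srun_Seq[OF 1 srun_Seq[OF 2 3]] _ e]) (simp add: algebra_simps)
qed

text \<open>A pad is an empty item, so its head sees the marker 5 at once. The flag starts as 2,
  which stands for no clash.\<close>

definition clash_test :: com where
  "clash_test = Seq (wr 8 2) (Cond (\<lambda>a. a 2 \<noteq> 5 \<and> a 3 \<noteq> 5) (Seq compare_claims compare_claims) Skip)"

lemma item_string_props:
  "0 \<notin> set (item_string c)" "5 \<notin> set (item_string c)" "6 \<notin> set (item_string c)"
  "item_string c \<noteq> []" "hd (item_string c) \<noteq> 5"
proof -
  obtain v a w b where c: "c = (v, a, w, b)" by (cases c)
  show "0 \<notin> set (item_string c)" "5 \<notin> set (item_string c)" "6 \<notin> set (item_string c)" "item_string c \<noteq> []"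
    unfolding c by (auto simp: item_string_def claim_string_def sy_def)
  have "hd (item_string c) \<in> set (item_string c)" using \<open>item_string c \<noteq> []\<close> by (rule hd_in_set)
  then show "hd (item_string c) \<noteq> 5" using \<open>5 \<notin> set (item_string c)\<close> by metis
qed

lemma cur_item_string: "cur (zs, item_string c @ ys) \<noteq> 5"
  using item_string_props(4,5)[of c] by (cases "item_string c") auto

lemma bin_eq_iff: "bin m = bin n \<longleftrightarrow> m = n"
  using bin_inj by blast

lemma sys_eq_iff: "sys x = sys y \<longleftrightarrow> x = y"
  by (rule inj_map_eq_map) (simp add: inj_def)

lemma sys_bits: "set (sys x) \<subseteq> {1, 2}"
  by (auto simp: sy_def)

text \<open>On a pad the heads do not move, and otherwise they run to the end of their items; the
  existential splits cover both outcomes in the form that the item loop expects.\<close>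

lemma srun_clash_test:
  assumes s: "s 2 = (l, pos_string k I p @ 5 # r)" "s 3 = (l', pos_string k I q @ 5 # r')" "s 8 = ([], [])"
    and L: "length (pos_string k I p) \<le> L" "length (pos_string k I q) \<le> L"
  shows "\<exists>u v u' v'. pos_string k I p = u @ v \<and> pos_string k I q = u' @ v' \<and>
     srun clash_test s (40 * L + 50)
      (s(2 := (rev u @ l, v @ 5 # r), 3 := (rev u' @ l', v' @ 5 # r'),
         8 := ([], [if claims_clash k I p q then 1 else 2])))"
proof (cases "is_pad p \<or> is_pad q")
  case True
  let ?s1 = "s(8 := ([], [2]))"
  have 1: "srun (wr 8 2) s 1 ?s1" by (rule srun_wr') (use s in auto)
  have 2: "srun (Cond (\<lambda>a. a 2 \<noteq> 5 \<and> a 3 \<noteq> 5) (Seq compare_claims compare_claims) Skip) ?s1 (0 + 1) ?s1"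
    by (rule srun_Cond_False[OF _ srun_Skip]) (use s True in \<open>auto simp: pos_string_def\<close>)
  have "srun clash_test s (40 * L + 50)
      (s(2 := (rev [] @ l, pos_string k I p @ 5 # r), 3 := (rev [] @ l', pos_string k I q @ 5 # r'),
         8 := ([], [if claims_clash k I p q then 1 else 2])))"
    unfolding clash_test_def
    by (rule srun_eq[OF srun_Seq[OF 1 2]]) (use s True in \<open>auto simp: claims_clash_def fun_eq_iff\<close>)
  then show ?thesis by (intro exI[of _ "[]"] exI[of _ "pos_string k I p"] exI[of _ "pos_string k I q"] conjI) auto
next
  case False
  obtain v a w b where p: "claim k I (p div 16) = (v, a, w, b)" by (metis prod_cases4)
  obtain v' a' w' b' where q: "claim k I (q div 16) = (v', a', w', b')" by (metis prod_cases4)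
  let ?A = "claim_string (sys (bin v)) (replicate a 1)" let ?B = "claim_string (sys (bin w)) (sys (bin b))"
  let ?A' = "claim_string (sys (bin v')) (replicate a' 1)" let ?B' = "claim_string (sys (bin w')) (sys (bin b'))"
  have ps: "pos_string k I p = ?A @ ?B" "pos_string k I q = ?A' @ ?B'"
    using False p q by (simp_all add: pos_string_def item_string_def)
  let ?f = "if v = v' \<and> a \<noteq> a' then 1 else 2 :: nat"
  let ?g = "if claims_clash k I p q then 1 else 2 :: nat"
  let ?s1 = "s(8 := ([], [2]))"
  let ?s2 = "s(2 := (rev ?A @ l, ?B @ 5 # r), 3 := (rev ?A' @ l', ?B' @ 5 # r'), 8 := ([], [?f]))"
  let ?s3 = "s(2 := (rev ?B @ rev ?A @ l, 5 # r), 3 := (rev ?B' @ rev ?A' @ l', 5 # r'), 8 := ([], [?g]))"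
  have 1: "srun (wr 8 2) s 1 ?s1" by (rule srun_wr') (use s in auto)
  have rep: "replicate a (1::nat) = replicate a' 1 \<longleftrightarrow> a = a'" by (auto dest: arg_cong[of _ _ length])
  have lens: "length ?A \<le> L" "length ?B \<le> L" "length ?A' \<le> L" "length ?B' \<le> L" using L ps by auto
  have "srun compare_claims
     (s(2 := (l, ?A @ (?B @ 5 # r)), 3 := (l', ?A' @ (?B' @ 5 # r')), 8 := ([], [2]))) (20 * L + 20)
     (s(2 := (rev ?A @ l, ?B @ 5 # r), 3 := (rev ?A' @ l', ?B' @ 5 # r'),
        8 := ([], [if sys (bin v) = sys (bin v') \<and> replicate a 1 \<noteq> replicate a' (1::nat) then 1 else 2])))"
    by (rule srun_compare_claims) (use sys_bits lens in \<open>auto simp: claim_string_def\<close>)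
  then have 2: "srun compare_claims ?s1 (20 * L + 20) ?s2"
    by (rule srun_conv) (use s ps in \<open>auto simp: fun_eq_iff sys_eq_iff bin_eq_iff rep\<close>)
  have "srun compare_claims
     (s(2 := (rev ?A @ l, ?B @ (5 # r)), 3 := (rev ?A' @ l', ?B' @ (5 # r')), 8 := ([], [?f]))) (20 * L + 20)
     (s(2 := (rev ?B @ rev ?A @ l, 5 # r), 3 := (rev ?B' @ rev ?A' @ l', 5 # r'),
        8 := ([], [if sys (bin w) = sys (bin w') \<and> sys (bin b) \<noteq> sys (bin b') then 1 else ?f])))"
    by (rule srun_compare_claims) (use sys_bits lens in \<open>auto simp: claim_string_def\<close>)
  moreover have g: "(if sys (bin w) = sys (bin w') \<and> sys (bin b) \<noteq> sys (bin b') then 1 else ?f) = ?g"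
    using False by (auto simp: claims_clash_def p q clash_def sys_eq_iff bin_eq_iff)
  ultimately have 3: "srun compare_claims ?s2 (20 * L + 20) ?s3" by (simp only: g)
  have hds: "cur (l, pos_string k I p @ 5 # r) \<noteq> 5" "cur (l', pos_string k I q @ 5 # r') \<noteq> 5"
    using False by (simp_all add: pos_string_def cur_item_string)
  have 4: "srun (Cond (\<lambda>a. a 2 \<noteq> 5 \<and> a 3 \<noteq> 5) (Seq compare_claims compare_claims) Skip) ?s1
      (((20 * L + 20) + (20 * L + 20) + 1) + 1) ?s3"
    by (rule srun_Cond_True[OF _ srun_Seq[OF 2 3]]) (use s hds in auto)
  have "srun clash_test s (40 * L + 50)
      (s(2 := (rev (?A @ ?B) @ l, [] @ 5 # r), 3 := (rev (?A' @ ?B') @ l', [] @ 5 # r'), 8 := ([], [?g])))"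
    unfolding clash_test_def by (rule srun_eq[OF srun_Seq[OF 1 4]]) auto
  then show ?thesis using ps by (metis append_Nil2)
qed

text \<open>A comparison also moves through the item of the outer loop, so the head of tape 2 goes
  back to the symbol before that item, a marker 5 or the sentinel 6, and one step right. Clearing
  tape 8 restores the store required by the loop rule.\<close>

definition write_final :: com where
  "write_final = Seq (For_items 2 (For_items 3 (Seq clash_test (Seq (visit (\<lambda>a. a 8 = 1))
       (Seq (wr 8 0) (Seq (back_to 2 (\<lambda>x. x = 5 \<or> x = 6)) (rt 2)))))))
     (Seq (For_items 2 (visit (\<lambda>a. a 2 = 5))) (Seq (For 4 (visit (\<lambda>_. True))) (ems 0 [2, 2])))"

context game
begin

lemma srun_write_final:
  assumes s: "s 2 = ([6], items (pos_strings k I N))" "s 3 = ([6], items (pos_strings k I N))"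
      "s 4 = ([6], replicate N 1)" "s 8 = ([], [])"
    and X: "N * N + N + N \<le> X" and L: "\<And>p. p < N \<Longrightarrow> length (pos_string k I p) \<le> L"
  shows "srun write_final (counting s w 0)
     (N * (N * (43 * L + 16 * X + 99 + 6 * L) + 7 + 6 * L + 10) + N * (16 * X + 40 + 6 * L) + N * (16 * X + 30) + 40)
     (counting s (w @ enc_list (final_inputs N (claims_clash k I) is_pad)) (N * N + N + N))"
proof -
  let ?y = "pos_strings k I N"
  let ?\<phi> = "\<lambda>i. claims_clash k I (i div N) (i mod N)"
  have ly: "length ?y = N" by (simp add: pos_strings_def)
  have yi: "?y ! p = pos_string k I p" if "p < N" for p using that by (simp add: pos_strings_def)
  have yprops: "0 \<notin> set ys \<and> 5 \<notin> set ys \<and> 6 \<notin> set ys \<and> length ys \<le> L" if ys: "ys \<in> set ?y" for ys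
  proof -
    obtain p where "p < N" "ys = pos_string k I p" using ys by (auto simp: pos_strings_def)
    then show ?thesis using L[of p] item_string_props(1-3) by (auto simp: pos_string_def)
  qed
  let ?at = "\<lambda>p. (rev (items (take p ?y)) @ [6], items (drop p ?y)) :: zipper"
  have atd: "?at p = (rev (items (take p ?y)) @ [6], pos_string k I p @ 5 # items (drop (Suc p) ?y))" if "p < N" for p
    using items_drop[of p ?y] that yi ly by simp
  let ?c = "Seq clash_test (Seq (visit (\<lambda>a. a 8 = 1)) (Seq (wr 8 0) (Seq (back_to 2 (\<lambda>x. x = 5 \<or> x = 6)) (rt 2))))"
  have pair: "\<exists>u v. pos_string k I q = u @ v \<and>
      srun ?c (counting (s(2 := ?at p, 3 := ?at q)) w' (p * N + q)) (43 * L + 16 * X + 89)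
        (counting (s(2 := ?at p, 3 := (rev u @ rev (items (take q ?y)) @ [6], v @ 5 # items (drop (Suc q) ?y))))
          (w' @ sel ?\<phi> (p * N + q) (Suc (p * N + q))) (Suc (p * N + q)))"
    if p: "p < N" and q: "q < N" for p q w'
  proof -
    let ?i = "p * N + q"
    let ?s0 = "counting (s(2 := ?at p, 3 := ?at q)) w' ?i"
    let ?l = "rev (items (take p ?y)) @ [6]" let ?r = "items (drop (Suc p) ?y)"
    let ?l' = "rev (items (take q ?y)) @ [6]" let ?r' = "items (drop (Suc q) ?y)"
    let ?f = "if claims_clash k I p q then 1 else 2 :: nat"
    have "\<exists>u v u' v'. pos_string k I p = u @ v \<and> pos_string k I q = u' @ v' \<and>
       srun clash_test ?s0 (40 * L + 50)
        (?s0(2 := (rev u @ ?l, v @ 5 # ?r), 3 := (rev u' @ ?l', v' @ 5 # ?r'), 8 := ([], [?f])))"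
      by (rule srun_clash_test) (use s atd p q L in auto)
    then obtain u v u' v' where uv: "pos_string k I p = u @ v" "pos_string k I q = u' @ v'"
      and r1: "srun clash_test ?s0 (40 * L + 50)
        (?s0(2 := (rev u @ ?l, v @ 5 # ?r), 3 := (rev u' @ ?l', v' @ 5 # ?r'), 8 := ([], [?f])))" by blast
    let ?t = "s(2 := (rev u @ ?l, v @ 5 # ?r), 3 := (rev u' @ ?l', v' @ 5 # ?r'))"
    have 1: "srun clash_test ?s0 (40 * L + 50) (counting (?t(8 := ([], [?f]))) w' ?i)"
      by (rule srun_eq[OF r1]) (auto simp: counting_def fun_eq_iff)
    have "Suc p * N \<le> N * N" using p by (intro mult_le_mono1) simp
    then have iX: "?i < X" using X q by simp
    have dm: "?i div N = p" "?i mod N = q" using q by auto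
    have 2: "srun (visit (\<lambda>a. a 8 = 1)) (counting (?t(8 := ([], [?f]))) w' ?i) (16 * X + 23)
        (counting (?t(8 := ([], [?f]))) (w' @ sel ?\<phi> ?i (Suc ?i)) (Suc ?i))"
      by (rule srun_visit[OF iX]) (simp add: dm q)
    let ?w = "w' @ sel ?\<phi> ?i (Suc ?i)"
    have 3: "srun (wr 8 0) (counting (?t(8 := ([], [?f]))) ?w (Suc ?i)) 1 (counting ?t ?w (Suc ?i))"
      by (rule srun_eq[OF srun_erase]) (use s in \<open>auto simp: counting_def fun_eq_iff\<close>)
    obtain e l0 where e: "?l = e # l0" "e = 5 \<or> e = 6"
    proof (cases p)
      case 0
      then show ?thesis using that[of 6 "[]"] by simp
    next
      case (Suc p')
      then have "items (take p ?y) = items (take p' ?y) @ ?y ! p' @ [5]"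
        using items_snoc[of p' ?y] p ly by simp
      then show ?thesis using that[of 5] by simp
    qed
    have up: "5 \<notin> set u" "6 \<notin> set u" "length u \<le> L"
    proof -
      have "pos_string k I p \<in> set ?y" using p by (auto simp: pos_strings_def)
      then show "5 \<notin> set u" "6 \<notin> set u" "length u \<le> L" using yprops uv(1) by fastforce+
    qed
    have "srun (back_to 2 (\<lambda>x. x = 5 \<or> x = 6)) (counting ?t ?w (Suc ?i)) (3 * length (rev u) + 3)
        ((counting ?t ?w (Suc ?i))(2 := (l0, e # rev (rev u) @ v @ 5 # ?r)))"
    proof (rule srun_back_to)
      show "counting ?t ?w (Suc ?i) 2 = (rev u @ e # l0, v @ 5 # ?r)" using e(1) by simp
      show "\<not> (z = 5 \<or> z = 6)" if "z \<in> set (rev u)" for z using that up by auto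
    qed (rule e(2))
    then have 4: "srun (back_to 2 (\<lambda>x. x = 5 \<or> x = 6)) (counting ?t ?w (Suc ?i)) (3 * L + 3)
        (counting (?t(2 := (l0, e # u @ v @ 5 # ?r))) ?w (Suc ?i))"
      by (rule srun_eq) (use up in \<open>auto simp: counting_def fun_eq_iff\<close>)
    have 5: "srun (rt 2) (counting (?t(2 := (l0, e # u @ v @ 5 # ?r))) ?w (Suc ?i)) 1
        (counting (s(2 := ?at p, 3 := (rev u' @ ?l', v' @ 5 # ?r'))) ?w (Suc ?i))"
      by (rule srun_rt'[where x = e and l = l0 and r = "u @ v @ 5 # ?r"])
         (use e(1) uv atd[OF p] in \<open>auto simp: counting_def fun_eq_iff\<close>)
    have "srun ?c ?s0 (43 * L + 16 * X + 89) (counting (s(2 := ?at p, 3 := (rev u' @ ?l', v' @ 5 # ?r'))) ?w (Suc ?i))"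
      by (rule srun_mono[OF srun_Seq[OF 1 srun_Seq[OF 2 srun_Seq[OF 3 srun_Seq[OF 4 5]]]]]) simp
    then show ?thesis using uv(2) by blast
  qed
  have inner: "srun (For_items 3 ?c) (counting (s(2 := ?at p)) w' (p * N)) (N * ((43 * L + 16 * X + 89) + 6 * L + 10) + 7)
      (counting (s(2 := ?at p)) (w' @ sel ?\<phi> (p * N) (Suc p * N)) (Suc p * N))" if p: "p < N" for p w'
  proof -
    have "srun (For_items 3 ?c) (counting (s(2 := ?at p)) w' (p * N)) (length ?y * ((43 * L + 16 * X + 89) + 6 * L + 10) + 7)
      (counting (s(2 := ?at p)) (w' @ sel ?\<phi> (p * N) (p * N + length ?y * 1)) (p * N + length ?y * 1))"
    proof (rule srun_For_items_count[where yss = ?y and L = L])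
      fix q w'' assume "q < length ?y"
      then have q: "q < N" using ly by simp
      from pair[OF p q, of w''] show "\<exists>u v. ?y ! q = u @ v \<and>
        srun ?c (counting ((s(2 := ?at p))(3 := ?at q)) w'' (p * N + q * 1)) (43 * L + 16 * X + 89)
        (counting ((s(2 := ?at p))(3 := (rev u @ rev (items (take q ?y)) @ [6], v @ 5 # items (drop (Suc q) ?y))))
           (w'' @ sel ?\<phi> (p * N + q * 1) (p * N + Suc q * 1)) (p * N + Suc q * 1))"
        by (simp add: yi[OF q])
    qed (use s yprops in auto)
    then show ?thesis by (rule srun_conv) (auto simp: ly add.commute)
  qed
  have "srun (For_items 2 (For_items 3 ?c)) (counting s w 0)
      (length ?y * ((N * ((43 * L + 16 * X + 89) + 6 * L + 10) + 7) + 6 * L + 10) + 7)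
      (counting s (w @ sel ?\<phi> 0 (0 + length ?y * N)) (0 + length ?y * N))"
  proof (rule srun_For_items_count[where yss = ?y and L = L])
    fix p w' assume "p < length ?y"
    then have p: "p < N" using ly by simp
    show "\<exists>u v. ?y ! p = u @ v \<and>
        srun (For_items 3 ?c) (counting (s(2 := ?at p)) w' (0 + p * N)) (N * ((43 * L + 16 * X + 89) + 6 * L + 10) + 7)
        (counting (s(2 := (rev u @ rev (items (take p ?y)) @ [6], v @ 5 # items (drop (Suc p) ?y))))
           (w' @ sel ?\<phi> (0 + p * N) (0 + Suc p * N)) (0 + Suc p * N))"
      using inner[OF p, of w'] atd[OF p] by (intro exI[of _ "[]"] exI[of _ "?y ! p"]) (simp add: yi[OF p])
  qed (use s yprops in auto)
  then have 1: "srun (For_items 2 (For_items 3 ?c)) (counting s w 0)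
      (N * ((N * ((43 * L + 16 * X + 89) + 6 * L + 10) + 7) + 6 * L + 10) + 7)
      (counting s (w @ sel ?\<phi> 0 (N * N)) (N * N))" by (rule srun_eq) (auto simp: ly)
  let ?w1 = "w @ sel ?\<phi> 0 (N * N)"
  \<comment> \<open>The counter now runs through the guards, so position \<open>p\<close> shows up
    as \<open>N * N + p\<close>.\<close>
  let ?\<psi> = "\<lambda>i. is_pad (i - N * N)"
  have "srun (For_items 2 (visit (\<lambda>a. a 2 = 5))) (counting s ?w1 (N * N)) (length ?y * ((16 * X + 23) + 6 * L + 10) + 7)
      (counting s (?w1 @ sel ?\<psi> (N * N) (N * N + length ?y * 1)) (N * N + length ?y * 1))"
  proof (rule srun_For_items_count[where yss = ?y and L = L])
    fix p w' assume "p < length ?y"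
    then have p: "p < N" using ly by simp
    have c: "cur (?at p) = 5 \<longleftrightarrow> is_pad p"
      using atd[OF p] cur_item_string by (simp add: pos_string_def)
    have "srun (visit (\<lambda>a. a 2 = 5)) (counting (s(2 := ?at p)) w' (N * N + p)) (16 * X + 23)
        (counting (s(2 := ?at p)) (w' @ sel ?\<psi> (N * N + p) (Suc (N * N + p))) (Suc (N * N + p)))"
      by (rule srun_visit) (use p X c in auto)
    then show "\<exists>u v. ?y ! p = u @ v \<and>
        srun (visit (\<lambda>a. a 2 = 5)) (counting (s(2 := ?at p)) w' (N * N + p * 1)) (16 * X + 23)
        (counting (s(2 := (rev u @ rev (items (take p ?y)) @ [6], v @ 5 # items (drop (Suc p) ?y))))
           (w' @ sel ?\<psi> (N * N + p * 1) (N * N + Suc p * 1)) (N * N + Suc p * 1))"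
      using atd[OF p] by (intro exI[of _ "[]"] exI[of _ "?y ! p"]) (simp add: yi[OF p])
  qed (use s yprops in auto)
  then have 2: "srun (For_items 2 (visit (\<lambda>a. a 2 = 5))) (counting s ?w1 (N * N)) (N * ((16 * X + 23) + 6 * L + 10) + 7)
      (counting s (?w1 @ sel ?\<psi> (N * N) (N * N + N)) (N * N + N))" by (rule srun_eq) (auto simp: ly)
  let ?w2 = "?w1 @ sel ?\<psi> (N * N) (N * N + N)"
  have "srun (For 4 (visit (\<lambda>_. True))) (counting s ?w2 (N * N + N)) (length (replicate N (1::nat)) * (16 * X + 30) + 7)
      (counting s (?w2 @ sel (\<lambda>_. True) (N * N + N) (N * N + N + length (replicate N (1::nat)))) (N * N + N + length (replicate N (1::nat))))"
    by (rule srun_For_visit) (use s X in auto)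
  then have 3: "srun (For 4 (visit (\<lambda>_. True))) (counting s ?w2 (N * N + N)) (N * (16 * X + 30) + 7)
      (counting s (?w2 @ sel (\<lambda>_. True) (N * N + N) (N * N + N + N)) (N * N + N + N))" by simp
  let ?w3 = "?w2 @ sel (\<lambda>_. True) (N * N + N) (N * N + N + N)"
  have "filter ?\<psi> [N * N..<N * N + N] = map ((+) (N * N)) (filter is_pad [0..<N])"
  proof -
    have "[N * N..<N * N + N] = map ((+) (N * N)) [0..<N]" by (rule nth_equalityI) auto
    then show ?thesis by (simp add: filter_map o_def)
  qed
  then have e: "?w3 @ [True, True] = w @ enc_list (final_inputs N (claims_clash k I) is_pad)"
    by (simp add: sel_def enc_list_def final_inputs_def)
  show ?thesis unfolding write_final_def
    by (rule srun_eq[OF srun_Seq[OF 1 srun_Seq[OF 2 srun_Seq[OF 3 srun_write_end]]]])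
       (simp add: algebra_simps, simp only: e)
qed

text \<open>Three of the numbers in an item are copied from the input, the fourth is a label below
  \<open>k\<close> in unary, and 4 counts the separators.\<close>

lemma item_lengths:
  assumes p: "p < N"
  shows "length (pos_string k I p) \<le> 3 * length (enc_ug I) + k + 4"
proof (cases "is_pad p")
  case True
  then show ?thesis by (simp add: pos_string_def)
next
  case False
  have "p < 16 * (m * k)" using p by (simp add: ug_size_def)
  then have "p div 16 < m * k" by (simp add: less_mult_imp_div_less mult.commute)
  then have j: "p div 16 div k < m" by (simp add: less_mult_imp_div_less)
  let ?a = "p div 16 mod k"
  have a: "?a < k" using k by simp
  obtain v w \<pi> where e: "I ! (p div 16 div k) = (v, w, \<pi>)" "length \<pi> = k"
    "\<And>a. a < k \<Longrightarrow> claim k I ((p div 16 div k) * k + a) = (v, a, w, \<pi> ! a)"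
    by (rule edge[OF j]) (rule that, assumption+)
  have c: "claim k I (p div 16) = (v, ?a, w, \<pi> ! ?a)" using e(3)[OF a] by simp
  have lb: "length (bin x) \<le> length (enc_nat x)" for x
  proof -
    have "length (tag y) = 2 * length y" for y by (induction y) (auto simp: tag_def)
    then show ?thesis by (simp add: enc_nat_def)
  qed
  have en: "length (bin x) \<le> length (enc_ug I)" if x: "x \<in> set (v # w # \<pi>)" for x
  proof -
    have "length (enc_nat x) \<le> length (concat (map enc_nat (v # w # \<pi>)))"
      unfolding length_concat map_map by (rule member_le_sum_list) (use x in auto)
    also have "\<dots> \<le> length (enc_list (v # w # \<pi>))" by (simp add: enc_list_def)
    also have "\<dots> \<le> length (enc_ug I)"
    proof -
      have "enc_list (v # w # \<pi>) \<in> set edge_bits"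
        using e(1) j by (force simp: edge_bits_def in_set_conv_nth)
      then show ?thesis unfolding enc_ug_edge_bits by (auto simp: length_concat intro!: member_le_sum_list)
    qed
    finally show ?thesis using lb[of x] by linarith
  qed
  have "\<pi> ! ?a \<in> set \<pi>" using a e(2) by simp
  then have "length (bin v) \<le> length (enc_ug I)" "length (bin w) \<le> length (enc_ug I)"
    "length (bin (\<pi> ! ?a)) \<le> length (enc_ug I)" using en by auto
  then show ?thesis using False a by (simp add: pos_string_def c item_string_def claim_string_def)
qed

lemma edges_le_length: "m \<le> length (enc_ug I)"
proof -
  have "length es \<le> length (concat es)" if "\<forall>e\<in>set es. e \<noteq> []" for es :: "bool list list"
    using that
  proof (induction es)
    case (Cons e es)
    then show ?case by (cases e) auto
  qed simp
  moreover have "\<forall>e\<in>set edge_bits. e \<noteq> []" by (auto simp: edge_bits_def enc_list_def split: prod.splits)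
  ultimately have "length edge_bits \<le> length (enc_ug I)" unfolding enc_ug_edge_bits by blast
  then show ?thesis by (simp add: edge_bits_def)
qed

lemma enc_ug_graph:
  "enc_instance (ug_graph k I) (ug_budget k I) =
     enc_list [ug_budget k I] @ concat (replicate (N * N + N) [True, True]) @
     concat (map (\<lambda>u. enc_list (item_inputs N u)) [0..<N]) @ enc_list (final_inputs N (claims_clash k I) is_pad)"
  by (simp add: enc_instance_def enc_def ug_graph_def gadget_graph_def item_inputs_def o_def enc_list_def[of "[]"]
      flip: enc_list_def)

end

section \<open>The complete reduction and its consequence\<close>

definition work_tapes :: "nat list" where
  "work_tapes = [2, 3, 4, 5, 6, 7, 9, 10, 11, 12]"

definition reduction_prog :: "nat \<Rightarrow> com" where
  "reduction_prog k = Seq (sentinels work_tapes) (Seq (Loop (\<lambda>a. a 1 \<noteq> 0) (edge_prog k)) (Seq arrange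
     (Seq write_budget (Seq write_sources (Seq write_items write_final)))))"

definition reduction_time :: "nat \<Rightarrow> nat \<Rightarrow> nat \<Rightarrow> nat \<Rightarrow> nat \<Rightarrow> nat \<Rightarrow> nat" where
  "reduction_time k n m N X L = 100 + (m * (32 * k * (6 * X + 10) + k * (70 * n + 4 * k + 181) + 40 * n + 82) + 1)
     + (35 * (N * (L + 1)) + 3 * (8 * (m * k)) + 50) + (8 * (m * k) * (N * (6 * X + 16) + 14) + 24 * X + 60)
     + (N * (N * 11 + 14) + N * 11 + 20)
     + (N * (N * (N * (16 * X + 30) + 14) + N * (16 * X + 30) + 12 * N + 8 * X + 107) + 12)
     + (N * (N * (43 * L + 16 * X + 99 + 6 * L) + 7 + 6 * L + 10) + N * (16 * X + 40 + 6 * L) + N * (16 * X + 30) + 40)"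

context game
begin

lemma srun_reduction_prog:
  assumes X: "ug_budget k I \<le> X" "N * N + N + N \<le> X" and L: "\<And>p. p < N \<Longrightarrow> length (pos_string k I p) \<le> L"
  shows "\<exists>s'. srun (reduction_prog k) (start_store (enc_ug I)) (reduction_time k (length (enc_ug I)) m N X L) s' \<and>
     s' 0 = (rev (sys (enc_instance (ug_graph k I) (ug_budget k I))), [])"
proof -
  let ?n = "length (enc_ug I)"
  define b where "b t = (if t \<in> set work_tapes then ([6], []) else ([], []) :: zipper)" for t :: nat
  define c where "c = m * (32 * k - 1)"
  let ?P = "items (pos_strings k I N)"
  have tmem: "t \<in> set work_tapes \<longleftrightarrow> t \<in> {2, 3, 4, 5, 6, 7, 9, 10, 11, 12}" for t by (auto simp: work_tapes_def)
  have N: "N = 16 * (m * k)" by (simp add: ug_size_def)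
  have Npos: "0 < N" using m_pos k by (simp add: N)
  have budget: "c + 8 * (m * k) * N + 1 = ug_budget k I" by (simp add: ug_budget_def c_def)
  have 1: "srun (sentinels work_tapes) (start_store (enc_ug I)) 20 (parse_store b [] (enc_ug I) 0 0)"
    by (rule srun_eq[OF srun_sentinels])
       (auto simp: work_tapes_def b_def start_store_def parse_store_def pos_strings_def bin.simps[of 0] fun_eq_iff)
  have 2: "srun (Loop (\<lambda>a. a 1 \<noteq> 0) (edge_prog k)) (parse_store b [] (enc_ug I) 0 0)
     (m * (32 * k * (6 * X + 10) + k * (70 * ?n + 4 * k + 181) + 40 * ?n + 82) + 1)
     (parse_store b (enc_ug I) [] (m * k) c)"
    unfolding c_def by (rule srun_parse) (use X budget in \<open>auto simp: b_def work_tapes_def c_def\<close>)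
  have PN: "pos_strings k I (16 * (m * k)) = pos_strings k I N" by (simp add: N)
  have nP: "0 \<notin> set ?P" "6 \<notin> set ?P" using item_string_props by (auto simp: pos_strings_def pos_string_def)
  have five: "length (filter (\<lambda>x. x = 5) ?P) = N"
  proof -
    have "length (filter (\<lambda>x. x = 5) (items yss)) = length yss" if "\<forall>ys\<in>set yss. 5 \<notin> set ys" for yss :: "nat list list"
      using that by (induction yss) (auto simp: filter_empty_conv)
    moreover have "\<forall>ys\<in>set (pos_strings k I N). 5 \<notin> set ys"
      by (auto simp: pos_strings_def pos_string_def item_string_props(2))
    ultimately have "length (filter (\<lambda>x. x = 5) ?P) = length (pos_strings k I N)" by blast
    then show ?thesis by (simp add: pos_strings_def)
  qed
  have lP: "length ?P \<le> N * (L + 1)"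
  proof -
    have "length (items yss) \<le> length yss * (L + 1)" if "\<forall>ys\<in>set yss. length ys \<le> L" for yss :: "nat list list"
      using that by (induction yss) auto
    moreover have "\<forall>ys\<in>set (pos_strings k I N). length ys \<le> L" using L by (auto simp: pos_strings_def)
    ultimately show ?thesis by (metis length_map length_upt minus_nat.diff_0 pos_strings_def)
  qed
  define s where "s = b(1 := (rev (sys (enc_ug I)) @ [6], []), 2 := ([6], ?P), 3 := ([6], ?P),
     4 := ([6], replicate N 1), 5 := ([6], replicate N 1), 6 := ([6], replicate N 1), 12 := ([6], replicate (8 * (m * k)) 1))"
  have "srun arrange (parse_store b (enc_ug I) [] (m * k) c) (35 * length ?P + 3 * (8 * (m * k)) + 50)
     ((parse_store b (enc_ug I) [] (m * k) c)(2 := ([6], ?P), 3 := ([6], ?P), 4 := ([6], replicate N 1),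
        5 := ([6], replicate N 1), 6 := ([6], replicate N 1), 12 := ([6], replicate (8 * (m * k)) 1)))"
    by (rule srun_arrange[OF _ _ _ _ _ _ nP five[symmetric]]) (auto simp: parse_store_def b_def work_tapes_def PN)
  then have 3: "srun arrange (parse_store b (enc_ug I) [] (m * k) c) (35 * (N * (L + 1)) + 3 * (8 * (m * k)) + 50) (counting s [] c)"
    by (rule srun_eq) (use lP in \<open>auto simp: s_def parse_store_def counting_def b_def tmem out_def fun_eq_iff\<close>)
  have s: "s 2 = ([6], ?P)" "s 3 = ([6], ?P)" "s 4 = ([6], replicate N 1)" "s 5 = ([6], replicate N 1)"
    "s 6 = ([6], replicate N 1)" "s 12 = ([6], replicate (8 * (m * k)) 1)" "s 8 = ([], [])"
    by (auto simp: s_def b_def work_tapes_def)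
  have 4: "srun write_budget (counting s [] c) (8 * (m * k) * (N * (6 * X + 16) + 14) + 24 * X + 60)
     (counting s ([] @ enc_list [c + 8 * (m * k) * N + 1]) 0)"
    by (rule srun_write_budget[OF s(6,3)]) (use X budget in simp)
  let ?w4 = "[] @ enc_list [c + 8 * (m * k) * N + 1]"
  note 5 = srun_write_sources[OF s(3,4), of ?w4 0]
  let ?w5 = "?w4 @ concat (replicate (N * N + N) [True, True])"
  have X': "N * N + N \<le> X" using X by simp
  note 6 = srun_write_items[OF s(3-5) Npos X', of ?w5]
  let ?w6 = "?w5 @ concat (map (\<lambda>u. enc_list (item_inputs N u)) [0..<N])"
  note 7 = srun_write_final[OF s(1-3) s(7) X(2) L, of ?w6]
  let ?w7 = "?w6 @ enc_list (final_inputs N (claims_clash k I) is_pad)"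
  have "srun (reduction_prog k) (start_store (enc_ug I)) (reduction_time k ?n m N X L) (counting s ?w7 (N * N + N + N))"
    unfolding reduction_prog_def
    by (rule srun_mono[OF srun_Seq[OF 1 srun_Seq[OF 2 srun_Seq[OF 3 srun_Seq[OF 4 srun_Seq[OF 5 srun_Seq[OF 6 7]]]]]]])
       (simp_all add: reduction_time_def)
  moreover have "?w7 = enc_instance (ug_graph k I) (ug_budget k I)" by (simp only: budget append_Nil enc_ug_graph append_assoc)
  ultimately show ?thesis by (auto simp: out_def)
qed

end

lemma reduction_time_mono:
  "m \<le> m' \<Longrightarrow> N \<le> N' \<Longrightarrow> reduction_time k n m N X L \<le> reduction_time k n m' N' X L"
  unfolding reduction_time_def by (intro add_mono mult_le_mono order_refl) assumption+

text \<open>The definite description gives a function on all strings; on the encoding of a game it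
  is determined by \<open>enc_ug_inj\<close>.\<close>

definition reduce :: "nat \<Rightarrow> bool list \<Rightarrow> bool list" where
  "reduce k x = (let I = (THE I. x = enc_ug I) in enc_instance (ug_graph k I) (ug_budget k I))"

lemma enc_ug_inj: "enc_ug I = enc_ug I' \<Longrightarrow> I = I'"
proof -
  assume "enc_ug I = enc_ug I'"
  then have "map (\<lambda>(v, w, \<pi>). v # w # \<pi>) I = map (\<lambda>(v, w, \<pi>). v # w # \<pi>) I'"
    using enc_inj unfolding enc_ug_def by blast
  then show ?thesis by (rule list.inj_map_strong[rotated]) auto
qed

lemma reduce_enc_ug: "reduce k (enc_ug I) = enc_instance (ug_graph k I) (ug_budget k I)"
proof -
  have "(THE J. enc_ug I = enc_ug J) = I" by (rule the_equality) (auto dest: enc_ug_inj)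
  then show ?thesis by (simp add: reduce_def)
qed

lemma wf_reduction_prog: "wf_com 13 7 (reduction_prog k)"
  by (auto simp: reduction_prog_def work_tapes_def wf_edge_prog arrange_def duplicate_def write_budget_def
      write_sources_def write_items_def write_item_def shift_mark_def write_final_def clash_test_def)

lemma poly_time_reduce:
  assumes k: "0 < k"
  shows "poly_time_on {enc_ug I | I. is_unique_game k I} (reduce k)"
proof (rule poly_time_on_program[OF wf_reduction_prog])
  define NN where "NN n = 16 * (n * k)" for n
  \<comment> \<open>One bound for all counter values: the first summands cover
    \<open>ug_budget\<close>, the last ones the node numbers up to
    \<open>N * N + N + N\<close>.\<close>
  define XX where "XX n = 8 * (n * k) * NN n + n * (32 * k) + 1 + (NN n * NN n + NN n + NN n)" for n
  define LL where "LL n = 3 * n + k + 4" for n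
  show "poly_bound (\<lambda>n. reduction_time k n n (NN n) (XX n) (LL n))"
    unfolding reduction_time_def XX_def NN_def LL_def by (intro poly_bound_intros)
  fix x assume "x \<in> {enc_ug I | I. is_unique_game k I}"
  then obtain I where x: "x = enc_ug I" and I: "is_unique_game k I" by blast
  interpret game k I using I k by unfold_locales
  let ?n = "length x"
  have m: "m \<le> ?n" using edges_le_length x by simp
  have N: "N \<le> NN ?n" using m by (simp add: NN_def ug_size_def)
  have "N * N + N + N \<le> NN ?n * NN ?n + NN ?n + NN ?n" using N by (intro add_mono mult_le_mono)
  then have X2: "N * N + N + N \<le> XX ?n" by (simp add: XX_def)
  have "8 * (m * k) * N + m * (32 * k - 1) \<le> 8 * (?n * k) * NN ?n + ?n * (32 * k)"
    using m N by (intro add_mono mult_le_mono) auto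
  then have X1: "ug_budget k I \<le> XX ?n" by (simp add: ug_budget_def XX_def)
  have L: "length (pos_string k I p) \<le> LL ?n" if "p < N" for p
    using item_lengths[OF that] by (simp add: LL_def x)
  obtain s' where s': "srun (reduction_prog k) (start_store x) (reduction_time k ?n m N (XX ?n) (LL ?n)) s'"
    "s' 0 = (rev (sys (reduce k x)), [])"
    using srun_reduction_prog[OF X1 X2 L] unfolding x reduce_enc_ug by blast
  have "srun (reduction_prog k) (start_store x) (reduction_time k ?n ?n (NN ?n) (XX ?n) (LL ?n)) s'"
    by (rule srun_mono[OF s'(1) reduction_time_mono[OF m N]])
  then show "\<exists>s'. srun (reduction_prog k) (start_store x) (reduction_time k ?n ?n (NN ?n) (XX ?n) (LL ?n)) s' \<and>
      s' 0 = (rev (sys (reduce k x)), [])" using s'(2) by blast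
qed simp_all

theorem theorem7p1:
  fixes \<delta> :: real
  assumes "\<delta> < 2"
    and "class_P \<noteq> class_NP"
    and "UGC"
  shows "\<not> (\<exists>f. poly_time f \<and> approximates_pebbling \<delta> f)"
proof
  assume "\<exists>f. poly_time f \<and> approximates_pebbling \<delta> f"
  then obtain f where f: "poly_time f" "approximates_pebbling \<delta> f" by blast
  \<comment> \<open>Inequality of the classes gives a problem in NP outside P only together with
    this inclusion.\<close>
  have "class_P \<subseteq> class_NP"
  proof
    fix L assume "L \<in> class_P"
    then have "poly_time_on UNIV (\<lambda>x. [x \<in> L])" by (simp add: class_P_def poly_time_on_UNIV)
    from poly_time_on_comp[OF poly_time_decode[of UNIV] this]
    have "{z. decode z \<in> L} \<in> class_P" by (simp add: class_P_def poly_time_on_UNIV)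
    \<comment> \<open>Witnesses of length 0 suffice, since the verifier decides the instance by
      itself.\<close>
    moreover have "\<forall>x. x \<in> L \<longleftrightarrow> (\<exists>w. length w \<le> 0 * length x ^ 0 + 0 \<and> pair x w \<in> {z. decode z \<in> L})"
      by (simp add: decode_pair)
    ultimately show "L \<in> class_NP" unfolding class_NP_def by blast
  qed
  then obtain L where L: "L \<in> class_NP" "L \<notin> class_P" using assms(2) by blast
  \<comment> \<open>Since \<open>1/3 < 1 - 1/2\<close>, the two cases of the promise are told apart
    by whether the value reaches 1/2.\<close>
  let ?promise = "\<lambda>k. NP_hard_promise
       {enc_ug I | I. is_unique_game k I \<and> ug_value k I \<ge> 1 - 1/2}
       {enc_ug I | I. is_unique_game k I \<and> ug_value k I \<le> 1/3}"
  have "\<exists>k > 0. ?promise k"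
    using assms(3)[unfolded UGC_def, rule_format, of "1/2" "1/3"] by simp
  then obtain k where k: "0 < k" and hard: "?promise k" by (elim exE conjE)
  obtain g where g: "poly_time g"
    and yes: "\<And>x. x \<in> L \<Longrightarrow> g x \<in> {enc_ug I | I. is_unique_game k I \<and> ug_value k I \<ge> 1 - 1/2}"
    and no: "\<And>x. x \<notin> L \<Longrightarrow> g x \<in> {enc_ug I | I. is_unique_game k I \<and> ug_value k I \<le> 1/3}"
    using bspec[OF hard[unfolded NP_hard_promise_def] L(1)] by (elim exE conjE) simp
  \<comment> \<open>The first two conjuncts supply the domains on which \<open>reduce\<close> and
    \<open>zero_cost_bits\<close> are known to be computable in polynomial time.\<close>
  have decides: "g x \<in> {enc_ug I | I. is_unique_game k I} \<and> f (reduce k (g x)) \<in> range enc_pebbling \<and>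
      zero_cost_bits (f (reduce k (g x))) = [x \<in> L]" for x
  proof -
    obtain I where I: "g x = enc_ug I" "is_unique_game k I" and val: "ug_value k I \<ge> 1/2 \<longleftrightarrow> x \<in> L"
    proof (cases "x \<in> L")
      case True
      then show ?thesis using yes[OF True] that by auto
    next
      case False
      then obtain I where "g x = enc_ug I" "is_unique_game k I" "ug_value k I \<le> 1/3" using no by blast
      then show ?thesis using that False by force
    qed
    let ?V = "nodes (ug_graph k I)" and ?E = "edges (ug_graph k I)" and ?R = "ug_budget k I"
    obtain ss where ss: "f (reduce k (g x)) = enc_pebbling ss" "is_pebbling ?V ?E ?R ss"
      "real (cost ss) \<le> \<delta> * real (opt_cost ?V ?E ?R)"
      using f(2) ug_graph_is_dag ug_graph_pebbling_exists[OF I(2) k]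
      unfolding approximates_pebbling_def I(1) reduce_enc_ug by blast
    have "cost ss = 0 \<longleftrightarrow> x \<in> L"
    proof
      assume "cost ss = 0"
      then show "x \<in> L" using free_pebbling_imp_ug_value_high[OF I(2) k ss(2)] val by blast
    next
      assume "x \<in> L"
      then obtain ss' where "is_pebbling ?V ?E ?R ss'" "cost ss' = 0"
        using ug_value_high_imp_free_pebbling[OF I(2) k] val by blast
      then have "opt_cost ?V ?E ?R \<le> 0" unfolding opt_cost_def by (intro Least_le) blast
      then show "cost ss = 0" using ss(3) by simp
    qed
    then show ?thesis using I ss(1) by (auto simp: zero_cost_bits_enc)
  qed
  have "poly_time_on UNIV (\<lambda>x. reduce k (g x))"
    using poly_time_on_comp[of UNIV g, OF _ poly_time_reduce[OF k]] g decides by (simp add: poly_time_on_UNIV)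
  then have "poly_time_on UNIV (\<lambda>x. f (reduce k (g x)))"
    using poly_time_on_comp[of UNIV "\<lambda>x. reduce k (g x)" UNIV f] f(1) by (simp add: poly_time_on_UNIV)
  then have "poly_time_on UNIV (\<lambda>x. zero_cost_bits (f (reduce k (g x))))"
    using decides by (intro poly_time_on_comp[OF _ poly_time_zero_cost_bits]) auto
  then have "L \<in> class_P" using decides by (simp add: class_P_def poly_time_on_UNIV)
  then show False using L(2) by blast
qed

end
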